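(* Fix $\alpha \in (0,1)$ and let $f_r, f_s$ be functions with $f_r(n) = o(n)$ and $f_s(n) = o(n)$, such that $\alpha n + f_r(n)$ and $\alpha^2 n + f_s(n)$ are nonnegative integers for all $n$. Let $G_n = G(n, \alpha n + f_r(n), \alpha^2 n + f_s(n))$, $d_n = d(G_n)$ and $N_n = \binom{n}{\alpha n + f_r(n)}$ (the number of vertices of $G_n$). Then: 1. For any constant $0 < c < 1$, with high probability all connected components of $G_n(c/d_n)$ have size $O(\log N_n)$. 2. For any constant $c > 1$, with high probability $G_n(c/d_n)$ has a connected component of size $(1+o(1))\left(1 - \frac{\bar c}{c}\right) N_n$, where $\bar c$ is the solution of $x e^{-x} = c e^{-c}$ different from $c$; moreover, with high probability all other components of $G_n(c/d_n)$ have size $O(\log N_n)$.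
   Context: For integers $n, r, s$, the Johnson graph $G(n,r,s)$ has as vertices all vectors $v \in \{0,1\}^n$ with exactly $r$ coordinates equal to $1$, and two vertices are adjacent if and only if the inner product of the corresponding vectors equals $s$. This graph is regular; $d(G)$ denotes the common degree of a regular graph $G$. For a graph $G$ and $p \in [0,1]$, $G(p)$ denotes the random subgraph of $G$ on the same vertex set obtained by keeping each edge independently with probability $p$ (removing it with probability $1-p$). A sequence of events $Q_n$ holds with high probability if $\mathbf{P}(Q_n) \to 1$ as $n \to \infty$. *)

theory Defs
  imports "HOL-Probability.Product_PMF" "HOL-Library.Landau_Symbols"
begin

text \<open>A graph is a pair of a vertex set and a set of edges; an edge is a two-element set of
  vertices.\<close>

type_synonym 'a graph = "'a set \<times> 'a set set"

abbreviation verts :: "'a graph \<Rightarrow> 'a set" where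
  "verts G \<equiv> fst G"

abbreviation edges :: "'a graph \<Rightarrow> 'a set set" where
  "edges G \<equiv> snd G"

definition degree :: "'a graph \<Rightarrow> 'a \<Rightarrow> nat" where
  "degree G v = card {e \<in> edges G. v \<in> e}"

text \<open>Meaningful only for regular graphs with at least one vertex.\<close>

definition regular_degree :: "'a graph \<Rightarrow> nat" where
  "regular_degree G = (THE d. \<forall>v\<in>verts G. degree G v = d)"

definition connected_components :: "'a graph \<Rightarrow> 'a set set" where
  "connected_components G =
     verts G // {(u, v). u \<in> verts G \<and> v \<in> verts G \<and> (u, v) \<in> {(x, y). {x, y} \<in> edges G}\<^sup>*}"

text \<open>The vectors in \<open>{0,1}\<^sup>n\<close> are the extensional functions from \<open>{..<n}\<close> to \<open>{0,1}\<close>,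
  so that different functions are different vectors.\<close>

definition johnson_verts :: "nat \<Rightarrow> nat \<Rightarrow> (nat \<Rightarrow> nat) set" where
  "johnson_verts n r = {v \<in> {..<n} \<rightarrow>\<^sub>E {0, 1}. card {i \<in> {..<n}. v i = 1} = r}"

text \<open>The condition \<open>u \<noteq> v\<close> only matters for \<open>s = r\<close>, where it excludes loops.\<close>

definition johnson_graph :: "nat \<Rightarrow> nat \<Rightarrow> nat \<Rightarrow> (nat \<Rightarrow> nat) graph" where
  "johnson_graph n r s =
     (johnson_verts n r,
      {{u, v} | u v. u \<in> johnson_verts n r \<and> v \<in> johnson_verts n r \<and> u \<noteq> v \<and>
                     (\<Sum>i<n. u i * v i) = s})"

text \<open>For a graph with finitely many edges. Outside \<open>[0,1]\<close>, the parameter of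
  \<open>bernoulli_pmf\<close> is clamped to that interval.\<close>

definition random_subgraph :: "'a graph \<Rightarrow> real \<Rightarrow> 'a graph pmf" where
  "random_subgraph G p =
     map_pmf (\<lambda>keep. (verts G, {e \<in> edges G. keep e}))
       (Pi_pmf (edges G) False (\<lambda>_. bernoulli_pmf p))"

definition with_high_probability :: "(nat \<Rightarrow> 'a pmf) \<Rightarrow> (nat \<Rightarrow> 'a \<Rightarrow> bool) \<Rightarrow> bool" where
  "with_high_probability M Q \<longleftrightarrow>
     (\<lambda>n. measure_pmf.prob (M n) {x. Q n x}) \<longlonglongrightarrow> 1"

text \<open>For \<open>c > 1\<close> the real equation \<open>x e\<^sup>-\<^sup>x = c e\<^sup>-\<^sup>c\<close> has exactly one solution other than \<open>c\<close>,
  and that solution lies in \<open>(0,1)\<close>.\<close>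

definition conjugate_solution :: "real \<Rightarrow> real" where
  "conjugate_solution c = (THE x. x * exp (- x) = c * exp (- c) \<and> x \<noteq> c)"

end

theory Submission
  imports Defs
begin

text \<open>The theorem holds for every sequence of \<open>d\<close>-regular graphs on \<open>N\<close> vertices with
  \<open>d, N \<rightarrow> \<infinity>\<close> whose nontrivial eigenvalues are \<open>o(d)\<close>.

  For Johnson graphs, products of differences of coordinates \<open>x\<^sub>a - x\<^sub>b\<close> over disjoint pairs are
  eigenfunctions and span all functions. The eigenvalue divided by \<open>d\<close> is the expectation of such a
  product at a random neighbour, where the coordinates behave like independent Bernoulli variables
  of the same mean \<open>\<alpha>\<close>: it tends to \<open>0\<close> for a bounded number of pairs, and for many pairs it is at
  most the probability \<open>(2\<alpha>(1 - \<alpha>))\<^sup>j\<close> that all pairs are split. The eigenvalue bound gives the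
  expander mixing lemma.

  Exposing a component edge by edge bounds \<open>E[z^|C| \<theta>^|\<partial>C|]\<close> for the component \<open>C\<close> of a vertex.
  For \<open>c < 1\<close> this makes \<open>|C|\<close> exponentially small in probability; for \<open>c > 1\<close>, since sets of size
  at most \<open>\<delta>N\<close> have boundary close to \<open>d|C|\<close>, no component has size between \<open>O(log N)\<close> and \<open>\<delta>N\<close>.
  The same exposure and a second moment computation show that the fraction of vertices in small
  components tends to the extinction probability \<open>q = exp(- c(1 - q))\<close> of the Poisson branching
  process. All components larger than \<open>\<delta>N\<close> are merged by sprinkling a few additional edges, since
  mixing provides linearly many (in \<open>dN\<close>) edges between any two large sets.\<close>

section \<open>Percolation on a finite edge set\<close>

text \<open>The exploration lemmas weigh a partly explored set \<open>S\<close> by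
  \<open>z ^ card S * B ^ card (boundary E S)\<close>, where \<open>B\<close> is the price of an
  unexposed edge. The equations \<open>B = p y + (1 - p) \<theta>\<close> and
  \<open>y = z B ^ d\<close> are those of the generating function of a branching process. With
  \<open>p = c / d\<close>, \<open>\<theta> = 1\<close> and large \<open>d\<close> they read
  \<open>z = y exp (c (1 - y))\<close>, largest at \<open>y = 1 / c\<close>: hence the base
  \<open>exp (c - 1) / c\<close> of the tails. For \<open>c > 1\<close> this optimum has
  \<open>B < 1\<close>, where an upper bound on degrees no longer bounds the weight from above. The
  boundary factor is the way round: \<open>\<theta> > 1\<close> pushes \<open>B\<close> above 1, and
  the large boundary of a set of at most \<open>\<delta> N\<close> vertices pays for the smaller
  \<open>z\<close>. Sprinkling shows only that some component is nearly as large as expected; its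
  asymptotic size comes from counting the vertices in large components at \<open>c\<close> itself.
  Errors are fixed tolerances until the very end. Since \<open>t = exp (- c (1 - t))\<close> becomes
  \<open>x exp (- x) = c exp (- c)\<close> for \<open>x = c t\<close>, the extinction probability is
  \<open>conjugate_solution c / c\<close>.\<close>

definition pexp :: "'e set \<Rightarrow> real \<Rightarrow> ('e set \<Rightarrow> real) \<Rightarrow> real" where
  "pexp E p f = (\<Sum>F\<in>Pow E. p ^ card F * (1 - p) ^ card (E - F) * f F)"

lemma pexp_empty [simp]: "pexp {} p f = f {}"
  by (simp add: pexp_def)

lemma pexp_insert:
  assumes "finite E" "e \<notin> E"
  shows "pexp (insert e E) p f = p * pexp E p (\<lambda>F. f (insert e F)) + (1 - p) * pexp E p f"
proof -
  have fin: "finite (Pow E)" using assms by simp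
  have disj: "Pow E \<inter> insert e ` Pow E = {}" using assms by auto
  have inj: "inj_on (insert e) (Pow E)" using assms by (auto simp: inj_on_def)
  have "pexp (insert e E) p f = (\<Sum>F\<in>Pow E. p ^ card F * (1 - p) ^ card (insert e E - F) * f F)
     + (\<Sum>F\<in>insert e ` Pow E. p ^ card F * (1 - p) ^ card (insert e E - F) * f F)"
    unfolding pexp_def Pow_insert by (rule sum.union_disjoint) (use fin disj in auto)
  also have "(\<Sum>F\<in>Pow E. p ^ card F * (1 - p) ^ card (insert e E - F) * f F) = (1 - p) * pexp E p f"
    unfolding pexp_def sum_distrib_left
  proof (rule sum.cong, simp)
    fix F assume F: "F \<in> Pow E"
    then have "e \<notin> F" using assms by auto
    then have "insert e E - F = insert e (E - F)" by auto
    then have "card (insert e E - F) = Suc (card (E - F))" using assms by simp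
    then show "p ^ card F * (1 - p) ^ card (insert e E - F) * f F
      = (1 - p) * (p ^ card F * (1 - p) ^ card (E - F) * f F)" by simp
  qed
  also have "(\<Sum>F\<in>insert e ` Pow E. p ^ card F * (1 - p) ^ card (insert e E - F) * f F)
     = p * pexp E p (\<lambda>F. f (insert e F))"
    unfolding pexp_def sum_distrib_left sum.reindex[OF inj] o_def
  proof (rule sum.cong, simp)
    fix F assume F: "F \<in> Pow E"
    then have "e \<notin> F" "finite F" using assms finite_subset by auto
    then have "card (insert e F) = Suc (card F)" by simp
    moreover have "insert e E - insert e F = E - F" using assms F by auto
    ultimately show "p ^ card (insert e F) * (1 - p) ^ card (insert e E - insert e F) * f (insert e F)
      = p * (p ^ card F * (1 - p) ^ card (E - F) * f (insert e F))" by simp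
  qed
  finally show ?thesis by simp
qed

lemma pexp_remove:
  assumes "finite E" "e \<in> E"
  shows "pexp E p f = p * pexp (E - {e}) p (\<lambda>F. f (insert e F)) + (1 - p) * pexp (E - {e}) p f"
  using pexp_insert[of "E - {e}" e p f] assms by (simp add: insert_absorb)

lemma pexp_mono:
  assumes "0 \<le> p" "p \<le> 1" "\<And>F. F \<subseteq> E \<Longrightarrow> f F \<le> g F"
  shows "pexp E p f \<le> pexp E p g"
  unfolding pexp_def using assms by (intro sum_mono mult_left_mono) auto

lemma pexp_cong:
  assumes "\<And>F. F \<subseteq> E \<Longrightarrow> f F = g F"
  shows "pexp E p f = pexp E p g"
  unfolding pexp_def using assms by (intro sum.cong) auto

lemma pexp_const: "finite E \<Longrightarrow> pexp E p (\<lambda>_. a) = a"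
  by (induction E rule: finite_induct) (auto simp: pexp_insert algebra_simps)

lemma pexp_cmult: "pexp E p (\<lambda>F. a * f F) = a * pexp E p f"
  unfolding pexp_def sum_distrib_left by (rule sum.cong) auto

lemma pexp_add: "pexp E p (\<lambda>F. f F + g F) = pexp E p f + pexp E p g"
  unfolding pexp_def by (simp add: algebra_simps sum.distrib)

lemma pexp_diff: "pexp E p (\<lambda>F. f F - g F) = pexp E p f - pexp E p g"
  unfolding pexp_def by (simp add: algebra_simps sum_subtractf)

lemma pexp_sum: "pexp E p (\<lambda>F. \<Sum>i\<in>I. f i F) = (\<Sum>i\<in>I. pexp E p (f i))"
  unfolding pexp_def sum_distrib_left by (rule sum.swap)

lemma pexp_nonneg:
  assumes "0 \<le> p" "p \<le> 1" "\<And>F. F \<subseteq> E \<Longrightarrow> 0 \<le> f F"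
  shows "0 \<le> pexp E p f"
  unfolding pexp_def using assms by (intro sum_nonneg mult_nonneg_nonneg) auto

text \<open>An element is absent from the union of two independent random sets exactly when both
  miss it, so the absence probabilities multiply. Sprinkling rests on this two-round
  exposure.\<close>

lemma pexp_sprinkle:
  assumes "finite E" "1 - p = (1 - p1) * (1 - p2)"
  shows "pexp E p f = pexp E p1 (\<lambda>F1. pexp E p2 (\<lambda>F2. f (F1 \<union> F2)))"
  using assms(1)
proof (induction E arbitrary: f rule: finite_induct)
  case empty
  then show ?case by simp
next
  case (insert e E)
  have p: "p = p1 + p2 - p1 * p2" using assms(2) by (simp add: algebra_simps)
  have "pexp E p1 (\<lambda>F1. pexp (insert e E) p2 (\<lambda>F2. f (F1 \<union> F2))) =
     p2 * pexp E p (\<lambda>F. f (insert e F)) + (1 - p2) * pexp E p f"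
    using insert by (simp add: pexp_insert pexp_add pexp_cmult)
  moreover have "pexp E p1 (\<lambda>F1. pexp (insert e E) p2 (\<lambda>F2. f (insert e F1 \<union> F2))) =
     pexp E p (\<lambda>F. f (insert e F))"
    using insert by (simp add: pexp_insert pexp_add pexp_cmult algebra_simps)
  ultimately have "pexp (insert e E) p1 (\<lambda>F1. pexp (insert e E) p2 (\<lambda>F2. f (F1 \<union> F2)))
    = p1 * pexp E p (\<lambda>F. f (insert e F)) +
      (1 - p1) * (p2 * pexp E p (\<lambda>F. f (insert e F)) + (1 - p2) * pexp E p f)"
    by (subst pexp_insert[OF insert.hyps]) simp
  also have "\<dots> = pexp (insert e E) p f"
    unfolding pexp_insert[OF insert.hyps] p by (simp add: algebra_simps)
  finally show ?case by simp
qed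

abbreviation pprob :: "'e set \<Rightarrow> real \<Rightarrow> ('e set \<Rightarrow> bool) \<Rightarrow> real" where
  "pprob E p Q \<equiv> pexp E p (\<lambda>F. of_bool (Q F))"

lemma pprob_markov:
  assumes "0 \<le> p" "p \<le> 1" "\<And>F. F \<subseteq> E \<Longrightarrow> 0 \<le> f F" "0 < a"
    and "\<And>F. F \<subseteq> E \<Longrightarrow> Q F \<Longrightarrow> a \<le> f F"
  shows "pprob E p Q \<le> pexp E p f / a"
proof -
  have "a * pprob E p Q \<le> pexp E p f"
    unfolding pexp_cmult[symmetric] using assms by (intro pexp_mono) auto
  then show ?thesis using assms(4) by (simp add: field_simps)
qed

lemma pprob_union_bound:
  assumes "0 \<le> p" "p \<le> 1" "finite I" "\<And>F. F \<subseteq> E \<Longrightarrow> Q F \<Longrightarrow> \<exists>i\<in>I. R i F"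
  shows "pprob E p Q \<le> (\<Sum>i\<in>I. pprob E p (R i))"
proof -
  have "pprob E p Q \<le> pexp E p (\<lambda>F. \<Sum>i\<in>I. of_bool (R i F))"
  proof (rule pexp_mono[OF assms(1,2)])
    fix F assume F: "F \<subseteq> E"
    show "of_bool (Q F) \<le> (\<Sum>i\<in>I. of_bool (R i F) :: real)"
    proof (cases "Q F")
      case True
      then obtain i where i: "i \<in> I" "R i F" using assms(4) F by blast
      then have "(of_bool (R i F) :: real) \<le> (\<Sum>i\<in>I. of_bool (R i F))"
        by (intro member_le_sum) (use assms(3) in auto)
      then show ?thesis using i True by simp
    qed (auto intro: sum_nonneg)
  qed
  then show ?thesis by (simp add: pexp_sum)
qed

lemma pprob_compl: "finite E \<Longrightarrow> pprob E p (\<lambda>F. \<not> Q F) = 1 - pprob E p Q"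
  using pexp_diff[of E p "\<lambda>_. 1" "\<lambda>F. of_bool (Q F)"] by (simp add: pexp_const of_bool_not_iff)

text \<open>Translates product measures into the finite sums \<open>pexp\<close>, where later
  arguments are inductions over edges or termwise comparisons.\<close>

lemma expectation_Pi_bernoulli:
  assumes "finite E" "0 \<le> p" "p \<le> 1"
  shows "measure_pmf.expectation (Pi_pmf E False (\<lambda>_. bernoulli_pmf p)) (\<lambda>k. f {e \<in> E. k e}) = pexp E p f"
  using assms(1)
proof (induction E arbitrary: f rule: finite_induct)
  case empty
  then show ?case by simp
next
  case (insert e E)
  let ?M = "Pi_pmf E False (\<lambda>_. bernoulli_pmf p)"
  have fin: "finite (set_pmf ?M)"
    using insert.hyps by (intro finite_subset[OF set_Pi_pmf_subset'] finite_PiE_dflt) auto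
  have *: "Pi_pmf (insert e E) False (\<lambda>_. bernoulli_pmf p) =
    bind_pmf (bernoulli_pmf p) (\<lambda>b. map_pmf (\<lambda>k. k(e := b)) ?M)"
    using Pi_pmf_insert'[OF insert.hyps, of False "\<lambda>_. bernoulli_pmf p"]
    by (simp add: map_pmf_def)
  have "measure_pmf.expectation (Pi_pmf (insert e E) False (\<lambda>_. bernoulli_pmf p)) (\<lambda>k. f {x \<in> insert e E. k x})
    = (\<Sum>b\<in>UNIV. pmf (bernoulli_pmf p) b * measure_pmf.expectation (map_pmf (\<lambda>k. k(e := b)) ?M) (\<lambda>k. f {x \<in> insert e E. k x}))"
    unfolding * using fin by (subst pmf_expectation_bind[where A = UNIV]) auto
  also have "\<dots> = p * measure_pmf.expectation ?M (\<lambda>k. f (insert e {x \<in> E. k x})) +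
     (1 - p) * measure_pmf.expectation ?M (\<lambda>k. f {x \<in> E. k x})"
  proof -
    have 1: "{x. x \<noteq> e \<longrightarrow> x \<in> E \<and> k x} = insert e {x \<in> E. k x}" for k
      by auto
    have 2: "{x. x \<noteq> e \<and> (x \<noteq> e \<longrightarrow> x \<in> E \<and> k x)} = {x \<in> E. k x}" for k
      using insert.hyps by auto
    show ?thesis using assms by (simp add: UNIV_bool 1 2)
  qed
  also have "\<dots> = pexp (insert e E) p f"
    using insert.IH[of "\<lambda>F. f (insert e F)"] insert.IH[of f] insert.hyps by (simp add: pexp_insert)
  finally show ?case .
qed

lemma prob_random_subgraph:
  assumes "finite (edges G)" "0 \<le> p" "p \<le> 1"
  shows "measure_pmf.prob (random_subgraph G p) {H. Q H} = pprob (edges G) p (\<lambda>F. Q (verts G, F))"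
proof -
  let ?M = "Pi_pmf (edges G) False (\<lambda>_. bernoulli_pmf p)"
  have "measure_pmf.prob (random_subgraph G p) {H. Q H} =
      measure_pmf.prob ?M {k. Q (verts G, {e \<in> edges G. k e})}"
    unfolding random_subgraph_def by (simp add: measure_map_pmf vimage_def)
  also have "\<dots> = measure_pmf.expectation ?M (\<lambda>k. of_bool (Q (verts G, {e \<in> edges G. k e})))"
  proof -
    let ?A = "{k. Q (verts G, {e \<in> edges G. k e})}"
    have "measure_pmf.prob ?M ?A = measure_pmf.expectation ?M (indicator ?A)"
      by simp
    also have "indicator ?A = (\<lambda>k. of_bool (Q (verts G, {e \<in> edges G. k e})) :: real)"
      by (auto simp: indicator_def)
    finally show ?thesis .
  qed
  also have "\<dots> = pprob (edges G) p (\<lambda>F. Q (verts G, F))"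
    by (rule expectation_Pi_bernoulli[OF assms])
  finally show ?thesis .
qed

section \<open>Exploring a component\<close>

text \<open>The start is a set, not a vertex: the exploration absorbs the far end of an open edge by
  enlarging the start.\<close>

definition reach :: "'a set set \<Rightarrow> 'a set \<Rightarrow> 'a set" where
  "reach F S = {(x, y). {x, y} \<in> F}\<^sup>* `` S"

abbreviation comp_size :: "'a set set \<Rightarrow> 'a \<Rightarrow> nat" where
  "comp_size F v \<equiv> card (reach F {v})"

lemma reach_superset: "S \<subseteq> reach F S"
  by (auto simp: reach_def)

lemma reach_step: "x \<in> reach F S \<Longrightarrow> {x, y} \<in> F \<Longrightarrow> y \<in> reach F S"
  by (auto simp: reach_def intro: rtrancl_into_rtrancl)

lemma reach_least:
  assumes "S \<subseteq> T" "\<And>x y. x \<in> T \<Longrightarrow> {x, y} \<in> F \<Longrightarrow> y \<in> T"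
  shows "reach F S \<subseteq> T"
proof
  fix y assume "y \<in> reach F S"
  then obtain x where x: "x \<in> S" "(x, y) \<in> {(x, y). {x, y} \<in> F}\<^sup>*" by (auto simp: reach_def)
  from x(2) show "y \<in> T"
    by (induction rule: rtrancl_induct) (use assms x(1) in auto)
qed

lemma reach_mono: "F \<subseteq> F' \<Longrightarrow> S \<subseteq> S' \<Longrightarrow> reach F S \<subseteq> reach F' S'"
  by (rule reach_least) (use reach_superset[of S' F'] reach_step[of _ F' S'] in blast)+

text \<open>An open edge leaving \<open>S\<close> can be traded for its far end: once both ends are
  in the start set, the edge adds nothing. This lets the induction delete every exposed
  edge.\<close>

lemma reach_insert_edge:
  assumes "a \<in> S"
  shows "reach (insert {a, b} F) S = reach F (insert b S)"
proof
  show "reach (insert {a, b} F) S \<subseteq> reach F (insert b S)"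
  proof (rule reach_least)
    show "S \<subseteq> reach F (insert b S)" using reach_superset[of "insert b S" F] by auto
    fix x y assume x: "x \<in> reach F (insert b S)" and e: "{x, y} \<in> insert {a, b} F"
    have "{a, b} \<subseteq> reach F (insert b S)" using reach_superset[of "insert b S" F] assms by auto
    then show "y \<in> reach F (insert b S)"
      using e reach_step[OF x, of y] by (auto simp: doubleton_eq_iff)
  qed
  show "reach F (insert b S) \<subseteq> reach (insert {a, b} F) S"
  proof (rule reach_least)
    show "insert b S \<subseteq> reach (insert {a, b} F) S"
      using reach_superset[of S "insert {a, b} F"] reach_step[of a "insert {a, b} F" S b] assms by auto
  qed (auto intro: reach_step)
qed

lemma reach_sym: "v \<in> reach F {u} \<longleftrightarrow> u \<in> reach F {v}"
proof -
  have "sym ({(x, y). {x, y} \<in> F}\<^sup>*)"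
    by (intro sym_rtrancl) (auto simp: sym_def insert_commute)
  then show ?thesis by (auto simp: reach_def sym_def)
qed

lemma reach_idem: "reach F (reach F S) = reach F S"
  by (intro subset_antisym reach_superset reach_least) (auto intro: reach_step)

lemma reach_eq_of_mem: "v \<in> reach F {u} \<Longrightarrow> reach F {v} = reach F {u}"
  using reach_sym[of v F u] reach_mono[of F F "{v}" "reach F {u}"] reach_mono[of F F "{u}" "reach F {v}"]
  by (auto simp: reach_idem)

lemma reach_disjoint: "reach F {u} = reach F {v} \<or> reach F {u} \<inter> reach F {v} = {}"
  by (metis disjoint_iff reach_eq_of_mem)

lemma mem_reach: "v \<in> reach F {v}"
  using reach_superset[of "{v}" F] by auto

lemma reach_subset:
  assumes "\<And>e. e \<in> F \<Longrightarrow> e \<subseteq> V" "S \<subseteq> V"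
  shows "reach F S \<subseteq> V"
  by (rule reach_least) (use assms in blast)+

lemma finite_reach:
  assumes "finite F" "\<And>e. e \<in> F \<Longrightarrow> card e = 2" "finite S"
  shows "finite (reach F S)"
proof (rule finite_subset[OF reach_subset[of F "\<Union>F \<union> S"]])
  have "finite e" if "e \<in> F" for e using assms(2)[OF that] by (simp add: card_ge_0_finite)
  then show "finite (\<Union>F \<union> S)" using assms by auto
qed auto

definition boundary :: "'a set set \<Rightarrow> 'a set \<Rightarrow> 'a set set" where
  "boundary E S = {e \<in> E. e \<inter> S \<noteq> {} \<and> \<not> e \<subseteq> S}"

lemma boundary_edgeE:
  assumes "e \<in> boundary E S" "card e = 2"
  obtains a b where "e = {a, b}" "a \<in> S" "b \<notin> S"
  using assms by (auto simp: boundary_def card_2_iff)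

lemma finite_boundary: "finite E \<Longrightarrow> finite (boundary E S)"
  by (simp add: boundary_def)

lemma reach_eq_if_no_boundary:
  assumes "boundary E S = {}" "F \<subseteq> E"
  shows "reach F S = S"
proof (rule subset_antisym[OF reach_least reach_superset])
  fix x y assume "x \<in> S" "{x, y} \<in> F"
  then show "y \<in> S" using assms by (auto simp: boundary_def)
qed simp

lemma card_boundary_remove:
  assumes "finite E" "e \<in> boundary E S"
  shows "card (boundary E S) = Suc (card (boundary (E - {e}) S))"
proof -
  have "boundary E S = insert e (boundary (E - {e}) S)" "e \<notin> boundary (E - {e}) S" using assms by (auto simp: boundary_def)
  then show ?thesis using finite_boundary[of "E - {e}" S] assms by simp
qed

lemma card_boundary_remove_le:
  assumes "finite E"
  shows "card (boundary E S) \<le> Suc (card (boundary (E - {e}) S))"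
proof -
  have "card (boundary E S) \<le> card (insert e (boundary (E - {e}) S))"
    by (rule card_mono) (use assms finite_boundary[of "E - {e}" S] in \<open>auto simp: boundary_def\<close>)
  also have "\<dots> \<le> Suc (card (boundary (E - {e}) S))" by (rule card_insert_le_m1) auto
  finally show ?thesis .
qed

lemma card_boundary_insert_le:
  assumes "finite E" "e \<in> boundary E S" "b \<in> e" "card {e \<in> E. b \<in> e} \<le> d"
  shows "card (boundary (E - {e}) (insert b S)) \<le> card (boundary (E - {e}) S) + d"
proof -
  have "boundary (E - {e}) (insert b S) \<subseteq> boundary (E - {e}) S \<union> {e \<in> E. b \<in> e}" by (auto simp: boundary_def)
  then have "card (boundary (E - {e}) (insert b S)) \<le> card (boundary (E - {e}) S \<union> {e \<in> E. b \<in> e})"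
    using assms by (intro card_mono) (auto simp: boundary_def)
  also have "\<dots> \<le> card (boundary (E - {e}) S) + card {e \<in> E. b \<in> e}" by (rule card_Un_le)
  finally show ?thesis using assms by simp
qed

text \<open>The exploration process, run as an induction over the edges: expose one boundary edge of
  the current set \<open>S\<close>; if it is present, its endpoint joins \<open>S\<close>, otherwise it is discarded.\<close>

lemma exploration_upper:
  fixes p y z B \<theta> :: real
  assumes "finite E" "finite S" "\<And>e. e \<in> E \<Longrightarrow> card e = 2"
    and "\<And>v. card {e \<in> E. v \<in> e} \<le> d"
    and p: "0 \<le> p" "p \<le> 1" and z: "0 \<le> z" and B: "1 \<le> B" and \<theta>: "1 \<le> \<theta>"
    and y: "z * B ^ d \<le> y" and step: "p * y + (1 - p) * \<theta> \<le> B"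
  shows "pexp E p (\<lambda>F. z ^ card (reach F S) * \<theta> ^ card (boundary E (reach F S)))
     \<le> z ^ card S * B ^ card (boundary E S)"
  using assms(1-4)
proof (induction "card E" arbitrary: E S rule: less_induct)
  case less
  show ?case
  proof (cases "boundary E S = {}")
    case True
    then have "pexp E p (\<lambda>F. z ^ card (reach F S) * \<theta> ^ card (boundary E (reach F S))) =
        pexp E p (\<lambda>F. z ^ card S)"
      by (intro pexp_cong) (simp add: reach_eq_if_no_boundary[OF True])
    then show ?thesis using True less.prems by (simp add: pexp_const)
  next
    case False
    then obtain e where e: "e \<in> boundary E S" by auto
    then have eE: "e \<in> E" by (auto simp: boundary_def)
    obtain a b where ab: "e = {a, b}" "a \<in> S" "b \<notin> S" using boundary_edgeE[OF e] less.prems(3)[OF eE] by blast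
    let ?E = "E - {e}" and ?m = "card (boundary (E - {e}) S)"
    have lt: "card ?E < card E" using eE less.prems(1) by (meson card_Diff1_less)
    have deg: "card {e \<in> ?E. v \<in> e} \<le> d" for v
      by (rule le_trans[OF card_mono less.prems(4)[of v]]) (use less.prems(1) in auto)
    have IH: "pexp ?E p (\<lambda>F. z ^ card (reach F T) * \<theta> ^ card (boundary ?E (reach F T)))
        \<le> z ^ card T * B ^ card (boundary ?E T)" if "finite T" for T
      by (rule less.hyps[OF lt]) (use less.prems that deg in auto)
    \<comment> \<open>If \<open>e\<close> is closed, it leaves the edge set but may remain in the
      boundary of the final component: at most one extra factor \<open>\<theta>\<close>.\<close>
    have "pexp ?E p (\<lambda>F. z ^ card (reach F S) * \<theta> ^ card (boundary E (reach F S)))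
      \<le> pexp ?E p (\<lambda>F. \<theta> * (z ^ card (reach F S) * \<theta> ^ card (boundary ?E (reach F S))))"
    proof (intro pexp_mono p)
      fix F
      have "\<theta> ^ card (boundary E (reach F S)) \<le> \<theta> ^ Suc (card (boundary ?E (reach F S)))"
        by (rule power_increasing[OF card_boundary_remove_le \<theta>]) (rule less.prems)
      then show "z ^ card (reach F S) * \<theta> ^ card (boundary E (reach F S))
        \<le> \<theta> * (z ^ card (reach F S) * \<theta> ^ card (boundary ?E (reach F S)))"
        using z mult_left_mono[of _ _ "z ^ card (reach F S)"] by (fastforce simp: algebra_simps)
    qed
    also have "\<dots> \<le> \<theta> * (z ^ card S * B ^ ?m)"
      unfolding pexp_cmult using \<theta> less.prems by (intro mult_left_mono IH) auto
    finally have closed: "pexp ?E p (\<lambda>F. z ^ card (reach F S) * \<theta> ^ card (boundary E (reach F S)))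
      \<le> \<theta> * (z ^ card S * B ^ ?m)" .
    \<comment> \<open>If \<open>e\<close> is open, both its ends lie in the component, so it never
      counts in the boundary.\<close>
    have "pexp ?E p (\<lambda>F. z ^ card (reach (insert e F) S) * \<theta> ^ card (boundary E (reach (insert e F) S)))
      = pexp ?E p (\<lambda>F. z ^ card (reach F (insert b S)) * \<theta> ^ card (boundary ?E (reach F (insert b S))))"
    proof (rule pexp_cong)
      fix F
      have "e \<subseteq> reach F (insert b S)" using reach_superset[of "insert b S" F] ab by auto
      then have "boundary E (reach F (insert b S)) = boundary ?E (reach F (insert b S))" by (auto simp: boundary_def)
      then show "z ^ card (reach (insert e F) S) * \<theta> ^ card (boundary E (reach (insert e F) S))
        = z ^ card (reach F (insert b S)) * \<theta> ^ card (boundary ?E (reach F (insert b S)))"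
        using reach_insert_edge[OF ab(2)] ab(1) by simp
    qed
    also have "\<dots> \<le> z ^ Suc (card S) * B ^ card (boundary ?E (insert b S))"
      using IH[of "insert b S"] less.prems ab by simp
    \<comment> \<open>The new vertex contributes \<open>z\<close> and at most \<open>d\<close>
      untested edges; \<open>1 \<le> B\<close> turns this count into an upper bound.\<close>
    also have "\<dots> \<le> z ^ Suc (card S) * B ^ (?m + d)"
      using z B card_boundary_insert_le[OF less.prems(1) e, of b d] less.prems(4)[of b] ab
      by (intro mult_left_mono power_increasing) auto
    also have "\<dots> = z ^ card S * B ^ ?m * (z * B ^ d)" by (simp add: power_add)
    also have "\<dots> \<le> z ^ card S * B ^ ?m * y" using z B y by (intro mult_left_mono) auto
    finally have "pexp E p (\<lambda>F. z ^ card (reach F S) * \<theta> ^ card (boundary E (reach F S)))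
      \<le> p * (z ^ card S * B ^ ?m * y) + (1 - p) * (\<theta> * (z ^ card S * B ^ ?m))"
      unfolding pexp_remove[OF less.prems(1) eE]
      using closed p by (intro add_mono mult_left_mono) auto
    also have "\<dots> = z ^ card S * B ^ ?m * (p * y + (1 - p) * \<theta>)" by (simp add: algebra_simps)
    also have "\<dots> \<le> z ^ card S * B ^ ?m * B" using z B step by (intro mult_left_mono) auto
    also have "\<dots> = z ^ card S * B ^ card (boundary E S)" using card_boundary_remove[OF less.prems(1) e] by simp
    finally show ?thesis .
  qed
qed

text \<open>For \<open>B \<le> 1\<close> overestimating the new boundary edges by \<open>d\<close>
  makes the weight smaller, so the same degree bound now serves from below: a component is dominated
  by a tree with \<open>d\<close> fresh edges at every vertex.\<close>

lemma exploration_lower: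
  fixes p y z B :: real
  assumes "finite E" "finite S" "\<And>e. e \<in> E \<Longrightarrow> card e = 2"
    and "\<And>v. card {e \<in> E. v \<in> e} \<le> d"
    and p: "0 \<le> p" "p \<le> 1" and z: "0 \<le> z" and B: "0 \<le> B" "B \<le> 1"
    and y: "y \<le> z * B ^ d" and step: "B \<le> p * y + (1 - p)"
  shows "z ^ card S * B ^ card (boundary E S) \<le> pexp E p (\<lambda>F. z ^ card (reach F S))"
  using assms(1-4)
proof (induction "card E" arbitrary: E S rule: less_induct)
  case less
  show ?case
  proof (cases "boundary E S = {}")
    case True
    then have "pexp E p (\<lambda>F. z ^ card (reach F S)) = pexp E p (\<lambda>F. z ^ card S)"
      by (intro pexp_cong) (simp add: reach_eq_if_no_boundary[OF True])
    then show ?thesis using True less.prems by (simp add: pexp_const)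
  next
    case False
    then obtain e where e: "e \<in> boundary E S" by auto
    then have eE: "e \<in> E" by (auto simp: boundary_def)
    obtain a b where ab: "e = {a, b}" "a \<in> S" "b \<notin> S" using boundary_edgeE[OF e] less.prems(3)[OF eE] by blast
    let ?E = "E - {e}" and ?m = "card (boundary (E - {e}) S)"
    have lt: "card ?E < card E" using eE less.prems(1) by (meson card_Diff1_less)
    have deg: "card {e \<in> ?E. v \<in> e} \<le> d" for v
      by (rule le_trans[OF card_mono less.prems(4)[of v]]) (use less.prems(1) in auto)
    have IH: "z ^ card T * B ^ card (boundary ?E T) \<le> pexp ?E p (\<lambda>F. z ^ card (reach F T))" if "finite T" for T
      by (rule less.hyps[OF lt]) (use less.prems that deg in auto)
    have "z ^ card S * B ^ card (boundary E S) = z ^ card S * B ^ ?m * B"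
      using card_boundary_remove[OF less.prems(1) e] by simp
    also have "\<dots> \<le> z ^ card S * B ^ ?m * (p * y + (1 - p))"
      using z B step by (intro mult_left_mono) auto
    also have "\<dots> = p * (z ^ card S * B ^ ?m * y) + (1 - p) * (z ^ card S * B ^ ?m)"
      by (simp add: algebra_simps)
    also have "\<dots> \<le> p * pexp ?E p (\<lambda>F. z ^ card (reach (insert e F) S)) + (1 - p) * pexp ?E p (\<lambda>F. z ^ card (reach F S))"
    proof (intro add_mono mult_left_mono)
      show "z ^ card S * B ^ ?m \<le> pexp ?E p (\<lambda>F. z ^ card (reach F S))" using IH less.prems by simp
      have "z ^ card S * B ^ ?m * y \<le> z ^ card S * B ^ ?m * (z * B ^ d)"
        using z B y by (intro mult_left_mono) auto
      also have "\<dots> = z ^ Suc (card S) * B ^ (?m + d)" by (simp add: power_add)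
      also have "\<dots> \<le> z ^ Suc (card S) * B ^ card (boundary ?E (insert b S))"
        using z B card_boundary_insert_le[OF less.prems(1) e, of b d] less.prems(4)[of b] ab
        by (intro mult_left_mono power_decreasing) auto
      also have "\<dots> \<le> pexp ?E p (\<lambda>F. z ^ card (reach F (insert b S)))"
        using IH[of "insert b S"] less.prems ab by simp
      finally show "z ^ card S * B ^ ?m * y \<le> pexp ?E p (\<lambda>F. z ^ card (reach (insert e F) S))"
        using reach_insert_edge[OF ab(2)] ab(1) by simp
    qed (use p in auto)
    also have "\<dots> = pexp E p (\<lambda>F. z ^ card (reach F S))"
      by (rule pexp_remove[OF less.prems(1) eE, symmetric])
    finally show ?thesis .
  qed
qed

lemma card_edges_meeting_le:
  assumes "finite S" "\<And>e. e \<in> E \<Longrightarrow> card e = 2" "b \<notin> S"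
  shows "card {e \<in> E. b \<in> e \<and> e \<inter> S \<noteq> {}} \<le> card S"
proof -
  have "{e \<in> E. b \<in> e \<and> e \<inter> S \<noteq> {}} \<subseteq> (\<lambda>a. {a, b}) ` S"
  proof
    fix e assume e: "e \<in> {e \<in> E. b \<in> e \<and> e \<inter> S \<noteq> {}}"
    then obtain a where a: "a \<in> e" "a \<in> S" by auto
    have "card e = 2" using e assms by auto
    then have "e = {a, b}" using a e assms(3) by (auto simp: card_2_iff)
    then show "e \<in> (\<lambda>a. {a, b}) ` S" using a by auto
  qed
  then have "card {e \<in> E. b \<in> e \<and> e \<inter> S \<noteq> {}} \<le> card ((\<lambda>a. {a, b}) ` S)"
    using assms by (intro card_mono) auto
  also have "\<dots> \<le> card S" using assms by (intro card_image_le) auto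
  finally show ?thesis .
qed

text \<open>Discarding a boundary edge lowers degrees outside \<open>S\<close>, but never the number of edges
  avoiding \<open>S\<close>; hence the form of the degree hypothesis.\<close>

lemma exploration_small:
  fixes p y B :: real
  assumes "finite E" "S \<subseteq> V" "finite V" "\<And>e. e \<in> E \<Longrightarrow> card e = 2 \<and> e \<subseteq> V"
    and "\<And>v. v \<in> V - S \<Longrightarrow> d \<le> card {e \<in> E. v \<in> e \<and> e \<inter> S = {}} + card S"
    and p: "0 \<le> p" "p \<le> 1" and B: "0 \<le> B" "B \<le> 1" and K: "2 * K \<le> d"
    and y: "B ^ (d - 2 * K) \<le> y" and step: "p * y + (1 - p) \<le> B" and "card S \<le> K"
  shows "pprob E p (\<lambda>F. card (reach F S) \<le> K) \<le> B ^ card (boundary E S)"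
  using assms(1,2,4,5) \<open>card S \<le> K\<close>
proof (induction "card E" arbitrary: E S rule: less_induct)
  case less
  have finS: "finite S" using less.prems(2) assms(3) finite_subset by auto
  show ?case
  proof (cases "boundary E S = {}")
    case True
    have "pprob E p (\<lambda>F. card (reach F S) \<le> K) \<le> pexp E p (\<lambda>F. 1)"
      using p by (intro pexp_mono) auto
    then show ?thesis using True less.prems by (simp add: pexp_const)
  next
    case False
    then obtain e where e: "e \<in> boundary E S" by auto
    then have eE: "e \<in> E" by (auto simp: boundary_def)
    obtain a b where ab: "e = {a, b}" "a \<in> S" "b \<notin> S" using boundary_edgeE[OF e] less.prems(3)[OF eE] by blast
    have bV: "b \<in> V" using less.prems(3)[OF eE] ab by auto
    let ?E = "E - {e}" and ?m = "card (boundary (E - {e}) S)"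
    have lt: "card ?E < card E" using eE less.prems(1) by (meson card_Diff1_less)
    have m: "card (boundary E S) = Suc ?m" by (rule card_boundary_remove[OF less.prems(1) e])
    have closed: "pprob ?E p (\<lambda>F. card (reach F S) \<le> K) \<le> B ^ ?m"
    proof (rule less.hyps[OF lt])
      fix v assume v: "v \<in> V - S"
      have "{e' \<in> ?E. v \<in> e' \<and> e' \<inter> S = {}} = {e \<in> E. v \<in> e \<and> e \<inter> S = {}}" using ab by auto
      then show "d \<le> card {e' \<in> ?E. v \<in> e' \<and> e' \<inter> S = {}} + card S" using less.prems(4)[OF v] by simp
    qed (use less.prems in auto)
    have "pprob ?E p (\<lambda>F. card (reach F (insert b S)) \<le> K) \<le> B ^ (?m + (d - 2 * K))"
    proof (cases "card (insert b S) \<le> K")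
      case False
      have "pprob ?E p (\<lambda>F. card (reach F (insert b S)) \<le> K) = pexp ?E p (\<lambda>_. 0)"
      proof (rule pexp_cong)
        fix F assume F: "F \<subseteq> ?E"
        have "finite (reach F (insert b S))"
          by (rule finite_reach) (use F less.prems finS finite_subset[OF F] in auto)
        then have "card (insert b S) \<le> card (reach F (insert b S))"
          by (intro card_mono reach_superset)
        then show "of_bool (card (reach F (insert b S)) \<le> K) = (0::real)" using False by simp
      qed
      then show ?thesis using less.prems B by (simp add: pexp_const)
    next
      case True
      \<comment> \<open>Passing from \<open>S\<close> to \<open>insert b S\<close> spoils at most
        one edge at \<open>v\<close>, namely \<open>{v, b}\<close>; the growth of
        \<open>card S\<close> by one makes up for it.\<close>
      have inv: "d \<le> card {e' \<in> ?E. v \<in> e' \<and> e' \<inter> insert b S = {}} + card (insert b S)"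
        if v: "v \<in> V - insert b S" for v
      proof -
        have "{e \<in> E. v \<in> e \<and> e \<inter> S = {}} \<subseteq> insert {v, b} {e' \<in> ?E. v \<in> e' \<and> e' \<inter> insert b S = {}}"
        proof
          fix x assume x: "x \<in> {e \<in> E. v \<in> e \<and> e \<inter> S = {}}"
          have "card x = 2" using x less.prems by auto
          then show "x \<in> insert {v, b} {e' \<in> ?E. v \<in> e' \<and> e' \<inter> insert b S = {}}"
            using x v ab by (auto simp: card_2_iff)
        qed
        then have "card {e \<in> E. v \<in> e \<and> e \<inter> S = {}} \<le> card (insert {v, b} {e' \<in> ?E. v \<in> e' \<and> e' \<inter> insert b S = {}})"
          by (rule card_mono[rotated]) (use less.prems in auto)
        also have "\<dots> \<le> Suc (card {e' \<in> ?E. v \<in> e' \<and> e' \<inter> insert b S = {}})"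
          by (rule card_insert_le_m1) auto
        finally show ?thesis using less.prems(4)[of v] v ab finS by auto
      qed
      have "pprob ?E p (\<lambda>F. card (reach F (insert b S)) \<le> K) \<le> B ^ card (boundary ?E (insert b S))"
        by (rule less.hyps[OF lt]) (use less.prems True bV inv in auto)
      also have "\<dots> \<le> B ^ (?m + (d - 2 * K))"
      proof (rule power_decreasing[OF _ B])
        \<comment> \<open>\<open>?X\<close> are the edges that \<open>b\<close> adds to the
          boundary, at least \<open>d - card S\<close> of them; \<open>?Y\<close>, at most
          \<open>card S\<close> edges including \<open>e\<close>, become internal. As
          \<open>card S \<le> K\<close>, the gain over \<open>?m\<close> is at least
          \<open>d - 2 * K\<close>.\<close>
        let ?X = "{e \<in> E. b \<in> e \<and> e \<inter> S = {}}" and ?Y = "{e \<in> E. b \<in> e \<and> e \<inter> S \<noteq> {}}"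
        have sub: "boundary E S - ?Y \<union> ?X \<subseteq> boundary ?E (insert b S)"
        proof -
          have "x \<in> boundary ?E (insert b S)" if x: "x \<in> ?X" for x
          proof -
            have "card x = 2" using x less.prems by auto
            then have "\<not> x \<subseteq> insert b S" using x by (auto simp: card_2_iff)
            then show ?thesis using x ab by (auto simp: boundary_def)
          qed
          moreover have "x \<in> boundary ?E (insert b S)" if x: "x \<in> boundary E S - ?Y" for x
            using x ab by (auto simp: boundary_def)
          ultimately show ?thesis by blast
        qed
        have "card (boundary E S - ?Y \<union> ?X) = card (boundary E S - ?Y) + card ?X"
          by (rule card_Un_disjoint) (use less.prems in \<open>auto simp: boundary_def\<close>)
        moreover have "card (boundary E S) - card ?Y \<le> card (boundary E S - ?Y)"
          by (rule diff_card_le_card_Diff) (use less.prems in auto)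
        moreover have "card ?Y \<le> card S" by (rule card_edges_meeting_le) (use finS less.prems ab in auto)
        moreover have "card (boundary E S - ?Y \<union> ?X) \<le> card (boundary ?E (insert b S))"
          by (rule card_mono[OF _ sub]) (use less.prems in \<open>auto simp: boundary_def\<close>)
        moreover have "d \<le> card ?X + card S" using less.prems(4)[of b] bV ab by auto
        ultimately show "?m + (d - 2 * K) \<le> card (boundary ?E (insert b S))" using less.prems(5) m K by linarith
      qed
      finally show ?thesis .
    qed
    also have "\<dots> = B ^ ?m * B ^ (d - 2 * K)" by (simp add: power_add)
    also have "\<dots> \<le> B ^ ?m * y" using B y by (intro mult_left_mono) auto
    finally have "pprob ?E p (\<lambda>F. card (reach (insert e F) S) \<le> K) \<le> B ^ ?m * y"
      using reach_insert_edge[OF ab(2)] ab(1) by simp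
    then have "pprob E p (\<lambda>F. card (reach F S) \<le> K) \<le> p * (B ^ ?m * y) + (1 - p) * B ^ ?m"
      unfolding pexp_remove[OF less.prems(1) eE]
      using closed p by (intro add_mono mult_left_mono) auto
    also have "\<dots> = B ^ ?m * (p * y + (1 - p))" by (simp add: algebra_simps)
    also have "\<dots> \<le> B ^ ?m * B" using B step by (intro mult_left_mono) auto
    also have "\<dots> = B ^ card (boundary E S)" using m by simp
    finally show ?thesis .
  qed
qed

section \<open>Eigenfunctions of the Johnson graph\<close>

definition slice :: "'a set \<Rightarrow> nat \<Rightarrow> 'a set set" where
  "slice \<Omega> r = {w. w \<subseteq> \<Omega> \<and> card w = r}"

definition slice_nbrs :: "'a set \<Rightarrow> nat \<Rightarrow> nat \<Rightarrow> 'a set \<Rightarrow> 'a set set" where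
  "slice_nbrs \<Omega> r s u = {w \<in> slice \<Omega> r. card (u \<inter> w) = s}"

definition slice_op :: "'a set \<Rightarrow> nat \<Rightarrow> nat \<Rightarrow> ('a set \<Rightarrow> real) \<Rightarrow> 'a set \<Rightarrow> real" where
  "slice_op \<Omega> r s f u = (\<Sum>w\<in>slice_nbrs \<Omega> r s u. f w)"

definition pair_prod :: "('a \<times> 'a) list \<Rightarrow> 'a set \<Rightarrow> real" where
  "pair_prod ps w = (\<Prod>(a, b)\<leftarrow>ps. of_bool (a \<in> w) - of_bool (b \<in> w))"

text \<open>Symmetric in its two parts, so that a pair may have its first point on either side. The
  neighbours of \<open>u\<close> are such sets for \<open>u\<close> and its complement.\<close>

definition split_sets :: "'a set \<Rightarrow> 'a set \<Rightarrow> nat \<Rightarrow> nat \<Rightarrow> 'a set set" where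
  "split_sets U W k l = {w. w \<subseteq> U \<union> W \<and> card (w \<inter> U) = k \<and> card (w \<inter> W) = l}"

text \<open>With \<open>\<sigma> = - 1\<close> these are the eigenvalues of the Johnson graph, \<open>j\<close> being the level and
  \<open>m\<close>, \<open>q\<close>, \<open>k\<close>, \<open>l\<close> the sizes of a vertex and its complement and of the parts a neighbour
  has in them; \<open>\<sigma> = 1\<close> gives the same sum without cancellation.\<close>

fun signed_count :: "real \<Rightarrow> nat \<Rightarrow> nat \<Rightarrow> nat \<Rightarrow> nat \<Rightarrow> nat \<Rightarrow> real" where
  "signed_count \<sigma> 0 m q k l = real (m choose k) * real (q choose l)"
| "signed_count \<sigma> (Suc j) m q k l =
     (if m = 0 \<or> q = 0 then 0 else
       (if k = 0 then 0 else signed_count \<sigma> j (m - 1) (q - 1) (k - 1) l) +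
       \<sigma> * (if l = 0 then 0 else signed_count \<sigma> j (m - 1) (q - 1) k (l - 1)))"

lemma finite_slice [simp]: "finite \<Omega> \<Longrightarrow> finite (slice \<Omega> r)"
  by (simp add: slice_def)

lemma finite_slice_nbrs [simp]: "finite \<Omega> \<Longrightarrow> finite (slice_nbrs \<Omega> r s u)"
  by (simp add: slice_nbrs_def)

lemma pair_prod_Nil [simp]: "pair_prod [] w = 1"
  by (simp add: pair_prod_def)

lemma pair_prod_Cons [simp]:
  "pair_prod ((a, b) # ps) w = (of_bool (a \<in> w) - of_bool (b \<in> w)) * pair_prod ps w"
  by (simp add: pair_prod_def)

lemma pair_prod_append: "pair_prod (ps @ qs) w = pair_prod ps w * pair_prod qs w"
  by (simp add: pair_prod_def)

lemma pair_prod_cong: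
  assumes "\<And>x. x \<in> fst ` set ps \<union> snd ` set ps \<Longrightarrow> x \<in> w \<longleftrightarrow> x \<in> w'"
  shows "pair_prod ps w = pair_prod ps w'"
  using assms by (induction ps) auto

lemma abs_pair_prod_le: "\<bar>pair_prod ps w\<bar> \<le> 1"
proof (induction ps)
  case (Cons p ps)
  then show ?case by (cases p) (auto simp: abs_mult)
qed simp

lemma finite_split_sets: "finite U \<Longrightarrow> finite W \<Longrightarrow> finite (split_sets U W k l)"
  by (simp add: split_sets_def)

lemma card_split_sets:
  assumes "finite U" "finite W" "U \<inter> W = {}"
  shows "card (split_sets U W k l) = (card U choose k) * (card W choose l)"
proof -
  have "bij_betw (\<lambda>(x, y). x \<union> y) ({x. x \<subseteq> U \<and> card x = k} \<times> {y. y \<subseteq> W \<and> card y = l}) (split_sets U W k l)"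
  proof (rule bij_betw_byWitness[where f' = "\<lambda>w. (w \<inter> U, w \<inter> W)"])
    show "(\<lambda>(x, y). x \<union> y) ` ({x. x \<subseteq> U \<and> card x = k} \<times> {y. y \<subseteq> W \<and> card y = l}) \<subseteq> split_sets U W k l"
    proof clarify
      fix x y assume "x \<subseteq> U" "y \<subseteq> W"
      then have "(x \<union> y) \<inter> U = x" "(x \<union> y) \<inter> W = y" "x \<union> y \<subseteq> U \<union> W" using assms by auto
      then show "x \<union> y \<in> split_sets U W (card x) (card y)" by (simp add: split_sets_def)
    qed
  qed (use assms in \<open>auto simp: split_sets_def\<close>)
  then have "card (split_sets U W k l) = card ({x. x \<subseteq> U \<and> card x = k} \<times> {y. y \<subseteq> W \<and> card y = l})"
    by (simp add: bij_betw_same_card)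
  then show ?thesis using assms by (simp add: card_cartesian_product n_subsets)
qed

lemma split_sets_remove:
  assumes "finite U" "a \<in> U" "b \<in> W" "U \<inter> W = {}"
  shows "{w \<in> split_sets U W k l. a \<in> w \<and> b \<notin> w} =
    (if k = 0 then {} else insert a ` split_sets (U - {a}) (W - {b}) (k - 1) l)"
proof -
  have U: "w \<inter> U = insert a ((w - {a}) \<inter> (U - {a}))" if "a \<in> w" for w using that assms by auto
  have c: "card (w \<inter> U) = Suc (card ((w - {a}) \<inter> (U - {a})))" if "a \<in> w" for w
    unfolding U[OF that] using assms by (subst card_insert_disjoint) auto
  have W: "w \<inter> W = (w - {a}) \<inter> (W - {b})" if "b \<notin> w" for w using that assms by auto
  have eq: "w \<in> {w \<in> split_sets U W k l. a \<in> w \<and> b \<notin> w} \<longleftrightarrow>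
     w \<in> insert a ` split_sets (U - {a}) (W - {b}) (k - 1) l" if "k > 0" for w
  proof
    assume w: "w \<in> {w \<in> split_sets U W k l. a \<in> w \<and> b \<notin> w}"
    then have "w - {a} \<in> split_sets (U - {a}) (W - {b}) (k - 1) l"
      using c[of w] W[of w] by (auto simp: split_sets_def)
    moreover have "w = insert a (w - {a})" using w by auto
    ultimately show "w \<in> insert a ` split_sets (U - {a}) (W - {b}) (k - 1) l" by blast
  next
    assume "w \<in> insert a ` split_sets (U - {a}) (W - {b}) (k - 1) l"
    then obtain x where x: "w = insert a x" "x \<in> split_sets (U - {a}) (W - {b}) (k - 1) l" by auto
    then have "a \<notin> x" "b \<notin> w" "a \<in> w" using assms by (auto simp: split_sets_def)
    moreover from this have "w - {a} = x" using x by auto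
    ultimately show "w \<in> {w \<in> split_sets U W k l. a \<in> w \<and> b \<notin> w}"
      using x c[of w] W[of w] that assms by (auto simp: split_sets_def)
  qed
  show ?thesis
  proof (cases "k = 0")
    case True
    then show ?thesis using c by (fastforce simp: split_sets_def)
  next
    case False
    then show ?thesis using eq by (simp add: set_eq_iff)
  qed
qed

lemma inj_on_insert_split_sets: "x \<notin> U \<union> W \<Longrightarrow> inj_on (insert x) (split_sets U W k l)"
  by (rule inj_on_inverseI[of _ "\<lambda>w. w - {x}"]) (auto simp: split_sets_def)

lemma sum_split_sets_remove:
  fixes f :: "'a set \<Rightarrow> real"
  assumes "finite U" "a \<in> U" "b \<in> W" "U \<inter> W = {}" "\<And>w. f (insert a w) = f w"
  shows "(\<Sum>w\<in>{w \<in> split_sets U W k l. a \<in> w \<and> b \<notin> w}. f w) =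
    (if k = 0 then 0 else \<Sum>w\<in>split_sets (U - {a}) (W - {b}) (k - 1) l. f w)"
proof -
  have "inj_on (insert a) (split_sets (U - {a}) (W - {b}) (k - 1) l)"
    using assms(2,4) by (intro inj_on_insert_split_sets) auto
  then show ?thesis using split_sets_remove[OF assms(1-4)] assms(5) by (simp add: sum.reindex)
qed

lemma split_sets_commute: "split_sets U W k l = split_sets W U l k"
  by (auto simp: split_sets_def)

text \<open>A set containing both or neither point of the first pair contributes 0. If it contains
  exactly one, deleting both points leaves the same problem with \<open>k\<close> or
  \<open>l\<close> lowered, and the two choices have opposite signs: the recursion of
  \<open>signed_count\<close>. The factor \<open>pair_prod ps U\<close> records on which side each
  pair has its first point.\<close>

lemma sum_pair_prod_split_sets:
  assumes "finite U" "finite W" "U \<inter> W = {}" "distinct (map fst ps @ map snd ps)"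
    and "\<And>a b. (a, b) \<in> set ps \<Longrightarrow> a \<in> U \<and> b \<in> W \<or> a \<in> W \<and> b \<in> U"
  shows "(\<Sum>w\<in>split_sets U W k l. pair_prod ps w) =
    signed_count (-1) (length ps) (card U) (card W) k l * pair_prod ps U"
  using assms
proof (induction ps arbitrary: U W k l)
  case Nil
  then show ?case by (simp add: card_split_sets)
next
  case (Cons p ps)
  obtain a b where p: "p = (a, b)" by (cases p)
  have out: "x \<notin> fst ` set ps \<union> snd ` set ps" if "x = a \<or> x = b" for x using Cons.prems(4) p that by auto
  \<comment> \<open>\<open>x\<close> is the point of the first pair in \<open>U\<close>,
    \<open>y\<close> the one in \<open>W\<close>, and \<open>\<sigma>\<close> the sign of this
    reordering.\<close>
  obtain x y and \<sigma> :: real where xy: "x \<in> U" "y \<in> W" "x = a \<or> x = b" "y = a \<or> y = b"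
    and \<sigma>: "\<And>w. pair_prod (p # ps) w = \<sigma> * ((of_bool (x \<in> w) - of_bool (y \<in> w)) * pair_prod ps w)"
  proof (cases "a \<in> U \<and> b \<in> W")
    case True
    then show ?thesis by (intro that[of a b 1]) (auto simp: p)
  next
    case False
    then show ?thesis using Cons.prems(5)[of a b] by (intro that[of b a "-1"]) (auto simp: p)
  qed
  let ?U = "U - {x}" and ?W = "W - {y}" and ?j = "length ps"
  have xy': "x \<notin> W" "y \<notin> U" using xy Cons.prems(3) by auto
  have fin: "finite (split_sets U W k l)" using Cons.prems by (simp add: finite_split_sets)
  have ins: "pair_prod ps (insert v w) = pair_prod ps w" if "v = a \<or> v = b" for v w
    using out[OF that] by (intro pair_prod_cong) auto
  have U: "pair_prod ps ?U = pair_prod ps U" using ins[OF xy(3), of ?U] xy(1) by (simp add: insert_absorb)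
  have "a' \<in> ?U \<and> b' \<in> ?W \<or> a' \<in> ?W \<and> b' \<in> ?U" if "(a', b') \<in> set ps" for a' b'
  proof -
    have "a' \<in> fst ` set ps" "b' \<in> snd ` set ps" using that by (metis fst_conv snd_conv image_eqI)+
    then have "a' \<noteq> x" "a' \<noteq> y" "b' \<noteq> x" "b' \<noteq> y" using out[OF xy(3)] out[OF xy(4)] by auto
    then show ?thesis using Cons.prems(5)[of a' b'] that by auto
  qed
  then have IH: "(\<Sum>w\<in>split_sets ?U ?W k' l'. pair_prod ps w)
     = signed_count (-1) ?j (card U - 1) (card W - 1) k' l' * pair_prod ps U" for k' l'
    using Cons.IH[of ?U ?W k' l'] Cons.prems(1-4) xy U by auto
  have 1: "(\<Sum>w\<in>{w \<in> split_sets U W k l. x \<in> w \<and> y \<notin> w}. pair_prod ps w)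
     = (if k = 0 then 0 else signed_count (-1) ?j (card U - 1) (card W - 1) (k - 1) l * pair_prod ps U)"
    using Cons.prems(1,3) xy ins by (simp only: sum_split_sets_remove IH)
  have 2: "(\<Sum>w\<in>{w \<in> split_sets U W k l. y \<in> w \<and> x \<notin> w}. pair_prod ps w)
     = (if l = 0 then 0 else signed_count (-1) ?j (card U - 1) (card W - 1) k (l - 1) * pair_prod ps U)"
    unfolding split_sets_commute[of U] IH[symmetric] split_sets_commute[of ?U]
    using Cons.prems(2,3) xy ins by (intro sum_split_sets_remove) auto
  have "(\<Sum>w\<in>split_sets U W k l. pair_prod (p # ps) w) =
    \<sigma> * (\<Sum>w\<in>split_sets U W k l. (if x \<in> w \<and> y \<notin> w then pair_prod ps w else 0) -
        (if y \<in> w \<and> x \<notin> w then pair_prod ps w else 0))"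
    unfolding \<sigma> sum_distrib_left by (intro sum.cong) auto
  also have "\<dots> = \<sigma> * ((\<Sum>w\<in>{w \<in> split_sets U W k l. x \<in> w \<and> y \<notin> w}. pair_prod ps w)
     - (\<Sum>w\<in>{w \<in> split_sets U W k l. y \<in> w \<and> x \<notin> w}. pair_prod ps w))"
    using fin by (simp add: sum_subtractf sum.inter_filter)
  finally have eq: "(\<Sum>w\<in>split_sets U W k l. pair_prod (p # ps) w) = \<dots>" .
  have "card U \<noteq> 0" "card W \<noteq> 0" using xy Cons.prems(1,2) by auto
  then show ?case unfolding eq 1 2 \<sigma>[of U] using xy xy' by (simp add: algebra_simps)
qed

definition valid_pairs :: "'a set \<Rightarrow> ('a \<times> 'a) list \<Rightarrow> bool" where
  "valid_pairs \<Omega> ps \<longleftrightarrow> distinct (map fst ps @ map snd ps) \<and> fst ` set ps \<union> snd ` set ps \<subseteq> \<Omega>"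

lemma valid_pairs_mem:
  assumes "valid_pairs \<Omega> ps" "(a, b) \<in> set ps"
  shows "a \<in> \<Omega>" "b \<in> \<Omega>"
proof -
  have "a \<in> fst ` set ps" "b \<in> snd ` set ps" using assms(2) by (metis fst_conv snd_conv image_eqI)+
  then show "a \<in> \<Omega>" "b \<in> \<Omega>" using assms(1) by (auto simp: valid_pairs_def)
qed

lemma card_transpose_image: "card (Transposition.transpose a b ` w) = card w"
  by (intro card_image inj_on_subset[OF inj_transpose]) auto

text \<open>Transposing \<open>a\<close> and \<open>b\<close> is a sign-reversing involution on
  \<open>Y\<close>. It serves twice: for the whole slice, and for the neighbours of a set that does
  not split the pair.\<close>

lemma sum_pair_prod_swap:
  assumes "valid_pairs \<Omega> ps" "(a, b) \<in> set ps" "\<And>w. w \<in> Y \<Longrightarrow> Transposition.transpose a b ` w \<in> Y"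
  shows "(\<Sum>w\<in>Y. pair_prod ps w) = 0"
proof -
  let ?\<tau> = "Transposition.transpose a b"
  obtain ps1 ps2 where ps: "ps = ps1 @ (a, b) # ps2" using assms(2) by (meson split_list)
  have "pair_prod ps (?\<tau> ` w) = - pair_prod ps w" for w
  proof -
    have mem: "x \<in> ?\<tau> ` w \<longleftrightarrow> ?\<tau> x \<in> w" for x
      by (metis image_iff transpose_involutory)
    have ne: "x \<noteq> a \<and> x \<noteq> b" if "x \<in> fst ` set (ps1 @ ps2) \<union> snd ` set (ps1 @ ps2)" for x
      using assms(1) that unfolding ps valid_pairs_def by auto
    have "pair_prod (ps1 @ ps2) (?\<tau> ` w) = pair_prod (ps1 @ ps2) w"
    proof (rule pair_prod_cong)
      fix x assume "x \<in> fst ` set (ps1 @ ps2) \<union> snd ` set (ps1 @ ps2)"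
      then show "x \<in> ?\<tau> ` w \<longleftrightarrow> x \<in> w" using ne[of x] by (simp add: mem)
    qed
    then show ?thesis by (simp add: ps pair_prod_append mem)
  qed
  moreover have "(\<Sum>w\<in>Y. pair_prod ps (?\<tau> ` w)) = (\<Sum>w\<in>Y. pair_prod ps w)"
    by (rule sum.reindex_bij_witness[of _ "(`) ?\<tau>" "(`) ?\<tau>"]) (use assms(3) in \<open>auto simp: image_comp\<close>)
  ultimately show ?thesis by (simp add: sum_negf)
qed

lemma transpose_slice:
  assumes "w \<in> slice \<Omega> r" "a \<in> \<Omega>" "b \<in> \<Omega>"
  shows "Transposition.transpose a b ` w \<in> slice \<Omega> r"
proof -
  have "Transposition.transpose a b ` w \<subseteq> \<Omega>"
    using assms by (auto simp: slice_def Transposition.transpose_def)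
  then show ?thesis using assms(1) by (simp add: slice_def card_transpose_image)
qed

lemma slice_nbrs_eq:
  assumes "finite \<Omega>" "u \<in> slice \<Omega> r" "s \<le> r"
  shows "slice_nbrs \<Omega> r s u = split_sets u (\<Omega> - u) s (r - s)"
proof -
  have "card w = card (w \<inter> u) + card (w \<inter> (\<Omega> - u))" if "w \<subseteq> \<Omega>" for w
  proof -
    have "finite w" using that assms finite_subset by blast
    then have "card (w \<inter> u \<union> w \<inter> (\<Omega> - u)) = card (w \<inter> u) + card (w \<inter> (\<Omega> - u))"
      by (intro card_Un_disjoint) auto
    moreover have "w \<inter> u \<union> w \<inter> (\<Omega> - u) = w" using that by auto
    ultimately show ?thesis by simp
  qed
  moreover have "u \<union> (\<Omega> - u) = \<Omega>" using assms by (auto simp: slice_def)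
  ultimately show ?thesis
    using assms(3) unfolding slice_nbrs_def slice_def split_sets_def Int_commute[of u]
    by (auto cong: conj_cong)
qed

text \<open>If some pair is not split by \<open>u\<close>, the transposition of its points fixes
  \<open>u\<close> and both sides vanish. Otherwise each pair has one point in \<open>u\<close> and
  one outside, the case counted by \<open>sum_pair_prod_split_sets\<close>.\<close>

lemma slice_op_pair_prod:
  assumes "finite \<Omega>" "valid_pairs \<Omega> ps" "u \<in> slice \<Omega> r" "s \<le> r"
  shows "slice_op \<Omega> r s (pair_prod ps) u =
    signed_count (-1) (length ps) r (card \<Omega> - r) s (r - s) * pair_prod ps u"
proof (cases "\<exists>(a, b)\<in>set ps. a \<in> u \<longleftrightarrow> b \<in> u")
  case True
  then obtain a b where ab: "(a, b) \<in> set ps" "a \<in> u \<longleftrightarrow> b \<in> u" by auto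
  let ?\<tau> = "Transposition.transpose a b"
  have "slice_op \<Omega> r s (pair_prod ps) u = 0"
    unfolding slice_op_def
  proof (rule sum_pair_prod_swap[OF assms(2) ab(1)])
    fix w assume w: "w \<in> slice_nbrs \<Omega> r s u"
    have "?\<tau> ` u = u" using ab(2) by (auto simp: transpose_image_eq)
    then have "u \<inter> ?\<tau> ` w = ?\<tau> ` (u \<inter> w)"
      by (metis image_Int inj_transpose)
    then show "?\<tau> ` w \<in> slice_nbrs \<Omega> r s u"
      using w ab(1) assms(2) by (force simp: slice_nbrs_def valid_pairs_def card_transpose_image intro!: transpose_slice)
  qed
  moreover have "pair_prod ps u = 0"
    using ab by (auto simp: pair_prod_def prod_list_zero_iff image_iff intro!: bexI[of _ "(a, b)"])
  ultimately show ?thesis by simp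
next
  case False
  have "a \<in> u \<and> b \<in> \<Omega> - u \<or> a \<in> \<Omega> - u \<and> b \<in> u" if "(a, b) \<in> set ps" for a b
    using False that valid_pairs_mem[OF assms(2) that] by blast
  moreover have "finite u" "card u = r" "card (\<Omega> - u) = card \<Omega> - r"
    using assms(1,3) by (auto simp: slice_def card_Diff_subset finite_subset)
  ultimately show ?thesis
    unfolding slice_op_def slice_nbrs_eq[OF assms(1,3,4)]
    using assms(1,2) sum_pair_prod_split_sets[of u "\<Omega> - u" ps s "r - s"] by (simp add: valid_pairs_def)
qed

section \<open>Mixing from the eigenvalues\<close>

definition all_pairs :: "'a set \<Rightarrow> ('a \<times> 'a) list set" where
  "all_pairs \<Omega> = {ps. valid_pairs \<Omega> ps}"

lemma finite_all_pairs:
  assumes "finite \<Omega>"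
  shows "finite (all_pairs \<Omega>)"
proof (rule finite_subset)
  show "all_pairs \<Omega> \<subseteq> {ps. set ps \<subseteq> \<Omega> \<times> \<Omega> \<and> length ps \<le> card \<Omega>}"
  proof
    fix ps assume ps: "ps \<in> all_pairs \<Omega>"
    then have "length ps = card (fst ` set ps)"
      using distinct_card[of "map fst ps"] by (auto simp: all_pairs_def valid_pairs_def)
    also have "\<dots> \<le> card \<Omega>"
      using ps assms by (intro card_mono) (auto simp: all_pairs_def valid_pairs_def)
    finally show "ps \<in> {ps. set ps \<subseteq> \<Omega> \<times> \<Omega> \<and> length ps \<le> card \<Omega>}"
      using ps valid_pairs_mem[of \<Omega> ps] by (auto simp: all_pairs_def)
  qed
  show "finite {ps. set ps \<subseteq> \<Omega> \<times> \<Omega> \<and> length ps \<le> card \<Omega>}"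
    using assms by (intro finite_lists_length_le) auto
qed

section \<open>The pair products span all functions on a slice\<close>

definition pair_span :: "'a set \<Rightarrow> nat \<Rightarrow> ('a set \<Rightarrow> real) \<Rightarrow> bool" where
  "pair_span \<Omega> r f \<longleftrightarrow> (\<exists>c. \<forall>w\<in>slice \<Omega> r. f w = (\<Sum>ps\<in>all_pairs \<Omega>. c ps * pair_prod ps w))"

lemma pair_span_add:
  assumes "pair_span \<Omega> r f" "pair_span \<Omega> r g"
  shows "pair_span \<Omega> r (\<lambda>w. f w + g w)"
proof -
  obtain c c' where "\<forall>w\<in>slice \<Omega> r. f w = (\<Sum>ps\<in>all_pairs \<Omega>. c ps * pair_prod ps w)"
    "\<forall>w\<in>slice \<Omega> r. g w = (\<Sum>ps\<in>all_pairs \<Omega>. c' ps * pair_prod ps w)"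
    using assms unfolding pair_span_def by blast
  then show ?thesis unfolding pair_span_def
    by (intro exI[of _ "\<lambda>ps. c ps + c' ps"]) (simp add: algebra_simps sum.distrib)
qed

lemma pair_span_cmult:
  assumes "pair_span \<Omega> r f"
  shows "pair_span \<Omega> r (\<lambda>w. a * f w)"
proof -
  obtain c where "\<forall>w\<in>slice \<Omega> r. f w = (\<Sum>ps\<in>all_pairs \<Omega>. c ps * pair_prod ps w)"
    using assms unfolding pair_span_def by blast
  then show ?thesis unfolding pair_span_def
    by (intro exI[of _ "\<lambda>ps. a * c ps"]) (simp add: sum_distrib_left algebra_simps)
qed

lemma pair_span_sum:
  assumes "finite I" "\<And>i. i \<in> I \<Longrightarrow> pair_span \<Omega> r (f i)"
  shows "pair_span \<Omega> r (\<lambda>w. \<Sum>i\<in>I. f i w)"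
  using assms
proof (induction I rule: finite_induct)
  case empty
  show ?case unfolding pair_span_def by (rule exI[of _ "\<lambda>_. 0"]) auto
qed (auto intro: pair_span_add)

lemma pair_span_cong:
  assumes "pair_span \<Omega> r f" "\<And>w. w \<in> slice \<Omega> r \<Longrightarrow> f w = g w"
  shows "pair_span \<Omega> r g"
  using assms unfolding pair_span_def by metis

lemma pair_span_base:
  assumes "finite \<Omega>" "valid_pairs \<Omega> ps"
  shows "pair_span \<Omega> r (pair_prod ps)"
  unfolding pair_span_def
proof (intro exI ballI)
  fix w
  have "(\<Sum>qs\<in>all_pairs \<Omega>. of_bool (qs = ps) * pair_prod qs w) = (\<Sum>qs\<in>{ps}. pair_prod qs w)"
    using finite_all_pairs[OF assms(1)] assms(2)
    by (intro sum.mono_neutral_cong_right) (auto simp: all_pairs_def)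
  then show "pair_prod ps w = (\<Sum>qs\<in>all_pairs \<Omega>. of_bool (qs = ps) * pair_prod qs w)" by simp
qed

text \<open>A factor is nonzero exactly when one of its two points is in \<open>w\<close>, so
  \<open>w\<close> spends one element on each pair.\<close>

lemma card_inter_pair_points:
  assumes "valid_pairs \<Omega> ps" "pair_prod ps w \<noteq> 0" "finite w"
  shows "card (w \<inter> (fst ` set ps \<union> snd ` set ps)) = length ps"
  using assms
proof (induction ps)
  case (Cons p ps)
  obtain a b where p: "p = (a, b)" by (cases p)
  let ?P = "fst ` set ps \<union> snd ` set ps"
  have ab: "a \<notin> ?P" "b \<notin> ?P" "a \<noteq> b" using Cons.prems p by (auto simp: valid_pairs_def)
  have "valid_pairs \<Omega> ps" using Cons.prems p by (auto simp: valid_pairs_def)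
  then have IH: "card (w \<inter> ?P) = length ps" using Cons p by auto
  have "a \<in> w \<longleftrightarrow> b \<notin> w" using Cons.prems p by auto
  then have "w \<inter> (fst ` set (p # ps) \<union> snd ` set (p # ps)) = insert (if a \<in> w then a else b) (w \<inter> ?P)"
    using p by auto
  then show ?case using IH ab Cons.prems by simp
qed simp

text \<open>The differences \<open>g a - g b\<close> of \<open>g b = pair_prod ps * 1[insert b T \<subseteq> w]\<close> have one more pair
  and a smaller \<open>T\<close>; the sum of \<open>g b\<close> over the remaining points \<open>b\<close> is a multiple of
  \<open>pair_prod ps * 1[T \<subseteq> w]\<close> because all \<open>w\<close> have the same size.\<close>

lemma pair_span_monomial:
  assumes "finite \<Omega>" "valid_pairs \<Omega> ps" "T \<subseteq> \<Omega> - (fst ` set ps \<union> snd ` set ps)" "card T = m"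
  shows "pair_span \<Omega> r (\<lambda>w. pair_prod ps w * of_bool (T \<subseteq> w))"
  using assms(2-4)
proof (induction m arbitrary: ps T)
  case 0
  then have "T = {}" using assms(1) by (metis card_0_eq finite_Diff finite_subset)
  then show ?case using pair_span_base[OF assms(1) 0(1)] by simp
next
  case (Suc m)
  let ?P = "fst ` set ps \<union> snd ` set ps"
  have finT: "finite T" using Suc.prems assms(1) by (meson finite_Diff finite_subset)
  obtain a where a: "a \<in> T" using Suc.prems by fastforce
  define T' where "T' = T - {a}"
  have T': "card T' = m" "T = insert a T'" "a \<notin> T'" "finite T'" "T' \<subseteq> \<Omega> - ?P" "a \<in> \<Omega> - ?P"
    using Suc.prems a finT by (auto simp: T'_def)
  define R where "R = \<Omega> - ?P - T'"
  have R: "finite R" "a \<in> R" using assms(1) T' by (auto simp: R_def)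
  define g where "g b w = pair_prod ps w * of_bool (insert b T' \<subseteq> w)" for b w
  have diff: "pair_span \<Omega> r (\<lambda>w. g a w - g b w)" if "b \<in> R" for b
  proof (cases "b = a")
    case True
    then show ?thesis using pair_span_sum[of "{}"] by simp
  next
    case False
    have "valid_pairs \<Omega> ((a, b) # ps)"
      using Suc.prems(1) T' that False by (auto simp: valid_pairs_def R_def)
    then have "pair_span \<Omega> r (\<lambda>w. pair_prod ((a, b) # ps) w * of_bool (T' \<subseteq> w))"
      using T' that by (intro Suc.IH) (auto simp: R_def)
    then show ?thesis by (rule pair_span_cong) (auto simp: g_def)
  qed
  have low: "pair_span \<Omega> r (\<lambda>w. pair_prod ps w * of_bool (T' \<subseteq> w))"
    using Suc.prems T' by (intro Suc.IH) auto
  \<comment> \<open>The number of elements that \<open>w\<close> has left in \<open>R\<close>. The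
    subtraction is in the reals because it may be negative, in which case no \<open>w\<close>
    contributes.\<close>
  let ?k = "real r - real (length ps) - real m"
  have sum: "(\<Sum>b\<in>R. g b w) = ?k * (pair_prod ps w * of_bool (T' \<subseteq> w))" if w: "w \<in> slice \<Omega> r" for w
  proof (cases "T' \<subseteq> w \<and> pair_prod ps w \<noteq> 0")
    case True
    have finw: "finite w" using w assms(1) by (auto simp: slice_def intro: finite_subset)
    have "(\<Sum>b\<in>R. g b w) = pair_prod ps w * real (card (w \<inter> R))"
      using True R by (simp add: g_def flip: sum_distrib_left) (simp add: of_bool_def sum.If_cases Int_def conj_commute)
    moreover have "card w = card (w \<inter> ?P) + card T' + card (w \<inter> R)"
    proof -
      have "w = (w \<inter> ?P \<union> T') \<union> (w \<inter> R)" using True w by (auto simp: R_def slice_def)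
      moreover have "card ((w \<inter> ?P \<union> T') \<union> (w \<inter> R)) = card (w \<inter> ?P \<union> T') + card (w \<inter> R)"
        using finw T' by (intro card_Un_disjoint) (auto simp: R_def)
      moreover have "card (w \<inter> ?P \<union> T') = card (w \<inter> ?P) + card T'"
        using finw T' by (intro card_Un_disjoint) auto
      ultimately show ?thesis by simp
    qed
    moreover have "card (w \<inter> ?P) = length ps"
      using card_inter_pair_points[OF Suc.prems(1) _ finw] True by simp
    moreover have "card w = r" using w by (simp add: slice_def)
    ultimately show ?thesis using True T' by (simp add: algebra_simps)
  next
    case False
    then show ?thesis by (auto simp: g_def)
  qed
  have cR: "card R \<noteq> 0" using R by auto
  \<comment> \<open>\<open>card R * g a\<close> is the sum of the differences
    \<open>g a - g b\<close> plus the sum of all \<open>g b\<close>.\<close>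
  have "pair_span \<Omega> r (\<lambda>w. (1 / card R) * ((\<Sum>b\<in>R. g a w - g b w) + ?k * (pair_prod ps w * of_bool (T' \<subseteq> w))))"
    using R diff low by (intro pair_span_cmult pair_span_add pair_span_sum)
  then have "pair_span \<Omega> r (g a)"
    by (rule pair_span_cong) (use cR sum in \<open>simp add: sum_subtractf\<close>)
  then show ?case unfolding g_def T'(2) by simp
qed

text \<open>Sets in the slice have equal size, so \<open>u \<subseteq> w\<close> means
  \<open>u = w\<close> there: the monomial of \<open>u\<close> is a point indicator.\<close>

lemma pair_span_all:
  assumes "finite \<Omega>"
  shows "pair_span \<Omega> r f"
proof -
  have "pair_span \<Omega> r (\<lambda>w. \<Sum>u\<in>slice \<Omega> r. f u * (pair_prod [] w * of_bool (u \<subseteq> w)))"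
    using assms by (intro pair_span_sum pair_span_cmult pair_span_monomial) (auto simp: valid_pairs_def slice_def)
  then show ?thesis
  proof (rule pair_span_cong)
    fix w assume w: "w \<in> slice \<Omega> r"
    have "u \<subseteq> w \<longleftrightarrow> u = w" if "u \<in> slice \<Omega> r" for u
      using that w assms card_subset_eq[of w u] finite_subset[of w \<Omega>] by (auto simp: slice_def)
    then have "(\<Sum>u\<in>slice \<Omega> r. f u * (pair_prod [] w * of_bool (u \<subseteq> w))) = (\<Sum>u\<in>slice \<Omega> r. f u * of_bool (u = w))"
      by (intro sum.cong) auto
    also have "\<dots> = f w" using w assms by (simp add: of_bool_def sum.delta' mult_if_delta if_distrib cong: if_cong)
    finally show "(\<Sum>u\<in>slice \<Omega> r. f u * (pair_prod [] w * of_bool (u \<subseteq> w))) = f w" .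
  qed
qed

section \<open>Operator norm and expander mixing\<close>

lemma slice_op_sym:
  assumes "finite \<Omega>"
  shows "(\<Sum>u\<in>slice \<Omega> r. slice_op \<Omega> r s f u * g u) = (\<Sum>u\<in>slice \<Omega> r. f u * slice_op \<Omega> r s g u)"
proof -
  have op: "slice_op \<Omega> r s h u = (\<Sum>w\<in>slice \<Omega> r. of_bool (card (u \<inter> w) = s) * h w)" for h u
  proof -
    have "of_bool (card (u \<inter> w) = s) * h w = (if card (u \<inter> w) = s then h w else 0)" for w by simp
    then show ?thesis
      unfolding slice_op_def slice_nbrs_def using assms by (simp only: sum.inter_filter finite_slice)
  qed
  have "(\<Sum>u\<in>slice \<Omega> r. slice_op \<Omega> r s f u * g u) =
      (\<Sum>u\<in>slice \<Omega> r. \<Sum>w\<in>slice \<Omega> r. of_bool (card (u \<inter> w) = s) * f w * g u)"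
    unfolding op by (simp add: sum_distrib_right)
  also have "\<dots> = (\<Sum>w\<in>slice \<Omega> r. \<Sum>u\<in>slice \<Omega> r. of_bool (card (u \<inter> w) = s) * f w * g u)"
    by (rule sum.swap)
  also have "\<dots> = (\<Sum>u\<in>slice \<Omega> r. f u * slice_op \<Omega> r s g u)"
    unfolding op sum_distrib_left by (intro sum.cong refl) (simp add: Int_commute mult_ac)
  finally show ?thesis .
qed

text \<open>Log-convexity of \<open>m \<mapsto> \<parallel>A\<^sup>m f\<parallel>\<^sup>2\<close> for a symmetric operator \<open>A\<close> turns exponential growth at rate
  \<open>L\<^sup>2\<close> into an operator bound, without any orthogonality of the eigenfunctions.\<close>

lemma first_ratio_le_growth_rate:
  fixes a :: "nat \<Rightarrow> real"
  assumes nn: "\<And>m. 0 \<le> a m" and lc: "\<And>m. (a (Suc m))\<^sup>2 \<le> a m * a (Suc (Suc m))"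
    and growth: "\<And>m. a m \<le> M * q ^ m" and "0 < q"
  shows "a 1 \<le> q * a 0"
proof (rule ccontr)
  assume "\<not> a 1 \<le> q * a 0"
  then have gt: "q * a 0 < a 1" by simp
  then have "0 < a 1" using nn[of 0] \<open>0 < q\<close> by (smt (verit) mult_nonneg_nonneg)
  then have a0: "0 < a 0" using lc[of 0] nn[of 0] by (cases "a 0 = 0") auto
  \<comment> \<open>The first ratio. By log-convexity the ratios do not decrease, so a value above
    \<open>q\<close> would force growth like \<open>t ^ m\<close>, which contradicts
    \<open>growth\<close> however large \<open>M\<close> is.\<close>
  define t where "t = a 1 / a 0"
  have t: "q < t" "0 < t" using gt a0 \<open>0 < q\<close> \<open>0 < a 1\<close> by (auto simp: t_def field_simps)
  have ratio: "0 < a m \<and> t * a m \<le> a (Suc m)" for m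
  proof (induction m)
    case 0
    then show ?case using a0 by (simp add: t_def)
  next
    case (Suc m)
    then have am: "0 < a m" and le: "t * a m \<le> a (Suc m)" by auto
    have pos: "0 < a (Suc m)" using am le t by (smt (verit) mult_pos_pos)
    have "a m * (t * a (Suc m)) \<le> a (Suc m) * a (Suc m)"
      using mult_right_mono[OF le, of "a (Suc m)"] pos by (simp add: mult_ac)
    also have "\<dots> \<le> a m * a (Suc (Suc m))" using lc[of m] by (simp add: power2_eq_square)
    finally show ?case using pos am by simp
  qed
  have low: "a 0 * t ^ m \<le> a m" for m
  proof (induction m)
    case (Suc m)
    have "a 0 * t ^ Suc m = t * (a 0 * t ^ m)" by simp
    also have "\<dots> \<le> t * a m" using Suc t by simp
    finally show ?case using ratio[of m] by simp
  qed simp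
  have "(t / q) ^ m \<le> M / a 0" for m
    using low[of m] growth[of m] a0 \<open>0 < q\<close> by (simp add: field_simps power_divide)
  moreover have "1 < t / q" using t \<open>0 < q\<close> by simp
  then obtain m where "M / a 0 < (t / q) ^ m" using real_arch_pow by blast
  ultimately show False by (meson not_less)
qed

text \<open>Expand \<open>f\<close> in pair products. Powers of the operator multiply each
  coefficient by the power of its eigenvalue, so the norms grow at most like \<open>L ^ m\<close> up
  to a constant depending on \<open>f\<close>; \<open>first_ratio_le_growth_rate\<close> removes the
  constant.\<close>

lemma slice_op_norm_le:
  assumes "finite \<Omega>" "r \<le> card \<Omega>" "s \<le> r" "0 < L"
    and eig: "\<And>ps. valid_pairs \<Omega> ps \<Longrightarrow> ps \<noteq> [] \<Longrightarrow>
       \<bar>signed_count (-1) (length ps) r (card \<Omega> - r) s (r - s)\<bar> \<le> L"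
    and f0: "(\<Sum>w\<in>slice \<Omega> r. f w) = 0"
  shows "(\<Sum>w\<in>slice \<Omega> r. (slice_op \<Omega> r s f w)\<^sup>2) \<le> L\<^sup>2 * (\<Sum>w\<in>slice \<Omega> r. (f w)\<^sup>2)"
proof -
  let ?X = "slice \<Omega> r" and ?A = "slice_op \<Omega> r s"
  let ?lam = "\<lambda>ps. signed_count (-1) (length ps) r (card \<Omega> - r) s (r - s)"
  let ?V = "all_pairs \<Omega> - {[]}"
  have fin: "finite ?X" using assms by simp
  have "card ?X = card \<Omega> choose r" unfolding slice_def using assms by (simp add: n_subsets)
  then have cX: "real (card ?X) \<noteq> 0" using assms by simp
  have finV: "finite (all_pairs \<Omega>)" using assms by (simp add: finite_all_pairs)
  have Nil: "[] \<in> all_pairs \<Omega>" by (simp add: all_pairs_def valid_pairs_def)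
  obtain c where c: "\<And>w. w \<in> ?X \<Longrightarrow> f w = (\<Sum>ps\<in>all_pairs \<Omega>. c ps * pair_prod ps w)"
    using pair_span_all[OF assms(1), of r f] unfolding pair_span_def by blast
  have "(\<Sum>w\<in>?X. f w) = (\<Sum>ps\<in>all_pairs \<Omega>. c ps * (\<Sum>w\<in>?X. pair_prod ps w))"
    using sum.swap[of "\<lambda>w ps. c ps * pair_prod ps w" "all_pairs \<Omega>" ?X] c by (simp add: sum_distrib_left)
  also have "\<dots> = (\<Sum>ps\<in>{[]}. c ps * (\<Sum>w\<in>?X. pair_prod ps w))"
  proof (intro sum.mono_neutral_right ballI)
    fix ps assume ps: "ps \<in> ?V"
    then obtain a b where ab: "(a, b) \<in> set ps" by (cases ps) auto
    have "(\<Sum>w\<in>?X. pair_prod ps w) = 0"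
    proof (rule sum_pair_prod_swap[OF _ ab])
      show "valid_pairs \<Omega> ps" using ps by (simp add: all_pairs_def)
      then show "Transposition.transpose a b ` w \<in> ?X" if "w \<in> ?X" for w
        using that valid_pairs_mem[OF _ ab] by (intro transpose_slice) auto
    qed
    then show "c ps * (\<Sum>w\<in>?X. pair_prod ps w) = 0" by simp
  qed (use finV Nil in auto)
  \<comment> \<open>Only the constant function \<open>pair_prod []\<close> has nonzero sum over the
    slice, so mean zero removes the top eigenvalue.\<close>
  finally have "c [] = 0" using f0 cX by simp
  then have f: "f w = (\<Sum>ps\<in>?V. c ps * pair_prod ps w)" if "w \<in> ?X" for w
    using c[OF that] sum.remove[OF finV Nil, of "\<lambda>ps. c ps * pair_prod ps w"] by simp
  have pow: "(?A ^^ m) f w = (\<Sum>ps\<in>?V. c ps * ?lam ps ^ m * pair_prod ps w)" if "w \<in> ?X" for m w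
    using that
  proof (induction m arbitrary: w)
    case 0
    then show ?case using f by simp
  next
    case (Suc m)
    have sub: "slice_nbrs \<Omega> r s w \<subseteq> ?X" by (auto simp: slice_nbrs_def)
    have "(?A ^^ Suc m) f w = (\<Sum>v\<in>slice_nbrs \<Omega> r s w. (?A ^^ m) f v)" by (simp add: slice_op_def)
    also have "\<dots> = (\<Sum>v\<in>slice_nbrs \<Omega> r s w. \<Sum>ps\<in>?V. c ps * ?lam ps ^ m * pair_prod ps v)"
      using sub Suc.IH by (intro sum.cong) auto
    also have "\<dots> = (\<Sum>ps\<in>?V. c ps * ?lam ps ^ m * ?A (pair_prod ps) w)"
      by (subst sum.swap) (simp add: slice_op_def sum_distrib_left)
    also have "\<dots> = (\<Sum>ps\<in>?V. c ps * ?lam ps ^ Suc m * pair_prod ps w)"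
      using assms Suc.prems by (intro sum.cong refl) (simp add: slice_op_pair_prod all_pairs_def)
    finally show ?case .
  qed
  define a where "a m = (\<Sum>w\<in>?X. ((?A ^^ m) f w)\<^sup>2)" for m
  define C where "C = (\<Sum>ps\<in>?V. \<bar>c ps\<bar>)"
  have "a 1 \<le> L\<^sup>2 * a 0"
  proof (rule first_ratio_le_growth_rate[where M = "card ?X * C\<^sup>2"])
    show "0 \<le> a m" for m by (auto simp: a_def sum_nonneg)
    show "(a (Suc m))\<^sup>2 \<le> a m * a (Suc (Suc m))" for m
    proof -
      \<comment> \<open>Moving one application of the symmetric operator across the inner product
        turns Cauchy-Schwarz into log-convexity.\<close>
      have "a (Suc m) = (\<Sum>w\<in>?X. (?A ^^ m) f w * (?A ^^ Suc (Suc m)) f w)"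
        using slice_op_sym[OF assms(1), of r s "(?A ^^ m) f" "(?A ^^ Suc m) f"]
        by (simp add: a_def power2_eq_square)
      then show ?thesis
        using Cauchy_Schwarz_ineq_sum[of "(?A ^^ m) f" "(?A ^^ Suc (Suc m)) f" ?X] by (simp add: a_def)
    qed
    show "a m \<le> (card ?X * C\<^sup>2) * (L\<^sup>2) ^ m" for m
    proof -
      have "((?A ^^ m) f w)\<^sup>2 \<le> C\<^sup>2 * (L\<^sup>2) ^ m" if w: "w \<in> ?X" for w
      proof -
        have "\<bar>(?A ^^ m) f w\<bar> \<le> (\<Sum>ps\<in>?V. \<bar>c ps * ?lam ps ^ m * pair_prod ps w\<bar>)"
          unfolding pow[OF w] by (rule sum_abs)
        also have "\<dots> \<le> (\<Sum>ps\<in>?V. \<bar>c ps\<bar> * L ^ m)"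
        proof (rule sum_mono)
          fix ps assume ps: "ps \<in> ?V"
          have "\<bar>?lam ps\<bar> ^ m \<le> L ^ m" using ps eig[of ps] by (intro power_mono) (auto simp: all_pairs_def)
          then have "\<bar>c ps\<bar> * \<bar>?lam ps\<bar> ^ m * \<bar>pair_prod ps w\<bar> \<le> \<bar>c ps\<bar> * L ^ m * 1"
            using abs_pair_prod_le[of ps w] assms(4) by (intro mult_mono) auto
          then show "\<bar>c ps * ?lam ps ^ m * pair_prod ps w\<bar> \<le> \<bar>c ps\<bar> * L ^ m"
            by (simp add: abs_mult power_abs)
        qed
        also have "\<dots> = C * L ^ m" by (simp add: C_def sum_distrib_right)
        finally have "\<bar>(?A ^^ m) f w\<bar>\<^sup>2 \<le> (C * L ^ m)\<^sup>2" by (intro power_mono) auto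
        then show ?thesis by (simp add: power_mult_distrib mult.commute flip: power_mult)
      qed
      then have "a m \<le> (\<Sum>w\<in>?X. C\<^sup>2 * (L\<^sup>2) ^ m)" unfolding a_def by (rule sum_mono)
      then show ?thesis by simp
    qed
  qed (use assms in auto)
  then show ?thesis by (simp add: a_def)
qed

definition slice_pairs :: "nat \<Rightarrow> 'a set set \<Rightarrow> 'a set set \<Rightarrow> ('a set \<times> 'a set) set" where
  "slice_pairs s A B = {(u, w) \<in> A \<times> B. card (u \<inter> w) = s}"

lemma slice_mixing:
  assumes "finite \<Omega>" "r \<le> card \<Omega>" "s \<le> r" "0 < L"
    and eig: "\<And>ps. valid_pairs \<Omega> ps \<Longrightarrow> ps \<noteq> [] \<Longrightarrow>
       \<bar>signed_count (-1) (length ps) r (card \<Omega> - r) s (r - s)\<bar> \<le> L"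
    and A: "A \<subseteq> slice \<Omega> r" and B: "B \<subseteq> slice \<Omega> r"
  shows "\<bar>real (card (slice_pairs s A B)) -
     real ((r choose s) * ((card \<Omega> - r) choose (r - s))) * real (card A) * real (card B) / real (card (slice \<Omega> r))\<bar>
     \<le> L * sqrt (real (card A) * real (card B))"
proof -
  let ?X = "slice \<Omega> r"
  define N where "N = real (card ?X)"
  define d where "d = real ((r choose s) * ((card \<Omega> - r) choose (r - s)))"
  have fin: "finite ?X" using assms by simp
  have finA: "finite A" "finite B" using A B fin finite_subset by auto
  have "card ?X = card \<Omega> choose r" unfolding slice_def using assms by (simp add: n_subsets)
  then have N: "0 < N" using assms by (simp add: N_def)
  \<comment> \<open>The indicator of \<open>B\<close> minus its mean: the mean yields the main term
    of the count, \<open>f\<close> the error.\<close>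
  define f where "f w = of_bool (w \<in> B) - real (card B) / N" for w
  have sB: "(\<Sum>w\<in>?X. of_bool (w \<in> B)) = real (card B)"
    using B fin by (simp add: Int_absorb1 Int_absorb2 flip: Int_def)
  have f0: "(\<Sum>w\<in>?X. f w) = 0" using N sB by (simp add: f_def sum_subtractf N_def)
  define k where "k = real (card B) / N"
  have "(\<Sum>w\<in>?X. (f w)\<^sup>2) = (\<Sum>w\<in>?X. (1 - 2 * k) * of_bool (w \<in> B) + k\<^sup>2)"
    by (intro sum.cong refl) (auto simp: f_def k_def power2_eq_square algebra_simps)
  also have "\<dots> = (1 - 2 * k) * real (card B) + N * k\<^sup>2"
    by (simp add: sum.distrib sB N_def flip: sum_distrib_left)
  also have "\<dots> = real (card B) - real (card B) * real (card B) / N"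
    using N by (simp add: k_def power2_eq_square field_simps)
  also have "\<dots> \<le> real (card B)" using N by simp
  finally have f2: "(\<Sum>w\<in>?X. (f w)\<^sup>2) \<le> real (card B)" .
  have deg: "slice_op \<Omega> r s (\<lambda>_. 1) u = d" if u: "u \<in> ?X" for u
    using slice_op_pair_prod[OF assms(1) _ u assms(3), of "[]"] by (simp add: valid_pairs_def d_def slice_op_def)
  have opf: "slice_op \<Omega> r s f u = real (card {w \<in> B. card (u \<inter> w) = s}) - d * real (card B) / N" if u: "u \<in> ?X" for u
  proof -
    have finn: "finite (slice_nbrs \<Omega> r s u)" using assms by simp
    have "slice_op \<Omega> r s f u = (\<Sum>w\<in>slice_nbrs \<Omega> r s u. of_bool (w \<in> B)) - real (card B) / N * slice_op \<Omega> r s (\<lambda>_. 1) u"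
      by (simp add: slice_op_def f_def sum_subtractf)
    also have "(\<Sum>w\<in>slice_nbrs \<Omega> r s u. of_bool (w \<in> B)) = real (card {w \<in> B. card (u \<inter> w) = s})"
    proof -
      have "slice_nbrs \<Omega> r s u \<inter> {w. w \<in> B} = {w \<in> B. card (u \<inter> w) = s}" using B by (auto simp: slice_nbrs_def)
      then show ?thesis using finn by simp
    qed
    finally show ?thesis using deg[OF u] by simp
  qed
  have "slice_pairs s A B = (SIGMA u:A. {w \<in> B. card (u \<inter> w) = s})" by (auto simp: slice_pairs_def)
  then have "real (card (slice_pairs s A B)) = (\<Sum>u\<in>A. real (card {w \<in> B. card (u \<inter> w) = s}))"
    using finA by (simp add: card_SigmaI)
  also have "\<dots> = (\<Sum>u\<in>A. slice_op \<Omega> r s f u + d * real (card B) / N)"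
    using opf A by (intro sum.cong refl) auto
  finally have eq: "real (card (slice_pairs s A B)) - d * real (card A) * real (card B) / N = (\<Sum>u\<in>A. slice_op \<Omega> r s f u)"
    by (simp add: sum.distrib)
  have "(\<Sum>u\<in>A. 1 * slice_op \<Omega> r s f u)\<^sup>2 \<le> (\<Sum>u\<in>A. 1\<^sup>2) * (\<Sum>u\<in>A. (slice_op \<Omega> r s f u)\<^sup>2)"
    by (rule Cauchy_Schwarz_ineq_sum)
  also have "\<dots> \<le> real (card A) * (\<Sum>u\<in>?X. (slice_op \<Omega> r s f u)\<^sup>2)"
    using A fin by (auto intro!: mult_left_mono sum_mono2)
  also have "\<dots> \<le> real (card A) * (L\<^sup>2 * (\<Sum>w\<in>?X. (f w)\<^sup>2))"
    using slice_op_norm_le[OF assms(1-4) eig f0] by (intro mult_left_mono) auto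
  also have "\<dots> \<le> real (card A) * (L\<^sup>2 * real (card B))"
    using f2 by (intro mult_left_mono) auto
  finally have "(\<Sum>u\<in>A. slice_op \<Omega> r s f u)\<^sup>2 \<le> L\<^sup>2 * (real (card A) * real (card B))" by (simp add: mult_ac)
  then have "\<bar>\<Sum>u\<in>A. slice_op \<Omega> r s f u\<bar> \<le> sqrt (L\<^sup>2 * (real (card A) * real (card B)))"
    by (metis real_sqrt_abs real_sqrt_le_iff)
  also have "\<dots> = L * sqrt (real (card A) * real (card B))" using assms(4) by (simp add: real_sqrt_mult)
  finally show ?thesis unfolding eq[symmetric] d_def N_def .
qed

section \<open>Asymptotics of the eigenvalues\<close>

lemma abs_signed_count_le: "\<bar>signed_count (-1) j m q k l\<bar> \<le> signed_count 1 j m q k l"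
  by (induction "1::real" j m q k l rule: signed_count.induct) (auto intro: order_trans[OF abs_triangle_ineq4])

text \<open>For \<open>\<sigma> = 1\<close> the value counts sets that split each of
  \<open>j\<close> pairs, and a further pair is one more condition. At level 0 this is Pascal's rule
  for both binomials, of whose four products two are kept.\<close>

lemma signed_count_Suc_le: "signed_count 1 (Suc j) m q k l \<le> signed_count 1 j m q k l"
proof (induction j arbitrary: m q k l)
  case 0
  show ?case
  proof (cases "m = 0 \<or> q = 0")
    case False
    then obtain m' q' where mq: "m = Suc m'" "q = Suc q'" by (metis nat.exhaust)
    have 1: "real (m choose k) = (if k = 0 then 0 else real (m' choose (k - 1))) + real (m' choose k)"
      unfolding mq by (cases k) auto
    have 2: "real (q choose l) = (if l = 0 then 0 else real (q' choose (l - 1))) + real (q' choose l)"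
      unfolding mq by (cases l) auto
    show ?thesis unfolding signed_count.simps 1 2 using mq by (auto simp: algebra_simps)
  qed auto
next
  case (Suc j)
  show ?case
    unfolding signed_count.simps(2)[of 1 "Suc j" m q k l] signed_count.simps(2)[of 1 j m q k l]
    by (auto intro!: add_mono Suc.IH simp del: signed_count.simps)
qed

lemma signed_count_antimono: "i \<le> j \<Longrightarrow> signed_count 1 j m q k l \<le> signed_count 1 i m q k l"
  by (induction j rule: dec_induct) (auto intro: order_trans[OF signed_count_Suc_le] simp del: signed_count.simps)

lemma tendsto_ratio_diff1:
  fixes k m :: "nat \<Rightarrow> nat"
  assumes "(\<lambda>n. real (k n) / real (m n)) \<longlonglongrightarrow> \<alpha>" "filterlim m at_top sequentially"
    and "\<And>n. a n \<le> (1::nat)"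
  shows "(\<lambda>n. real (k n - a n) / real (m n - 1)) \<longlonglongrightarrow> \<alpha>"
proof -
  have m: "filterlim (\<lambda>n. real (m n)) at_top sequentially"
    by (rule filterlim_compose[OF filterlim_real_sequentially assms(2)])
  have inv: "(\<lambda>n. 1 / real (m n)) \<longlonglongrightarrow> 0"
    by (rule real_tendsto_divide_at_top[OF tendsto_const m])
  have e: "(\<lambda>n. real (k n - a n) / real (m n) - real (k n) / real (m n)) \<longlonglongrightarrow> 0"
  proof (rule Lim_null_comparison[OF _ inv], intro always_eventually allI)
    fix n
    have "\<bar>real (k n - a n) - real (k n)\<bar> \<le> 1" using assms(3)[of n] by (simp add: of_nat_diff_if)
    then show "norm (real (k n - a n) / real (m n) - real (k n) / real (m n)) \<le> 1 / real (m n)"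
      unfolding diff_divide_distrib[symmetric] by (simp add: divide_right_mono)
  qed
  have 1: "(\<lambda>n. real (k n - a n) / real (m n)) \<longlonglongrightarrow> \<alpha>"
    using tendsto_add[OF e assms(1)] by simp
  have "(\<lambda>n. real (k n - a n) / real (m n) / (1 - 1 / real (m n))) \<longlonglongrightarrow> \<alpha> / (1 - 0)"
    by (intro tendsto_divide 1 tendsto_diff tendsto_const inv) simp
  moreover have "eventually (\<lambda>n. real (k n - a n) / real (m n) / (1 - 1 / real (m n)) = real (k n - a n) / real (m n - 1)) sequentially"
    using filterlim_at_top_dense[THEN iffD1, OF m, rule_format, of 1]
    by eventually_elim (auto simp: field_simps of_nat_diff)
  ultimately have "(\<lambda>n. real (k n - a n) / real (m n - 1)) \<longlonglongrightarrow> \<alpha> / (1 - 0)"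
    by (rule Lim_transform_eventually)
  then show ?thesis by simp
qed

text \<open>In a random neighbour the two points of a pair are present independently with limiting
  density \<open>\<alpha>\<close> each, so either way of splitting it has probability tending to
  \<open>\<alpha> * (1 - \<alpha>)\<close>; the two ways have weights 1 and \<open>\<sigma>\<close>.
  Deleting the pair does not change the densities, hence the induction over all sequences. For
  \<open>\<sigma> = -1\<close> it is the equality of the two densities that makes the limit 0 when
  \<open>j > 0\<close>.\<close>

lemma signed_count_ratio_tendsto:
  assumes \<alpha>: "0 < \<alpha>" "\<alpha> < 1"
    and "filterlim m at_top sequentially" "filterlim q at_top sequentially"
    and "(\<lambda>n. real (k n) / real (m n)) \<longlonglongrightarrow> \<alpha>" "(\<lambda>n. real (l n) / real (q n)) \<longlonglongrightarrow> \<alpha>"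
  shows "(\<lambda>n. signed_count \<sigma> j (m n) (q n) (k n) (l n) / (real (m n choose k n) * real (q n choose l n)))
    \<longlonglongrightarrow> ((1 + \<sigma>) * (\<alpha> * (1 - \<alpha>))) ^ j"
  using assms(3-6)
proof (induction j arbitrary: m q k l)
  have interior: "eventually (\<lambda>n. 0 < k n \<and> k n < m n) sequentially"
    if "filterlim m at_top sequentially" "(\<lambda>n. real (k n) / real (m n)) \<longlonglongrightarrow> \<alpha>" for k m
    using order_tendstoD(1)[OF that(2) \<alpha>(1)] order_tendstoD(2)[OF that(2) \<alpha>(2)]
    by eventually_elim (auto simp: field_simps zero_less_divide_iff)
  {
    case 0
    show ?case
      by (rule tendsto_eventually)
         (use interior[OF 0(1,3)] interior[OF 0(2,4)] in eventually_elim, auto)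
  next
    case (Suc j)
    note lim = Suc.prems
    let ?base = "\<lambda>m q k l. real (m choose k) * real (q choose l)"
    let ?R = "\<lambda>m q k l n. signed_count \<sigma> j (m n) (q n) (k n) (l n) / ?base (m n) (q n) (k n) (l n)"
    let ?m = "\<lambda>n. m n - 1" and ?q = "\<lambda>n. q n - 1" and ?k = "\<lambda>n. k n - 1" and ?l = "\<lambda>n. l n - 1"
    let ?P = "(1 + \<sigma>) * (\<alpha> * (1 - \<alpha>))"
    have sub: "filterlim (\<lambda>n. m n - 1) at_top sequentially" if "filterlim m at_top sequentially" for m :: "nat \<Rightarrow> nat"
      using filterlim_compose[OF filterlim_minus_const_nat_at_top that] by simp
    have km: "(\<lambda>n. real (?k n) / real (?m n)) \<longlonglongrightarrow> \<alpha>" "(\<lambda>n. real (k n) / real (?m n)) \<longlonglongrightarrow> \<alpha>"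
      using tendsto_ratio_diff1[OF lim(3,1), of "\<lambda>_. 1"] tendsto_ratio_diff1[OF lim(3,1), of "\<lambda>_. 0"] by auto
    have lq: "(\<lambda>n. real (?l n) / real (?q n)) \<longlonglongrightarrow> \<alpha>" "(\<lambda>n. real (l n) / real (?q n)) \<longlonglongrightarrow> \<alpha>"
      using tendsto_ratio_diff1[OF lim(4,2), of "\<lambda>_. 1"] tendsto_ratio_diff1[OF lim(4,2), of "\<lambda>_. 0"] by auto
    have 1: "?R ?m ?q ?k l \<longlonglongrightarrow> ?P ^ j" by (rule Suc.IH) (use sub lim km lq in auto)
    have 2: "?R ?m ?q k ?l \<longlonglongrightarrow> ?P ^ j" by (rule Suc.IH) (use sub lim km lq in auto)
    let ?x = "\<lambda>n. real (k n) / real (m n)" and ?y = "\<lambda>n. real (l n) / real (q n)"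
    have "(\<lambda>n. ?R ?m ?q ?k l n * (?x n * (1 - ?y n)) + \<sigma> * (?R ?m ?q k ?l n * ((1 - ?x n) * ?y n)))
      \<longlonglongrightarrow> ?P ^ j * (\<alpha> * (1 - \<alpha>)) + \<sigma> * (?P ^ j * ((1 - \<alpha>) * \<alpha>))"
      by (intro tendsto_intros 1 2 lim)
    moreover have "eventually (\<lambda>n. ?R ?m ?q ?k l n * (?x n * (1 - ?y n)) + \<sigma> * (?R ?m ?q k ?l n * ((1 - ?x n) * ?y n))
       = signed_count \<sigma> (Suc j) (m n) (q n) (k n) (l n) / ?base (m n) (q n) (k n) (l n)) sequentially"
      using interior[OF lim(1,3)] interior[OF lim(2,4)]
    proof eventually_elim
      case (elim n)
      have absorb: "real ((a - 1) choose (b - 1)) = real (a choose b) * (real b / real a)"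
        "real ((a - 1) choose b) = real (a choose b) * (1 - real b / real a)" if "0 < b" "b < a" for a b
      proof -
        have "b * (a choose b) = a * ((a - 1) choose (b - 1))"
          using binomial_absorption[of "b - 1" a] that by simp
        then have "real b * real (a choose b) = real a * real ((a - 1) choose (b - 1))" by (metis of_nat_mult)
        then show "real ((a - 1) choose (b - 1)) = real (a choose b) * (real b / real a)" using that by (simp add: field_simps)
        have "(a - b) * (a choose b) = a * ((a - 1) choose b)" by (rule binomial_absorb_comp)
        then have "real (a - b) * real (a choose b) = real a * real ((a - 1) choose b)" by (metis of_nat_mult)
        then show "real ((a - 1) choose b) = real (a choose b) * (1 - real b / real a)" using that by (simp add: field_simps of_nat_diff)
      qed
      have pos: "0 < ?x n" "?x n < 1" "0 < ?y n" "?y n < 1" "m n choose k n \<noteq> 0" "q n choose l n \<noteq> 0"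
        "m n \<noteq> 0" "q n \<noteq> 0" "k n \<noteq> 0" "l n \<noteq> 0"
        using elim by auto
      have b1: "?base (?m n) (?q n) (?k n) (l n) = ?base (m n) (q n) (k n) (l n) * (?x n * (1 - ?y n))"
        using elim by (simp only: absorb mult_ac)
      have b2: "?base (?m n) (?q n) (k n) (?l n) = ?base (m n) (q n) (k n) (l n) * ((1 - ?x n) * ?y n)"
        using elim by (simp only: absorb mult_ac)
      have gen: "(A / (D * z)) * z = A / D" if "z \<noteq> 0" for A D z :: real using that by simp
      have nz: "?x n * (1 - ?y n) \<noteq> 0" "(1 - ?x n) * ?y n \<noteq> 0" using pos by auto
      show ?case
        unfolding b1 b2 gen[OF nz(1)] gen[OF nz(2)] using pos by (simp add: add_divide_distrib)
    qed
    ultimately have "(\<lambda>n. signed_count \<sigma> (Suc j) (m n) (q n) (k n) (l n) / ?base (m n) (q n) (k n) (l n))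
      \<longlonglongrightarrow> ?P ^ j * (\<alpha> * (1 - \<alpha>)) + \<sigma> * (?P ^ j * ((1 - \<alpha>) * \<alpha>))"
      by (rule Lim_transform_eventually)
    then show ?case by (simp add: algebra_simps)
  }
qed

text \<open>High levels are small even without cancellation; each of the remaining finitely many levels
  tends to \<open>0\<close> because of it.\<close>

lemma eigenvalues_small:
  assumes \<alpha>: "0 < \<alpha>" "\<alpha> < 1" and "0 < \<epsilon>"
    and lim: "filterlim m at_top sequentially" "filterlim q at_top sequentially"
    "(\<lambda>n. real (k n) / real (m n)) \<longlonglongrightarrow> \<alpha>" "(\<lambda>n. real (l n) / real (q n)) \<longlonglongrightarrow> \<alpha>"
  shows "eventually (\<lambda>n. \<forall>j\<ge>1. \<bar>signed_count (-1) j (m n) (q n) (k n) (l n)\<bar>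
     \<le> \<epsilon> * (real (m n choose k n) * real (q n choose l n))) sequentially"
proof -
  let ?base = "\<lambda>n. real (m n choose k n) * real (q n choose l n)"
  \<comment> \<open>So the limiting probability \<open>2 * (\<alpha> * (1 - \<alpha>))\<close> that
    a pair is split is at most 1/2, and its powers tend to 0.\<close>
  have "4 * (\<alpha> * (1 - \<alpha>)) \<le> 1" using zero_le_power2[of "1 - 2 * \<alpha>"] by (simp add: power2_eq_square algebra_simps)
  then have h: "2 * (\<alpha> * (1 - \<alpha>)) < 1" "0 \<le> 2 * (\<alpha> * (1 - \<alpha>))" using \<alpha> by auto
  then have "(\<lambda>j. (2 * (\<alpha> * (1 - \<alpha>))) ^ j) \<longlonglongrightarrow> 0" by (intro LIMSEQ_power_zero) auto
  then obtain J where J: "(2 * (\<alpha> * (1 - \<alpha>))) ^ J < \<epsilon>"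
    using order_tendstoD(2)[OF _ \<open>0 < \<epsilon>\<close>] eventually_happens'[OF sequentially_bot] by metis
  have 1: "eventually (\<lambda>n. signed_count 1 J (m n) (q n) (k n) (l n) / ?base n < \<epsilon>) sequentially"
    by (rule order_tendstoD(2)[OF signed_count_ratio_tendsto[OF \<alpha> lim]]) (use J in simp)
  have 2: "eventually (\<lambda>n. \<forall>j\<in>{1..<J}. \<bar>signed_count (-1) j (m n) (q n) (k n) (l n) / ?base n\<bar> < \<epsilon>) sequentially"
  proof (rule eventually_ball_finite)
    show "\<forall>j\<in>{1..<J}. eventually (\<lambda>n. \<bar>signed_count (-1) j (m n) (q n) (k n) (l n) / ?base n\<bar> < \<epsilon>) sequentially"
    proof
      fix j assume "j \<in> {1..<J}"
      then have "(\<lambda>n. \<bar>signed_count (-1) j (m n) (q n) (k n) (l n) / ?base n\<bar>) \<longlonglongrightarrow> 0"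
        using signed_count_ratio_tendsto[OF \<alpha> lim, of "-1" j] by (intro tendsto_rabs_zero) (simp add: power_0_left)
      then show "eventually (\<lambda>n. \<bar>signed_count (-1) j (m n) (q n) (k n) (l n) / ?base n\<bar> < \<epsilon>) sequentially"
        by (rule order_tendstoD(2)) (rule \<open>0 < \<epsilon>\<close>)
    qed
  qed simp
  have 3: "eventually (\<lambda>n. ?base n > 0) sequentially"
    using order_tendstoD(2)[OF lim(3) \<alpha>(2)] order_tendstoD(2)[OF lim(4) \<alpha>(2)]
      order_tendstoD(1)[OF lim(3) \<alpha>(1)] order_tendstoD(1)[OF lim(4) \<alpha>(1)]
    by eventually_elim (auto simp: field_simps zero_less_divide_iff)
  show ?thesis using 1 2 3
  proof eventually_elim
    case (elim n)
    show ?case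
    proof (intro allI impI)
      fix j :: nat assume j: "1 \<le> j"
      show "\<bar>signed_count (-1) j (m n) (q n) (k n) (l n)\<bar> \<le> \<epsilon> * ?base n"
      proof (cases "j < J")
        case True
        then have "\<bar>signed_count (-1) j (m n) (q n) (k n) (l n) / ?base n\<bar> < \<epsilon>" using elim j by auto
        then show ?thesis using elim(3) by (simp add: abs_divide field_simps)
      next
        case False
        then have "\<bar>signed_count (-1) j (m n) (q n) (k n) (l n)\<bar> \<le> signed_count 1 J (m n) (q n) (k n) (l n)"
          by (intro order_trans[OF abs_signed_count_le] signed_count_antimono) simp
        then show ?thesis using elim(1,3) by (simp add: field_simps)
      qed
    qed
  qed
qed

section \<open>The Johnson graphs are mixing\<close>

text \<open>Ordered pairs, so an edge inside \<open>A \<inter> B\<close> counts twice, in accordance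
  with the main term: for \<open>A = B = V\<close> both are \<open>d * card V\<close>. Measuring the
  error in units of \<open>d\<close> lets one \<open>\<epsilon>\<close> serve along a sequence of
  growing degree.\<close>

definition mixing_graph :: "'a set \<Rightarrow> 'a set set \<Rightarrow> nat \<Rightarrow> real \<Rightarrow> bool" where
  "mixing_graph V E d \<epsilon> \<longleftrightarrow> finite V \<and> (\<forall>e\<in>E. e \<subseteq> V \<and> card e = 2) \<and>
     (\<forall>v\<in>V. card {e \<in> E. v \<in> e} = d) \<and>
     (\<forall>A\<subseteq>V. \<forall>B\<subseteq>V. \<bar>real (card {(a, b) \<in> A \<times> B. {a, b} \<in> E})
        - real d * real (card A) * real (card B) / real (card V)\<bar>
        \<le> \<epsilon> * real d * sqrt (real (card A) * real (card B)))"

section \<open>From 0/1 vectors to their sets of ones\<close>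

definition ones :: "nat \<Rightarrow> (nat \<Rightarrow> nat) \<Rightarrow> nat set" where
  "ones n v = {i \<in> {..<n}. v i = 1}"

lemma bij_betw_ones: "bij_betw (ones n) (johnson_verts n r) (slice {..<n} r)"
proof (rule bij_betw_byWitness[where f' = "\<lambda>w. \<lambda>i\<in>{..<n}. of_bool (i \<in> w)"])
  show "\<forall>v\<in>johnson_verts n r. (\<lambda>i\<in>{..<n}. of_bool (i \<in> ones n v)) = v"
  proof (intro ballI ext)
    fix v i assume "v \<in> johnson_verts n r"
    then have v: "v \<in> {..<n} \<rightarrow>\<^sub>E {0, 1}" by (simp add: johnson_verts_def)
    show "(\<lambda>i\<in>{..<n}. of_bool (i \<in> ones n v)) i = v i"
    proof (cases "i < n")
      case True
      then have "v i = 0 \<or> v i = 1" using v by (auto simp: PiE_def Pi_def)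
      then show ?thesis using True by (auto simp: ones_def)
    next
      case False
      then show ?thesis using PiE_arb[OF v, of i] by simp
    qed
  qed
  have eq: "ones n (\<lambda>i\<in>{..<n}. of_bool (i \<in> w)) = w" if "w \<subseteq> {..<n}" for w
    using that by (auto simp: ones_def)
  then show "\<forall>w\<in>slice {..<n} r. ones n (\<lambda>i\<in>{..<n}. of_bool (i \<in> w)) = w" by (auto simp: slice_def)
  show "ones n ` johnson_verts n r \<subseteq> slice {..<n} r"
    by (auto simp: johnson_verts_def slice_def ones_def)
  show "(\<lambda>w. \<lambda>i\<in>{..<n}. of_bool (i \<in> w)) ` slice {..<n} r \<subseteq> johnson_verts n r"
  proof clarify
    fix w assume w: "w \<in> slice {..<n} r"
    then have "card (ones n (\<lambda>i\<in>{..<n}. of_bool (i \<in> w))) = r" using eq by (simp add: slice_def)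
    then show "(\<lambda>i\<in>{..<n}. of_bool (i \<in> w)) \<in> johnson_verts n r"
      unfolding ones_def johnson_verts_def by auto
  qed
qed

lemma inner_eq_card_ones:
  assumes "u \<in> johnson_verts n r" "v \<in> johnson_verts n r'"
  shows "(\<Sum>i<n. u i * v i) = card (ones n u \<inter> ones n v)"
proof -
  have 01: "u i = 0 \<or> u i = 1" "v i = 0 \<or> v i = 1" if "i < n" for i
    using assms that unfolding johnson_verts_def PiE_def Pi_def by auto
  have "(\<Sum>i<n. u i * v i) = (\<Sum>i<n. of_bool (i \<in> ones n u \<inter> ones n v))"
  proof (rule sum.cong)
    fix i assume "i \<in> {..<n}"
    then show "u i * v i = of_bool (i \<in> ones n u \<inter> ones n v)" using 01[of i] by (auto simp: ones_def)
  qed simp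
  also have "\<dots> = card ({..<n} \<inter> {i. i \<in> ones n u \<inter> ones n v})" by simp
  also have "{..<n} \<inter> {i. i \<in> ones n u \<inter> ones n v} = ones n u \<inter> ones n v" by (auto simp: ones_def)
  finally show ?thesis .
qed

text \<open>A vector has inner product \<open>r\<close> with itself, so for
  \<open>s \<noteq> r\<close> loops are excluded automatically and adjacency depends on the overlap
  alone.\<close>

lemma johnson_edge_iff:
  assumes "u \<in> johnson_verts n r" "v \<in> johnson_verts n r" "s \<noteq> r"
  shows "{u, v} \<in> edges (johnson_graph n r s) \<longleftrightarrow> card (ones n u \<inter> ones n v) = s"
proof -
  have "card (ones n u) = r" using assms(1) by (simp add: johnson_verts_def ones_def)
  then have "u \<noteq> v" if "card (ones n u \<inter> ones n v) = s" using that assms(3) by auto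
  then show ?thesis
    using assms(1,2) inner_eq_card_ones[OF assms(1,2)] inner_eq_card_ones[OF assms(2,1)]
    by (auto simp: johnson_graph_def doubleton_eq_iff Int_commute)
qed

lemma johnson_edge_cases:
  assumes "e \<in> edges (johnson_graph n r s)"
  obtains u v where "e = {u, v}" "u \<in> johnson_verts n r" "v \<in> johnson_verts n r" "u \<noteq> v"
  using assms by (auto simp: johnson_graph_def)

lemma card_johnson_verts: "card (johnson_verts n r) = n choose r"
  using bij_betw_same_card[OF bij_betw_ones[of n r]] by (simp add: slice_def n_subsets)

lemma finite_johnson_verts: "finite (johnson_verts n r)"
  using bij_betw_finite[OF bij_betw_ones[of n r]] by simp

lemma johnson_degree:
  assumes v: "v \<in> johnson_verts n r" and "s < r"
  shows "card {e \<in> edges (johnson_graph n r s). v \<in> e} = (r choose s) * ((n - r) choose (r - s))"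
proof -
  let ?E = "edges (johnson_graph n r s)" and ?V = "johnson_verts n r"
  have vs: "ones n v \<in> slice {..<n} r" using bij_betw_ones v by (rule bij_betwE[THEN bspec])
  have "{e \<in> ?E. v \<in> e} = (\<lambda>w. {v, w}) ` {w \<in> ?V. {v, w} \<in> ?E}"
  proof
    show "{e \<in> ?E. v \<in> e} \<subseteq> (\<lambda>w. {v, w}) ` {w \<in> ?V. {v, w} \<in> ?E}"
    proof
      fix e assume e: "e \<in> {e \<in> ?E. v \<in> e}"
      then obtain a b where "e = {a, b}" "a \<in> ?V" "b \<in> ?V" using johnson_edge_cases by blast
      then show "e \<in> (\<lambda>w. {v, w}) ` {w \<in> ?V. {v, w} \<in> ?E}" using e by (auto simp: insert_commute)
    qed
  qed auto
  moreover have "inj_on (\<lambda>w. {v, w}) {w \<in> ?V. {v, w} \<in> ?E}" by (auto simp: inj_on_def doubleton_eq_iff)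
  ultimately have "card {e \<in> ?E. v \<in> e} = card {w \<in> ?V. {v, w} \<in> ?E}" by (simp add: card_image)
  also have "\<dots> = card (ones n ` {w \<in> ?V. {v, w} \<in> ?E})"
  proof (rule card_image[symmetric], rule inj_on_subset)
    show "inj_on (ones n) ?V" using bij_betw_ones[of n r] by (simp add: bij_betw_def)
  qed simp
  also have "ones n ` {w \<in> ?V. {v, w} \<in> ?E} = slice_nbrs {..<n} r s (ones n v)"
  proof -
    have "{w \<in> ?V. {v, w} \<in> ?E} = {w \<in> ?V. card (ones n v \<inter> ones n w) = s}"
      using johnson_edge_iff[OF v] assms(2) by auto
    moreover have "ones n ` ?V = slice {..<n} r" using bij_betw_ones[of n r] by (simp add: bij_betw_def)
    moreover have "ones n ` {w \<in> ?V. card (ones n v \<inter> ones n w) = s} = {x \<in> ones n ` ?V. card (ones n v \<inter> x) = s}"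
      by blast
    ultimately show ?thesis unfolding slice_nbrs_def by simp
  qed
  also have "\<dots> = split_sets (ones n v) ({..<n} - ones n v) s (r - s)"
    using vs assms(2) by (intro slice_nbrs_eq) auto
  also have "card \<dots> = (r choose s) * ((n - r) choose (r - s))"
  proof -
    have o: "ones n v \<subseteq> {..<n}" "card (ones n v) = r" using vs by (auto simp: slice_def)
    then have "finite (ones n v)" by (meson finite_lessThan finite_subset)
    then have "card ({..<n} - ones n v) = n - r" using o by (simp add: card_Diff_subset)
    then show ?thesis using o \<open>finite (ones n v)\<close> card_split_sets[of "ones n v" "{..<n} - ones n v"] by simp
  qed
  finally show ?thesis .
qed

lemma regular_degree_eq:
  assumes "verts G \<noteq> {}" "\<And>v. v \<in> verts G \<Longrightarrow> card {e \<in> edges G. v \<in> e} = d"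
  shows "regular_degree G = d"
  unfolding regular_degree_def degree_def using assms by (intro the_equality) auto

lemma johnson_mixing:
  assumes "s < r" "r \<le> n" "0 < \<epsilon>" "d = (r choose s) * ((n - r) choose (r - s))" "0 < d"
    and eig: "\<And>j. 1 \<le> j \<Longrightarrow> \<bar>signed_count (-1) j r (n - r) s (r - s)\<bar> \<le> \<epsilon> * real d"
  shows "mixing_graph (johnson_verts n r) (edges (johnson_graph n r s)) d \<epsilon>"
proof -
  let ?E = "edges (johnson_graph n r s)" and ?V = "johnson_verts n r"
  have inj: "inj_on (ones n) ?V" and img: "ones n ` ?V = slice {..<n} r"
    using bij_betw_ones[of n r] by (auto simp: bij_betw_def)
  have mix: "\<bar>real (card {(a, b) \<in> A \<times> B. {a, b} \<in> ?E}) - real d * real (card A) * real (card B) / real (card ?V)\<bar>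
        \<le> \<epsilon> * real d * sqrt (real (card A) * real (card B))" if A: "A \<subseteq> ?V" and B: "B \<subseteq> ?V" for A B
  proof -
    have cA: "card (ones n ` A) = card A" and cB: "card (ones n ` B) = card B"
      using inj A B by (auto intro!: card_image intro: inj_on_subset)
    have cV: "card ?V = card (slice {..<n} r)" using card_image[OF inj] img by simp
    have img2: "map_prod (ones n) (ones n) ` {(a, b) \<in> A \<times> B. {a, b} \<in> ?E} = slice_pairs s (ones n ` A) (ones n ` B)"
    proof -
      have "{(a, b) \<in> A \<times> B. {a, b} \<in> ?E} = {(a, b) \<in> A \<times> B. card (ones n a \<inter> ones n b) = s}"
        using A B johnson_edge_iff[of _ n r _ s] assms(1) by blast
      then show ?thesis by (force simp: slice_pairs_def image_iff)
    qed
    have inj2: "inj_on (map_prod (ones n) (ones n)) {(a, b) \<in> A \<times> B. {a, b} \<in> ?E}"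
      using A B by (intro inj_on_subset[OF map_prod_inj_on[OF inj inj]]) auto
    have cP: "card {(a, b) \<in> A \<times> B. {a, b} \<in> ?E} = card (slice_pairs s (ones n ` A) (ones n ` B))"
      using card_image[OF inj2] unfolding img2 by (rule sym)
    have "\<bar>real (card (slice_pairs s (ones n ` A) (ones n ` B))) -
       real ((r choose s) * ((card {..<n} - r) choose (r - s))) * real (card (ones n ` A)) * real (card (ones n ` B))
         / real (card (slice {..<n} r))\<bar>
       \<le> \<epsilon> * real d * sqrt (real (card (ones n ` A)) * real (card (ones n ` B)))"
    proof (rule slice_mixing)
      show "\<bar>signed_count (- 1) (length ps) r (card {..<n} - r) s (r - s)\<bar> \<le> \<epsilon> * real d"
        if "ps \<noteq> []" for ps :: "(nat \<times> nat) list"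
        using eig[of "length ps"] that by (cases ps) auto
      show "ones n ` A \<subseteq> slice {..<n} r" "ones n ` B \<subseteq> slice {..<n} r" using A B img by blast+
    qed (use assms in auto)
    then show ?thesis unfolding cP cV cA cB assms(4) by simp
  qed
  have "e \<subseteq> ?V \<and> card e = 2" if "e \<in> ?E" for e
    using that by (elim johnson_edge_cases) auto
  then show ?thesis
    unfolding mixing_graph_def using finite_johnson_verts johnson_degree[OF _ assms(1)] mix assms(4)
    by (intro conjI ballI allI impI) simp_all
qed

section \<open>Limits of the parameters of the Johnson graphs\<close>

lemma self_le_binomial:
  assumes "0 < k" "k < n"
  shows "n \<le> n choose k"
  using assms
proof (induction n arbitrary: k)
  case (Suc n)
  show ?case
  proof (cases "k = n")
    case True
    then show ?thesis using binomial_symmetric[of 1 "Suc n"] Suc.prems by simp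
  next
    case False
    obtain k' where k: "k = Suc k'" using Suc.prems by (cases k) auto
    have "1 \<le> n choose k'" using Suc.prems k by (simp add: Suc_le_eq)
    then show ?thesis using Suc.IH[of k] Suc.prems False k by simp
  qed
qed simp

lemma filterlim_at_top_if_ratio:
  fixes x :: "nat \<Rightarrow> nat"
  assumes "(\<lambda>n. real (x n) / real n) \<longlonglongrightarrow> a" "0 < a"
  shows "filterlim x at_top sequentially"
proof -
  have "filterlim (\<lambda>n. real (x n) / real n * real n) at_top sequentially"
    by (rule filterlim_tendsto_pos_mult_at_top[OF assms filterlim_real_sequentially])
  moreover have "eventually (\<lambda>n. real (x n) / real n * real n = real (x n)) sequentially"
    using eventually_gt_at_top[of 0] by eventually_elim simp
  ultimately have "filterlim (\<lambda>n. real (x n)) at_top sequentially"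
    by (rule filterlim_cong[THEN iffD1, OF refl refl, rotated])
  then show ?thesis by (simp add: filterlim_sequentially_iff_filterlim_real)
qed

lemma ratio_tendsto_if_smallo:
  assumes "f \<in> o(\<lambda>n. real n)" "\<And>n. real (x n) = a * real n + f n"
  shows "(\<lambda>n. real (x n) / real n) \<longlonglongrightarrow> a"
proof (rule Lim_transform_eventually)
  show "(\<lambda>n. a + f n / real n) \<longlonglongrightarrow> a"
    using tendsto_add[OF tendsto_const smalloD_tendsto[OF assms(1)], of a] by simp
  show "eventually (\<lambda>n. a + f n / real n = real (x n) / real n) sequentially"
    using eventually_gt_at_top[of 0] by eventually_elim (simp add: assms(2) field_simps)
qed

lemma johnson_sequence:
  fixes \<alpha> :: real and f_r f_s :: "nat \<Rightarrow> real" and r s d N :: "nat \<Rightarrow> nat"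
    and G :: "nat \<Rightarrow> (nat \<Rightarrow> nat) graph"
  assumes \<alpha>: "0 < \<alpha>" "\<alpha> < 1"
    and f: "f_r \<in> o(\<lambda>n. real n)" "f_s \<in> o(\<lambda>n. real n)"
    and r: "\<And>n. real (r n) = \<alpha> * real n + f_r n"
    and s: "\<And>n. real (s n) = \<alpha>\<^sup>2 * real n + f_s n"
    and G: "\<And>n. G n = johnson_graph n (r n) (s n)"
    and d: "\<And>n. d n = regular_degree (G n)"
    and N: "\<And>n. N n = n choose r n"
  shows "filterlim d at_top sequentially" "filterlim N at_top sequentially"
    "\<And>n. card (verts (G n)) = N n"
    "\<And>\<epsilon>. 0 < \<epsilon> \<Longrightarrow> eventually (\<lambda>n. mixing_graph (verts (G n)) (edges (G n)) (d n) \<epsilon>) sequentially"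
proof -
  have verts: "verts (G n) = johnson_verts n (r n)" for n by (simp add: G johnson_graph_def)
  show cV: "card (verts (G n)) = N n" for n by (simp add: verts card_johnson_verts N)
  have pos: "eventually (\<lambda>n::nat. n > 0) sequentially" by (rule eventually_gt_at_top)
  note rn = ratio_tendsto_if_smallo[OF f(1) r] and sn = ratio_tendsto_if_smallo[OF f(2) s]
  have \<alpha>2: "0 < \<alpha>\<^sup>2" "\<alpha>\<^sup>2 < \<alpha>" using \<alpha> by (auto simp: power2_eq_square)
  have "(\<lambda>n. real (r n) / real n - real (s n) / real n) \<longlonglongrightarrow> \<alpha> - \<alpha>\<^sup>2" by (intro tendsto_diff rn sn)
  then have "eventually (\<lambda>n. 0 < real (r n) / real n - real (s n) / real n) sequentially"
    using \<alpha>2 by (intro order_tendstoD(1)) auto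
  then have ord: "eventually (\<lambda>n. 0 < n \<and> 0 < s n \<and> s n < r n \<and> r n < n) sequentially"
    using pos order_tendstoD(1)[OF sn \<alpha>2(1)] order_tendstoD(2)[OF rn \<alpha>(2)]
    by eventually_elim (auto simp: field_simps zero_less_divide_iff)
  note rtop = filterlim_at_top_if_ratio[OF rn \<alpha>(1)]
  have qn: "(\<lambda>n. real (n - r n) / real n) \<longlonglongrightarrow> 1 - \<alpha>"
  proof (rule Lim_transform_eventually)
    show "(\<lambda>n. 1 - real (r n) / real n) \<longlonglongrightarrow> 1 - \<alpha>" by (intro tendsto_diff tendsto_const rn)
    show "eventually (\<lambda>n. 1 - real (r n) / real n = real (n - r n) / real n) sequentially"
      using ord by eventually_elim (simp add: field_simps of_nat_diff)
  qed
  have qtop: "filterlim (\<lambda>n. n - r n) at_top sequentially"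
    using filterlim_at_top_if_ratio[OF qn] \<alpha> by simp
  \<comment> \<open>Here the overlap \<open>\<alpha>\<^sup>2 n\<close> enters: a neighbour has
    density \<open>\<alpha>\<^sup>2 / \<alpha>\<close> inside the vertex and
    \<open>(\<alpha> - \<alpha>\<^sup>2) / (1 - \<alpha>)\<close> outside, and both equal
    \<open>\<alpha>\<close>.\<close>
  have kr: "(\<lambda>n. real (s n) / real (r n)) \<longlonglongrightarrow> \<alpha>"
  proof (rule Lim_transform_eventually)
    have "(\<lambda>n. (real (s n) / real n) / (real (r n) / real n)) \<longlonglongrightarrow> \<alpha>\<^sup>2 / \<alpha>" using \<alpha> by (intro tendsto_divide rn sn) auto
    then show "(\<lambda>n. (real (s n) / real n) / (real (r n) / real n)) \<longlonglongrightarrow> \<alpha>" using \<alpha> by (simp add: power2_eq_square)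
    show "eventually (\<lambda>n. (real (s n) / real n) / (real (r n) / real n) = real (s n) / real (r n)) sequentially"
      using pos by eventually_elim simp
  qed
  have lq: "(\<lambda>n. real (r n - s n) / real (n - r n)) \<longlonglongrightarrow> \<alpha>"
  proof (rule Lim_transform_eventually)
    have "(\<lambda>n. (real (r n) / real n - real (s n) / real n) / (real (n - r n) / real n)) \<longlonglongrightarrow> (\<alpha> - \<alpha>\<^sup>2) / (1 - \<alpha>)"
      using \<alpha> by (intro tendsto_divide tendsto_diff rn sn qn) auto
    moreover have "(\<alpha> - \<alpha>\<^sup>2) / (1 - \<alpha>) = \<alpha>" using \<alpha> by (simp add: power2_eq_square field_simps)
    ultimately show "(\<lambda>n. (real (r n) / real n - real (s n) / real n) / (real (n - r n) / real n)) \<longlonglongrightarrow> \<alpha>" by simp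
    show "eventually (\<lambda>n. (real (r n) / real n - real (s n) / real n) / (real (n - r n) / real n) =
       real (r n - s n) / real (n - r n)) sequentially"
      using ord by eventually_elim (simp add: of_nat_diff flip: diff_divide_distrib)
  qed
  define D where "D n = (r n choose s n) * ((n - r n) choose (r n - s n))" for n
  have ord2: "eventually (\<lambda>n. r n - s n < n - r n) sequentially"
    using order_tendstoD(2)[OF lq \<alpha>(2)] ord by eventually_elim (auto simp: field_simps)
  have dD: "eventually (\<lambda>n. d n = D n \<and> r n \<le> D n \<and> n \<le> N n) sequentially"
    using ord ord2
  proof eventually_elim
    case (elim n)
    have "d n = D n" unfolding d D_def
    proof (rule regular_degree_eq)
      show "verts (G n) \<noteq> {}" using cV[of n] elim by (auto simp: N)
      show "card {e \<in> edges (G n). v \<in> e} = (r n choose s n) * ((n - r n) choose (r n - s n))"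
        if "v \<in> verts (G n)" for v
        using johnson_degree[of v n "r n" "s n"] that[unfolded verts] elim unfolding G by blast
    qed
    \<comment> \<open>The first binomial is at least \<open>r n\<close>; \<open>ord2\<close> makes
      the second one positive.\<close>
    moreover have "r n * 1 \<le> D n" unfolding D_def
      using elim by (intro mult_mono self_le_binomial) (auto simp: Suc_le_eq)
    moreover have "n \<le> N n" unfolding N using elim by (intro self_le_binomial) auto
    ultimately show ?case by simp
  qed
  show "filterlim d at_top sequentially"
    by (rule filterlim_at_top_mono[OF rtop]) (use dD in eventually_elim, auto)
  show "filterlim N at_top sequentially"
    by (rule filterlim_at_top_mono[OF filterlim_ident]) (use dD in eventually_elim, auto)
  fix \<epsilon> :: real assume \<epsilon>: "0 < \<epsilon>"
  show "eventually (\<lambda>n. mixing_graph (verts (G n)) (edges (G n)) (d n) \<epsilon>) sequentially"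
    using ord ord2 dD eigenvalues_small[OF \<alpha> \<epsilon> rtop qtop kr lq]
  proof eventually_elim
    case (elim n)
    show ?case unfolding verts unfolding G
    proof (rule johnson_mixing)
      show "d n = (r n choose s n) * ((n - r n) choose (r n - s n))" using elim by (simp add: D_def)
      show "\<bar>signed_count (-1) j (r n) (n - r n) (s n) (r n - s n)\<bar> \<le> \<epsilon> * real (d n)" if "1 \<le> j" for j
        using elim that by (simp add: D_def)
    qed (use elim \<epsilon> in auto)
  qed
qed

section \<open>Components in percolated mixing graphs\<close>

lemma mixing_graphD:
  assumes "mixing_graph V E d \<epsilon>"
  shows "finite V" "finite E" "\<And>e. e \<in> E \<Longrightarrow> card e = 2" "\<And>e. e \<in> E \<Longrightarrow> e \<subseteq> V"
    "\<And>v. v \<in> V \<Longrightarrow> card {e \<in> E. v \<in> e} = d" "\<And>v. card {e \<in> E. v \<in> e} \<le> d"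
proof -
  show V: "finite V" and e: "\<And>e. e \<in> E \<Longrightarrow> card e = 2" "\<And>e. e \<in> E \<Longrightarrow> e \<subseteq> V"
    and deg: "\<And>v. v \<in> V \<Longrightarrow> card {e \<in> E. v \<in> e} = d"
    using assms by (auto simp: mixing_graph_def)
  show "finite E" by (rule finite_subset[of _ "Pow V"]) (use V e in auto)
  show "card {e \<in> E. v \<in> e} \<le> d" for v
  proof (cases "v \<in> V")
    case False
    then have "{e \<in> E. v \<in> e} = {}" using e by auto
    then show ?thesis by (metis card.empty le0)
  qed (use deg in auto)
qed

text \<open>Count incidences of vertices of \<open>K\<close> with edges: a boundary edge has one end
  in \<open>K\<close>, and an incidence with an inner edge determines an ordered pair.\<close>

lemma degree_sum_le_boundary:
  assumes "finite E" "\<And>e. e \<in> E \<Longrightarrow> card e = 2" "finite K" "\<And>v. v \<in> K \<Longrightarrow> card {e \<in> E. v \<in> e} = d"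
  shows "d * card K \<le> card (boundary E K) + card {(a, b) \<in> K \<times> K. {a, b} \<in> E}"
proof -
  let ?T = "SIGMA v:K. {e \<in> E. v \<in> e}" and ?P = "{(a, b) \<in> K \<times> K. {a, b} \<in> E}"
  have "d * card K = card ?T" using assms by (simp add: card_SigmaI)
  also have "\<dots> \<le> card (snd -` boundary E K \<inter> ?T \<union> (\<lambda>(a, b). (a, {a, b})) ` ?P)"
  proof (rule card_mono)
    show "finite (snd -` boundary E K \<inter> ?T \<union> (\<lambda>(a, b). (a, {a, b})) ` ?P)"
      using assms finite_subset[of ?P "K \<times> K"] by auto
    show "?T \<subseteq> snd -` boundary E K \<inter> ?T \<union> (\<lambda>(a, b). (a, {a, b})) ` ?P"
    proof
      fix x assume x: "x \<in> ?T"
      then obtain v e where ve: "x = (v, e)" "v \<in> K" "e \<in> E" "v \<in> e" by auto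
      obtain b where b: "e = {v, b}" using assms(2)[OF ve(3)] ve(4) by (auto simp: card_2_iff)
      show "x \<in> snd -` boundary E K \<inter> ?T \<union> (\<lambda>(a, b). (a, {a, b})) ` ?P"
      proof (cases "b \<in> K")
        case True
        then have "(v, b) \<in> ?P" using ve b by auto
        then have "(\<lambda>(a, b). (a, {a, b})) (v, b) \<in> (\<lambda>(a, b). (a, {a, b})) ` ?P" by (rule imageI)
        then show ?thesis using ve b by simp
      next
        case False
        then show ?thesis using ve b x by (auto simp: boundary_def)
      qed
    qed
  qed
  also have "\<dots> \<le> card (snd -` boundary E K \<inter> ?T) + card ((\<lambda>(a, b). (a, {a, b})) ` ?P)" by (rule card_Un_le)
  also have "card ((\<lambda>(a, b). (a, {a, b})) ` ?P) \<le> card ?P"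
    using assms finite_subset[of ?P "K \<times> K"] by (intro card_image_le) auto
  also have "card (snd -` boundary E K \<inter> ?T) \<le> card (boundary E K)"
  proof (rule card_inj_on_le)
    show "inj_on snd (snd -` boundary E K \<inter> ?T)"
    proof (rule inj_onI, clarsimp)
      fix v w e assume v: "v \<in> K" "v \<in> e" and w: "w \<in> K" "w \<in> e" and e: "e \<in> E" "e \<in> boundary E K"
      obtain a b where "e = {a, b}" "a \<in> K" "b \<notin> K" using boundary_edgeE[OF e(2)] assms(2)[OF e(1)] by blast
      then show "v = w" using v w by auto
    qed
  qed (use assms finite_boundary in auto)
  finally show ?thesis by simp
qed

text \<open>Mixing with \<open>A = B = K\<close> leaves at most
  \<open>(\<delta> + \<epsilon>) * d * card K\<close> incidences for inner edges; the rest go to the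
  boundary.\<close>

lemma mixing_graph_boundary:
  assumes "mixing_graph V E d \<epsilon>" "K \<subseteq> V" "real (card K) \<le> \<delta> * real (card V)"
  shows "(1 - (\<delta> + \<epsilon>)) * real d * real (card K) \<le> real (card (boundary E K))"
proof (cases "card V = 0")
  case True
  then have "K = {}" using assms mixing_graphD(1)[OF assms(1)] by auto
  then show ?thesis by simp
next
  case False
  note G = mixing_graphD[OF assms(1)]
  let ?e = "real (card {(a, b) \<in> K \<times> K. {a, b} \<in> E})" and ?k = "real (card K)" and ?N = "real (card V)"
  have "\<bar>?e - real d * ?k * ?k / ?N\<bar> \<le> \<epsilon> * real d * sqrt (?k * ?k)"
    using assms(1,2) unfolding mixing_graph_def by blast
  then have "?e \<le> real d * ?k * (?k / ?N) + \<epsilon> * real d * ?k" by simp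
  also have "\<dots> \<le> real d * ?k * \<delta> + \<epsilon> * real d * ?k"
    using assms(3) False by (intro add_right_mono mult_left_mono) (auto simp: field_simps)
  finally have "?e \<le> real d * ?k * \<delta> + \<epsilon> * real d * ?k" .
  moreover have "d * card K \<le> card (boundary E K) + card {(a, b) \<in> K \<times> K. {a, b} \<in> E}"
    using G assms(2) by (intro degree_sum_le_boundary) (auto intro: finite_subset)
  then have "real (d * card K) \<le> real (card (boundary E K) + card {(a, b) \<in> K \<times> K. {a, b} \<in> E})" by (rule of_nat_mono)
  then have "real d * ?k \<le> real (card (boundary E K)) + ?e" by simp
  ultimately show ?thesis by (simp add: algebra_simps)
qed

lemma power_one_plus_le_exp:
  fixes x :: real
  assumes "- real d \<le> x"
  shows "(1 + x / real d) ^ d \<le> exp x"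
proof (cases "d = 0")
  case False
  have "(1 + x / real d) ^ d \<le> exp (x / real d) ^ d"
  proof (rule power_mono)
    show "1 + x / real d \<le> exp (x / real d)" by (rule exp_ge_add_one_self)
    show "0 \<le> 1 + x / real d" using assms False by (simp add: field_simps)
  qed
  also have "\<dots> = exp x" using False by (simp flip: exp_of_nat_mult)
  finally show ?thesis .
qed (use assms in auto)

lemma card_boundary_singleton_le:
  assumes "mixing_graph V E d \<epsilon>"
  shows "card (boundary E {v}) \<le> d"
proof -
  have "card (boundary E {v}) \<le> card {e \<in> E. v \<in> e}"
    using mixing_graphD(2)[OF assms] by (intro card_mono) (auto simp: boundary_def)
  then show ?thesis using mixing_graphD(6)[OF assms, of v] by simp
qed

text \<open>\<open>\<rho>\<close> is the growth rate of the weight \<open>z^|C| \<theta>^|\<partial>C|\<close> in \<open>|C|\<close> on the event \<open>Q\<close>.\<close>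

lemma component_tail:
  fixes z \<theta> B \<rho> k :: real
  assumes G: "mixing_graph V E d \<epsilon>" and c: "0 < c" "c \<le> real d"
    and z: "0 \<le> z" and B: "1 \<le> B" and \<theta>: "1 \<le> \<theta>" and y: "z * B ^ d \<le> 1 / c"
    and step: "1 / real d + (1 - c / real d) * \<theta> \<le> B" and \<rho>: "1 \<le> \<rho>"
    and Q: "\<And>F. F \<subseteq> E \<Longrightarrow> Q F \<Longrightarrow> k \<le> real (comp_size F v) \<and>
      \<rho> ^ comp_size F v \<le> z ^ comp_size F v * \<theta> ^ card (boundary E (reach F {v}))"
  shows "pprob E (c / real d) Q \<le> (1 / c) * \<rho> powr (- k)"
proof -
  let ?p = "c / real d" and ?f = "\<lambda>F. z ^ comp_size F v * \<theta> ^ card (boundary E (reach F {v}))"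
  note M = mixing_graphD[OF G]
  have p: "0 \<le> ?p" "?p \<le> 1" using c by (auto simp: divide_le_eq)
  \<comment> \<open>The exploration runs with \<open>y = 1 / c\<close>, so an open edge contributes
    \<open>?p * y = 1 / d\<close> to the step condition.\<close>
  have "pexp E ?p ?f \<le> z ^ card {v} * B ^ card (boundary E {v})"
    by (rule exploration_upper[OF M(2) _ M(3) M(6) p z B \<theta> y]) (use step c in auto)
  also have "\<dots> \<le> z * B ^ d"
    using z B card_boundary_singleton_le[OF G, of v] by (auto intro!: mult_left_mono power_increasing)
  finally have E: "pexp E ?p ?f \<le> 1 / c" using y by simp
  have "pprob E ?p Q \<le> pexp E ?p ?f / \<rho> powr k"
  proof (rule pprob_markov[OF p])
    fix F assume "F \<subseteq> E" "Q F"
    note QF = Q[OF this]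
    then have "\<rho> powr k \<le> \<rho> powr real (comp_size F v)" using \<rho> by (intro powr_mono) auto
    then show "\<rho> powr k \<le> ?f F" using \<rho> QF by (simp add: powr_realpow)
  qed (use z \<theta> \<rho> in auto)
  also have "\<dots> \<le> (1 / c) / \<rho> powr k" using E \<rho> by (intro divide_right_mono) auto
  finally show ?thesis by (simp add: powr_minus field_simps)
qed

text \<open>No boundary weight here: with \<open>y = 1 / c > 1\<close> the edge price is
  \<open>B = 1 + (1 - c) / d\<close>, and \<open>B ^ d \<le> exp (1 - c)\<close> allows the base
  \<open>exp (c - 1) / c > 1\<close>.\<close>

lemma component_tail_subcritical:
  assumes G: "mixing_graph V E d \<epsilon>" and c: "0 < c" "c < 1" "c \<le> real d"
  shows "pprob E (c / real d) (\<lambda>F. k \<le> real (comp_size F v)) \<le> (1 / c) * (exp (c - 1) / c) powr (- k)"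
proof (rule component_tail[OF G c(1,3), where B = "1 + (1 - c) / real d" and \<theta> = 1])
  show "1 \<le> exp (c - 1) / c" using exp_ge_add_one_self[of "c - 1"] c by simp
  have "exp (c - 1) / c * (1 + (1 - c) / real d) ^ d \<le> exp (c - 1) / c * exp (1 - c)"
    using c by (intro mult_left_mono power_one_plus_le_exp) auto
  also have "\<dots> = 1 / c" by (simp flip: exp_add)
  finally show "exp (c - 1) / c * (1 + (1 - c) / real d) ^ d \<le> 1 / c" .
  show "1 \<le> 1 + (1 - c) / real d" using c by simp
qed (use c in \<open>auto simp: diff_divide_distrib\<close>)

text \<open>The event caps the component size, so mixing provides at least
  \<open>(1 - (\<delta> + \<epsilon>)) * d\<close> boundary edges per vertex. Rewarding each by
  \<open>\<theta>\<close> turns the base \<open>z = exp (- 1) / c\<close> into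
  \<open>\<rho> = z * exp (c * (1 - (\<delta> + \<epsilon>)))\<close>.\<close>

lemma component_gap:
  assumes G: "mixing_graph V E d \<epsilon>" and c: "0 < c" "c \<le> real d" and v: "v \<in> V"
    and \<rho>: "\<rho> = exp (c - 1 - c * (\<delta> + \<epsilon>)) / c" "1 \<le> \<rho>"
  shows "pprob E (c / real d) (\<lambda>F. k \<le> real (comp_size F v) \<and> real (comp_size F v) \<le> \<delta> * real (card V))
    \<le> (1 / c) * \<rho> powr (- k)"
proof -
  define z where "z = exp (-1) / c"
  \<comment> \<open>Chosen to satisfy \<open>(1 - p) * \<theta> \<le> 1\<close> for
    \<open>p = c / d\<close>, so that \<open>B = 1 + 1 / d\<close> suffices; the factor
    \<open>exp (- 1)\<close> in \<open>z\<close> then absorbs \<open>B ^ d\<close>.\<close>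
  define \<theta> where "\<theta> = exp (c / real d)"
  note M = mixing_graphD[OF G]
  have d: "0 < real d" using c by linarith
  have z: "0 \<le> z" using c by (simp add: z_def)
  show ?thesis
  proof (rule component_tail[OF G c z, where B = "1 + 1 / real d" and \<theta> = \<theta>])
    show "1 \<le> \<theta>" using c by (simp add: \<theta>_def)
    have "z * (1 + 1 / real d) ^ d \<le> z * exp 1" using z by (intro mult_left_mono power_one_plus_le_exp) auto
    also have "\<dots> = 1 / c" by (simp add: z_def flip: exp_add)
    finally show "z * (1 + 1 / real d) ^ d \<le> 1 / c" .
    have "(1 - c / real d) * \<theta> \<le> exp (- (c / real d)) * \<theta>"
      using exp_ge_add_one_self[of "- (c / real d)"] by (intro mult_right_mono) (auto simp: \<theta>_def)
    also have "\<dots> = 1" by (simp add: \<theta>_def flip: exp_add)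
    finally show "1 / real d + (1 - c / real d) * \<theta> \<le> 1 + 1 / real d" by simp
    fix F assume F: "F \<subseteq> E"
      and Q: "k \<le> real (comp_size F v) \<and> real (comp_size F v) \<le> \<delta> * real (card V)"
    let ?K = "reach F {v}"
    let ?m = "card ?K"
    have "?K \<subseteq> V" by (rule reach_subset) (use F M v in auto)
    then have "(1 - (\<delta> + \<epsilon>)) * real d * real ?m \<le> real (card (boundary E ?K))"
      using Q by (intro mixing_graph_boundary[OF G]) auto
    then have "c / real d * ((1 - (\<delta> + \<epsilon>)) * real d * real ?m) \<le> c / real d * real (card (boundary E ?K))"
      using c by (intro mult_left_mono) auto
    then have "exp (real ?m * (c * (1 - (\<delta> + \<epsilon>)))) \<le> exp (real (card (boundary E ?K)) * (c / real d))"
      using d by (simp add: mult_ac)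
    then have "exp (c * (1 - (\<delta> + \<epsilon>))) ^ ?m \<le> \<theta> ^ card (boundary E ?K)"
      unfolding \<theta>_def exp_of_nat_mult .
    then have "z ^ ?m * exp (c * (1 - (\<delta> + \<epsilon>))) ^ ?m \<le> z ^ ?m * \<theta> ^ card (boundary E ?K)"
      using z by (intro mult_left_mono) auto
    moreover have "z * exp (c * (1 - (\<delta> + \<epsilon>))) = \<rho>"
      unfolding \<rho> z_def by (simp add: algebra_simps flip: exp_add)
    ultimately show "k \<le> real ?m \<and> \<rho> ^ ?m \<le> z ^ ?m * \<theta> ^ card (boundary E ?K)"
      using Q by (simp flip: power_mult_distrib)
  qed (use \<rho> in auto)
qed

text \<open>Choice of the threshold that beats the union bound over \<open>N\<close> vertices.\<close>

lemma powr_minus_log_threshold: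
  fixes z N c :: real
  assumes "1 < z" "1 \<le> N"
  shows "N * ((1 / c) * z powr (- (2 / ln z * ln N))) = (1 / c) / N"
proof -
  have "z powr (- (2 / ln z * ln N)) = exp (- 2 * ln N)"
    using assms ln_gt_zero[of z] by (simp add: powr_def)
  also have "\<dots> = inverse (exp (ln N) * exp (ln N))" by (simp flip: exp_add exp_minus)
  also have "\<dots> = 1 / (N * N)" using assms by (simp add: inverse_eq_divide)
  finally have eq: "z powr (- (2 / ln z * ln N)) = 1 / (N * N)" .
  show ?thesis unfolding eq using assms by simp
qed

section \<open>Probabilities of small components\<close>

lemma edge_factor:
  fixes c d y :: real
  assumes "0 < c" "c \<le> d" "0 \<le> y" "y \<le> 1"
  shows "0 \<le> c / d" "c / d \<le> 1" "1 - c * (1 - y) / d = c / d * y + (1 - c / d)"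
    "0 \<le> 1 - c * (1 - y) / d" "1 - c * (1 - y) / d \<le> 1"
proof -
  have "c * (1 - y) \<le> d * 1" using assms by (intro mult_mono) auto
  then show "0 \<le> 1 - c * (1 - y) / d" using assms by (simp add: divide_le_eq)
qed (use assms in \<open>auto simp: divide_le_eq right_diff_distrib diff_divide_distrib\<close>)

text \<open>By \<open>exploration_lower\<close>, such a \<open>y\<close> is a lower bound for the
  mean of \<open>z ^ comp_size F v\<close>. Components larger than \<open>K\<close> contribute at
  most \<open>z ^ K\<close> to this mean, so the small ones carry the rest.\<close>

lemma component_small_lower:
  assumes G: "mixing_graph V E d \<epsilon>" and c: "0 < c" "c \<le> real d"
    and y: "0 \<le> y" "y \<le> 1" and z: "0 \<le> z" "z \<le> 1" and zy: "y \<le> z * (1 - c * (1 - y) / real d) ^ d"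
  shows "y - z ^ K \<le> pprob E (c / real d) (\<lambda>F. comp_size F v \<le> K)"
proof -
  let ?p = "c / real d"
  define B where "B = 1 - c * (1 - y) / real d"
  note M = mixing_graphD[OF G]
  note p = edge_factor(1,2)[OF c y] and Beq = edge_factor(3)[OF c y, folded B_def]
    and B = edge_factor(4,5)[OF c y, folded B_def]
  have "y \<le> z * B ^ d" using zy by (simp add: B_def)
  also have "\<dots> \<le> z ^ card {v} * B ^ card (boundary E {v})"
    using z B card_boundary_singleton_le[OF G, of v] by (auto intro!: mult_left_mono power_decreasing)
  also have "\<dots> \<le> pexp E ?p (\<lambda>F. z ^ comp_size F v)"
    by (rule exploration_lower[OF M(2) _ M(3) M(6) p z(1) B, where y = y]) (use zy Beq in \<open>auto simp: B_def\<close>)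
  also have "\<dots> \<le> pexp E ?p (\<lambda>F. of_bool (comp_size F v \<le> K) + z ^ K)"
  proof (rule pexp_mono[OF p])
    fix F
    have "z ^ comp_size F v \<le> z ^ K" if "\<not> comp_size F v \<le> K"
      using that z by (intro power_decreasing) auto
    then show "z ^ comp_size F v \<le> of_bool (comp_size F v \<le> K) + z ^ K"
      using z by (auto intro: add_increasing2 power_le_one)
  qed
  also have "\<dots> = pprob E ?p (\<lambda>F. comp_size F v \<le> K) + z ^ K"
    using M by (simp add: pexp_add pexp_const)
  finally show ?thesis by simp
qed

text \<open>If both components are small, exploring from \<open>{u, v}\<close> jointly reaches at
  most \<open>2 * K\<close> vertices, whether or not the components coincide. With
  \<open>2 * K\<close> in place of \<open>K\<close> the loss in \<open>exploration_small\<close>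
  becomes \<open>4 * K\<close>.\<close>

lemma component_pair_small_upper:
  assumes G: "mixing_graph V E d \<epsilon>" and c: "0 < c" "c \<le> real d" and uv: "u \<in> V" "v \<in> V" "u \<noteq> v"
    and y: "0 \<le> y" "y \<le> 1" and K: "4 * K \<le> d" "0 < K" and yB: "(1 - c * (1 - y) / real d) ^ (d - 4 * K) \<le> y"
  shows "pprob E (c / real d) (\<lambda>F. comp_size F u \<le> K \<and> comp_size F v \<le> K)
    \<le> (1 - c * (1 - y) / real d) ^ (2 * d - 2)"
proof -
  let ?p = "c / real d"
  define B where "B = 1 - c * (1 - y) / real d"
  note M = mixing_graphD[OF G]
  note p = edge_factor(1,2)[OF c y] and Beq = edge_factor(3)[OF c y, folded B_def]
    and B = edge_factor(4,5)[OF c y, folded B_def]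
  have "pprob E ?p (\<lambda>F. comp_size F u \<le> K \<and> comp_size F v \<le> K)
     \<le> pprob E ?p (\<lambda>F. card (reach F {u, v}) \<le> 2 * K)"
  proof (rule pexp_mono[OF p])
    fix F assume F: "F \<subseteq> E"
    have "reach F {u, v} \<subseteq> reach F {u} \<union> reach F {v}"
      by (rule reach_least) (auto intro: mem_reach reach_step)
    then have "card (reach F {u, v}) \<le> card (reach F {u} \<union> reach F {v})"
      using F M finite_subset[OF F] by (intro card_mono finite_UnI finite_reach) auto
    also have "\<dots> \<le> comp_size F u + comp_size F v" by (rule card_Un_le)
    finally show "(of_bool (comp_size F u \<le> K \<and> comp_size F v \<le> K) :: real)
       \<le> of_bool (card (reach F {u, v}) \<le> 2 * K)" by auto
  qed
  also have "\<dots> \<le> B ^ card (boundary E {u, v})"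
  proof (rule exploration_small[where V = V and d = d and y = y])
    fix w assume w: "w \<in> V - {u, v}"
    then have wV: "w \<in> V" by simp
    let ?X = "{e \<in> E. w \<in> e \<and> e \<inter> {u, v} = {}}" and ?Y = "{e \<in> E. w \<in> e \<and> e \<inter> {u, v} \<noteq> {}}"
    have "{e \<in> E. w \<in> e} = ?X \<union> ?Y" by blast
    then have "card {e \<in> E. w \<in> e} = card (?X \<union> ?Y)" by (rule arg_cong)
    also have "\<dots> \<le> card ?X + card ?Y" by (rule card_Un_le)
    finally have "card {e \<in> E. w \<in> e} \<le> card ?X + card ?Y" .
    moreover have "card {e \<in> E. w \<in> e \<and> e \<inter> {u, v} \<noteq> {}} \<le> card {u, v}"
      by (rule card_edges_meeting_le) (use M w in auto)
    ultimately show "d \<le> card {e \<in> E. w \<in> e \<and> e \<inter> {u, v} = {}} + card {u, v}" using M(5)[OF wV] by linarith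
  qed (use M B p K uv Beq yB in \<open>auto simp: B_def\<close>)
  \<comment> \<open>Only a possible edge \<open>{u, v}\<close> is missing from the boundary, and it
    is lost at both ends.\<close>
  also have "\<dots> \<le> B ^ (2 * d - 2)"
  proof (rule power_decreasing[OF _ B])
    let ?U = "{e \<in> E. u \<in> e} - {{u, v}}" and ?W = "{e \<in> E. v \<in> e} - {{u, v}}"
    have two: "e = {u, v}" if "e \<in> E" "u \<in> e" "v \<in> e" for e
      using M(3)[OF that(1)] that uv by (auto simp: card_2_iff)
    have "card (?U \<union> ?W) = card ?U + card ?W" using M(2) two by (intro card_Un_disjoint) auto
    moreover have "d - 1 \<le> card ?U" "d - 1 \<le> card ?W"
      using M(5)[OF uv(1)] M(5)[OF uv(2)] diff_card_le_card_Diff[of "{{u, v}}" "{e \<in> E. u \<in> e}"]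
        diff_card_le_card_Diff[of "{{u, v}}" "{e \<in> E. v \<in> e}"] by auto
    moreover have "?U \<union> ?W \<subseteq> boundary E {u, v}"
    proof
      fix e assume e: "e \<in> ?U \<union> ?W"
      then have "card e = 2" "e \<noteq> {u, v}" using M(3) by auto
      then have "\<not> e \<subseteq> {u, v}" using uv card_seteq[of "{u, v}" e] by auto
      then show "e \<in> boundary E {u, v}" using e by (auto simp: boundary_def)
    qed
    then have "card (?U \<union> ?W) \<le> card (boundary E {u, v})" using M(2) finite_boundary by (intro card_mono) auto
    ultimately show "2 * d - 2 \<le> card (boundary E {u, v})" by linarith
  qed
  finally show ?thesis by (simp add: B_def)
qed

section \<open>Concentration and sprinkling\<close>

lemma pprob_avoid:
  assumes "finite E'" "finite E" "E' \<subseteq> E"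
  shows "pprob E p (\<lambda>F. F \<inter> E' = {}) = (1 - p) ^ card E'"
  using assms
proof (induction E' arbitrary: E rule: finite_induct)
  case empty
  then show ?case by (simp add: pexp_const)
next
  case (insert e E')
  have "pprob E p (\<lambda>F. F \<inter> insert e E' = {}) = (1 - p) * pprob (E - {e}) p (\<lambda>F. F \<inter> insert e E' = {})"
    using insert.prems by (subst pexp_remove[of E e]) (auto simp: pexp_const)
  also have "pprob (E - {e}) p (\<lambda>F. F \<inter> insert e E' = {}) = pprob (E - {e}) p (\<lambda>F. F \<inter> E' = {})"
    by (rule pexp_cong) auto
  also have "\<dots> = (1 - p) ^ card E'" using insert by (intro insert.IH) auto
  finally show ?case using insert.hyps by simp
qed

definition small_verts :: "'a set \<Rightarrow> nat \<Rightarrow> 'a set set \<Rightarrow> 'a set" where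
  "small_verts V K F = {v \<in> V. comp_size F v \<le> K}"

definition large_verts :: "'a set \<Rightarrow> real \<Rightarrow> 'a set set \<Rightarrow> 'a set" where
  "large_verts V m F = {v \<in> V. m < real (comp_size F v)}"

lemma reach_in_large_verts:
  assumes "v \<in> large_verts V m F" "\<And>e. e \<in> F \<Longrightarrow> e \<subseteq> V" "w \<in> reach F {v}"
  shows "w \<in> large_verts V m F"
proof -
  have "v \<in> V" using assms(1) by (simp add: large_verts_def)
  then have "w \<in> V" using reach_subset[of F V "{v}"] assms by auto
  then show ?thesis using assms reach_eq_of_mem[OF assms(3)] by (simp add: large_verts_def)
qed

text \<open>Chebyshev about the target \<open>q * card V\<close> instead of the mean: the mean
  enters with the factor \<open>- 2 * q\<close>, so a lower bound \<open>a\<close> suffices for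
  single vertices and an upper bound \<open>b\<close> for pairs. The diagonal gives
  \<open>1 / card V\<close>. With \<open>a\<close> near \<open>q\<close> and \<open>b\<close> near
  \<open>q\<^sup>2\<close> little remains.\<close>

lemma small_verts_concentration:
  fixes \<eta> q a b :: real
  assumes E: "finite E" "finite V" "card V \<noteq> 0" and p: "0 \<le> p" "p \<le> 1" and "0 \<le> q" "0 < \<eta>" "0 \<le> b"
    and a: "\<And>v. v \<in> V \<Longrightarrow> a \<le> pprob E p (\<lambda>F. comp_size F v \<le> K)"
    and b: "\<And>u v. u \<in> V \<Longrightarrow> v \<in> V \<Longrightarrow> u \<noteq> v \<Longrightarrow>
       pprob E p (\<lambda>F. comp_size F u \<le> K \<and> comp_size F v \<le> K) \<le> b"
  shows "pprob E p (\<lambda>F. \<eta> * card V < \<bar>real (card (small_verts V K F)) - q * card V\<bar>)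
    \<le> (b - 2 * q * a + q\<^sup>2 + 1 / card V) / \<eta>\<^sup>2"
proof -
  let ?N = "real (card V)"
  define X where "X F = real (card (small_verts V K F))" for F
  have N: "0 < ?N" using E(3) by (simp only: of_nat_0_less_iff neq0_conv)
  have X: "X F = (\<Sum>v\<in>V. of_bool (comp_size F v \<le> K))" for F
    using E(2) by (simp add: X_def small_verts_def Int_def)
  have EX: "a * ?N \<le> pexp E p X"
  proof -
    have "a * ?N = (\<Sum>v\<in>V. a)" by simp
    also have "\<dots> \<le> (\<Sum>v\<in>V. pprob E p (\<lambda>F. comp_size F v \<le> K))" by (rule sum_mono) (rule a)
    also have "\<dots> = pexp E p X" unfolding X by (simp add: pexp_sum)
    finally show ?thesis .
  qed
  have EX2: "pexp E p (\<lambda>F. (X F)\<^sup>2) \<le> ?N + b * ?N\<^sup>2"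
  proof -
    have "pexp E p (\<lambda>F. (X F)\<^sup>2) =
      (\<Sum>u\<in>V. \<Sum>v\<in>V. pprob E p (\<lambda>F. comp_size F u \<le> K \<and> comp_size F v \<le> K))"
      unfolding X power2_eq_square sum_product by (simp add: pexp_sum flip: of_bool_conj)
    also have "\<dots> \<le> (\<Sum>u\<in>V. \<Sum>v\<in>V. of_bool (u = v) + b)"
    proof (intro sum_mono)
      fix u v assume uv: "u \<in> V" "v \<in> V"
      show "pprob E p (\<lambda>F. comp_size F u \<le> K \<and> comp_size F v \<le> K) \<le> of_bool (u = v) + b"
      proof (cases "u = v")
        case True
        have "pprob E p (\<lambda>F. comp_size F u \<le> K \<and> comp_size F v \<le> K) \<le> pexp E p (\<lambda>F. 1)"
          by (intro pexp_mono p) auto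
        then show ?thesis using True E assms(8) by (simp add: pexp_const)
      qed (use b uv in auto)
    qed
    also have "\<dots> = ?N + b * ?N\<^sup>2" using E(2) by (simp add: sum.distrib of_bool_def power2_eq_square algebra_simps)
    finally show ?thesis .
  qed
  have "pprob E p (\<lambda>F. \<eta> * ?N < \<bar>X F - q * ?N\<bar>) \<le> pexp E p (\<lambda>F. (X F - q * ?N)\<^sup>2) / (\<eta> * ?N)\<^sup>2"
  proof (rule pprob_markov[OF p])
    fix F assume "\<eta> * ?N < \<bar>X F - q * ?N\<bar>"
    then have "\<bar>\<eta> * ?N\<bar> \<le> \<bar>X F - q * ?N\<bar>" using assms(7) N by (simp add: abs_mult)
    then show "(\<eta> * ?N)\<^sup>2 \<le> (X F - q * ?N)\<^sup>2" by (simp add: abs_le_square_iff)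
  qed (use assms(7) N in auto)
  also have "\<dots> \<le> ((b - 2 * q * a + q\<^sup>2 + 1 / ?N) * ?N\<^sup>2) / (\<eta> * ?N)\<^sup>2"
  proof (rule divide_right_mono)
    have "(X F - q * ?N)\<^sup>2 = (X F)\<^sup>2 + ((- 2 * q * ?N) * X F + (q * ?N)\<^sup>2)" for F
      by (simp add: power2_eq_square algebra_simps)
    then have "pexp E p (\<lambda>F. (X F - q * ?N)\<^sup>2) = pexp E p (\<lambda>F. (X F)\<^sup>2) + ((- 2 * q * ?N) * pexp E p X + (q * ?N)\<^sup>2)"
      using E(1) by (simp only: pexp_add pexp_cmult pexp_const)
    also have "\<dots> \<le> (?N + b * ?N\<^sup>2) + ((- 2 * q * ?N) * (a * ?N) + (q * ?N)\<^sup>2)"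
      using EX EX2 assms(6) by (intro add_mono order_refl mult_left_mono_neg) auto
    also have "\<dots> = (b - 2 * q * a + q\<^sup>2 + 1 / ?N) * ?N\<^sup>2" using N by (simp add: power2_eq_square field_simps)
    finally show "pexp E p (\<lambda>F. (X F - q * ?N)\<^sup>2) \<le> (b - 2 * q * a + q\<^sup>2 + 1 / ?N) * ?N\<^sup>2" .
  qed simp
  also have "\<dots> = (b - 2 * q * a + q\<^sup>2 + 1 / ?N) / \<eta>\<^sup>2" using N by (simp add: power_mult_distrib)
  finally show ?thesis by (simp add: X_def)
qed

lemma card_edges_between:
  assumes "\<And>e. e \<in> E \<Longrightarrow> card e = 2" "finite E" "A \<inter> B = {}"
  shows "card {(a, b) \<in> A \<times> B. {a, b} \<in> E} \<le> card {e \<in> E. e \<inter> A \<noteq> {} \<and> e \<inter> B \<noteq> {}}"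
proof (rule card_inj_on_le)
  show "inj_on (\<lambda>(a, b). {a, b}) {(a, b) \<in> A \<times> B. {a, b} \<in> E}"
    using assms(3) by (auto simp: inj_on_def doubleton_eq_iff)
qed (use assms in auto)

text \<open>The geometric mean \<open>g\<close> of the two sizes is at least
  \<open>\<delta> * card V\<close>, so the mixing error \<open>\<delta> / 2\<close> takes away at
  most half of the main term; all the edges that remain would have to be closed.\<close>

lemma no_edges_between:
  fixes \<delta> :: real
  assumes G: "mixing_graph V E d (\<delta> / 2)" and "0 < \<delta>" and p: "0 \<le> p" "p \<le> 1"
    and AB: "A \<subseteq> V" "B \<subseteq> V" "A \<inter> B = {}" "\<delta> * real (card V) \<le> real (card A)" "\<delta> * real (card V) \<le> real (card B)" and "card V \<noteq> 0"
  shows "pprob E p (\<lambda>F. F \<inter> {e \<in> E. e \<inter> A \<noteq> {} \<and> e \<inter> B \<noteq> {}} = {}) \<le> exp (- (p * d) * (card V * \<delta>\<^sup>2 / 2))"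
proof -
  note M = mixing_graphD[OF G]
  let ?E' = "{e \<in> E. e \<inter> A \<noteq> {} \<and> e \<inter> B \<noteq> {}}" and ?N = "real (card V)" and ?a = "real (card A)" and ?b = "real (card B)"
  define g where "g = sqrt (?a * ?b)"
  have N: "0 < ?N" using \<open>card V \<noteq> 0\<close> by (simp only: of_nat_0_less_iff neq0_conv)
  have g2: "g * g = ?a * ?b" by (simp add: g_def)
  have "(\<delta> * ?N) * (\<delta> * ?N) \<le> ?a * ?b" using AB(4,5) \<open>0 < \<delta>\<close> by (intro mult_mono) auto
  then have "sqrt ((\<delta> * ?N) * (\<delta> * ?N)) \<le> g" unfolding g_def by (rule real_sqrt_le_mono)
  then have g: "\<delta> * ?N \<le> g" using assms by simp
  have g0: "0 \<le> g" by (simp add: g_def)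
  have "\<delta> \<le> g / ?N" using g N by (simp add: field_simps)
  then have "(\<delta> * ?N) * (\<delta> / 2) \<le> g * (g / ?N - \<delta> / 2)"
    by (intro mult_mono g) (use g0 \<open>0 < \<delta>\<close> in linarith)+
  then have "real d * ((\<delta> * ?N) * (\<delta> / 2)) \<le> real d * (g * (g / ?N - \<delta> / 2))" by (intro mult_left_mono) auto
  also have "\<dots> = real d * ?a * ?b / ?N - \<delta> / 2 * real d * g" using g2 by (simp add: algebra_simps)
  also have "\<dots> \<le> real (card {(a, b) \<in> A \<times> B. {a, b} \<in> E})"
  proof -
    have "\<bar>real (card {(a, b) \<in> A \<times> B. {a, b} \<in> E}) - real d * ?a * ?b / ?N\<bar> \<le> \<delta> / 2 * real d * sqrt (?a * ?b)"
      using G AB(1,2) unfolding mixing_graph_def by blast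
    then show ?thesis unfolding g_def by linarith
  qed
  also have "\<dots> \<le> real (card ?E')" using card_edges_between[OF M(3) M(2) AB(3)] by simp
  finally have c: "real d * (?N * \<delta>\<^sup>2 / 2) \<le> real (card ?E')" by (simp add: power2_eq_square mult_ac)
  have "pprob E p (\<lambda>F. F \<inter> ?E' = {}) = (1 - p) ^ card ?E'" using M by (intro pprob_avoid) auto
  also have "\<dots> \<le> exp (- p) ^ card ?E'"
    using p exp_ge_add_one_self[of "- p"] by (intro power_mono) auto
  also have "\<dots> = exp (- (p * real (card ?E')))" by (simp flip: exp_of_nat_mult)
  also have "\<dots> \<le> exp (- (p * (real d * (?N * \<delta>\<^sup>2 / 2))))" using mult_left_mono[OF c p(1)] by simp
  finally show ?thesis by (simp add: mult_ac)
qed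

text \<open>At most \<open>1 / \<delta>\<close> components exceed \<open>\<delta> * card V\<close>.
  If they do not merge, some split of them into two groups has no new edge across. There are at most
  \<open>2 powr (1 / \<delta>)\<close> splits, and \<open>no_edges_between\<close> applies to each
  because either side contains a whole large component.\<close>

lemma sprinkling_merges:
  fixes \<delta> :: real
  assumes G: "mixing_graph V E d (\<delta> / 2)" and \<delta>: "0 < \<delta>" and p: "0 \<le> p" "p \<le> 1" and N: "card V \<noteq> 0"
    and F1: "F1 \<subseteq> E"
  shows "pprob E p (\<lambda>F2. \<exists>x\<in>large_verts V (\<delta> * card V) F1. \<not> large_verts V (\<delta> * card V) F1 \<subseteq> reach (F1 \<union> F2) {x})
    \<le> 2 powr (1 / \<delta>) * exp (- (p * d) * (card V * \<delta>\<^sup>2 / 2))"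
proof -
  note M = mixing_graphD[OF G]
  let ?N = "real (card V)"
  define L where "L = large_verts V (\<delta> * card V) F1"
  define \<C> where "\<C> = (\<lambda>v. reach F1 {v}) ` L"
  define \<U> where "\<U> = {A \<in> Union ` Pow \<C>. \<delta> * ?N \<le> card A \<and> \<delta> * ?N \<le> card (L - A)}"
  have LV: "L \<subseteq> V" by (auto simp: L_def large_verts_def)
  have finL: "finite L" using LV M(1) finite_subset by auto
  have F1V: "e \<subseteq> V" if "e \<in> F1" for e using that F1 M by auto
  have CL: "reach F1 {v} \<subseteq> L" if "v \<in> L" for v
    using reach_in_large_verts[of v V _ F1, OF _ F1V] that unfolding L_def by blast
  have finC: "finite \<C>" using finL by (simp add: \<C>_def)
  have "card \<C> * (\<delta> * ?N) = (\<Sum>C\<in>\<C>. \<delta> * ?N)" by simp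
  also have "\<dots> \<le> (\<Sum>C\<in>\<C>. real (card C))"
    by (rule sum_mono) (auto simp: \<C>_def L_def large_verts_def)
  also have "\<dots> = real (card (\<Union>\<C>))"
  proof -
    have "pairwise disjnt \<C>" unfolding pairwise_def disjnt_def \<C>_def using reach_disjoint[of F1] by blast
    moreover have "finite C" if "C \<in> \<C>" for C
    proof -
      have "C \<subseteq> L" using that CL by (auto simp: \<C>_def)
      then show ?thesis using finL finite_subset by blast
    qed
    ultimately have "card (\<Union>\<C>) = sum card \<C>" by (intro card_Union_disjoint) auto
    then show ?thesis by simp
  qed
  also have "\<dots> \<le> ?N"
  proof -
    have "\<Union>\<C> \<subseteq> V" using CL LV by (auto simp: \<C>_def)
    then show ?thesis using M(1) by (simp add: card_mono)
  qed
  finally have cC: "real (card \<C>) \<le> 1 / \<delta>" using \<delta> N by (simp add: field_simps)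
  have finU: "finite \<U>" using finC by (simp add: \<U>_def)
  have "card \<U> \<le> card (Union ` Pow \<C>)" unfolding \<U>_def using finC by (intro card_mono) auto
  also have "\<dots> \<le> card (Pow \<C>)" using finC by (intro card_image_le) auto
  finally have "real (card \<U>) \<le> 2 ^ card \<C>" using finC by (simp add: card_Pow flip: of_nat_power)
  also have "\<dots> = 2 powr real (card \<C>)" by (simp add: powr_realpow)
  also have "\<dots> \<le> 2 powr (1 / \<delta>)" using cC by (intro powr_mono) auto
  finally have cU: "real (card \<U>) \<le> 2 powr (1 / \<delta>)" .
  let ?boundary = "\<lambda>A. {e \<in> E. e \<inter> A \<noteq> {} \<and> e \<inter> (L - A) \<noteq> {}}"
  have "pprob E p (\<lambda>F2. \<exists>x\<in>L. \<not> L \<subseteq> reach (F1 \<union> F2) {x}) \<le> (\<Sum>A\<in>\<U>. pprob E p (\<lambda>F. F \<inter> ?boundary A = {}))"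
  proof (rule pprob_union_bound[OF p finU])
    fix F2 assume F2: "F2 \<subseteq> E" and "\<exists>x\<in>L. \<not> L \<subseteq> reach (F1 \<union> F2) {x}"
    then obtain x y where x: "x \<in> L" and y: "y \<in> L" "y \<notin> reach (F1 \<union> F2) {x}" by blast
    \<comment> \<open>One side of the split: the part of \<open>L\<close> joined to
      \<open>x\<close>. It is a union of old components, and the other side contains that of
      \<open>y\<close>.\<close>
    define A where "A = L \<inter> reach (F1 \<union> F2) {x}"
    have sub: "reach F1 {v} \<subseteq> A" if "v \<in> A" for v
    proof -
      have "reach F1 {v} \<subseteq> reach (F1 \<union> F2) {v}" by (rule reach_mono) auto
      also have "\<dots> = reach (F1 \<union> F2) {x}" using that by (intro reach_eq_of_mem) (simp add: A_def)
      finally show ?thesis using CL that by (auto simp: A_def)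
    qed
    have suby: "reach F1 {y} \<subseteq> L - A"
    proof
      fix w assume w: "w \<in> reach F1 {y}"
      have "w \<notin> A"
      proof
        assume "w \<in> A"
        then have "reach F1 {w} \<subseteq> A" by (rule sub)
        moreover have "y \<in> reach F1 {w}" using w reach_sym by metis
        ultimately show False using y by (auto simp: A_def)
      qed
      then show "w \<in> L - A" using w CL[OF y(1)] by auto
    qed
    have finA: "finite A" using finL by (simp add: A_def)
    have big: "\<delta> * ?N \<le> card Z" if "reach F1 {v} \<subseteq> Z" "v \<in> L" "finite Z" for v Z
    proof -
      have "\<delta> * ?N < comp_size F1 v" using that(2) by (simp add: L_def large_verts_def)
      also have "\<dots> \<le> card Z" using that by (simp add: card_mono)
      finally show ?thesis by simp
    qed
    have "A = \<Union> ((\<lambda>v. reach F1 {v}) ` A)"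
    proof (intro subset_antisym subsetI)
      show "w \<in> \<Union> ((\<lambda>v. reach F1 {v}) ` A)" if "w \<in> A" for w
        using that mem_reach[of w F1] by (intro UN_I)
      show "w \<in> A" if "w \<in> \<Union> ((\<lambda>v. reach F1 {v}) ` A)" for w
        using that sub by (elim UN_E) (rule subsetD)
    qed
    moreover have "(\<lambda>v. reach F1 {v}) ` A \<in> Pow \<C>" by (auto simp: \<C>_def A_def)
    ultimately have "A \<in> Union ` Pow \<C>" by blast
    moreover have "x \<in> A" using x mem_reach by (auto simp: A_def)
    ultimately have "A \<in> \<U>"
      using big[OF sub x finA] big[OF suby y(1)] finL by (simp add: \<U>_def)
    moreover have "F2 \<inter> ?boundary A = {}"
    proof (rule ccontr)
      assume "F2 \<inter> ?boundary A \<noteq> {}"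
      then obtain e where e: "e \<in> F2" "e \<in> E" "e \<inter> A \<noteq> {}" "e \<inter> (L - A) \<noteq> {}" by auto
      then obtain a b where ab: "a \<in> e" "a \<in> A" "b \<in> e" "b \<in> L" "b \<notin> A" by blast
      have "e = {a, b}" using M(3)[OF e(2)] ab by (auto simp: card_2_iff)
      then have "b \<in> reach (F1 \<union> F2) {x}" using reach_step[of a "F1 \<union> F2" "{x}" b] ab e by (auto simp: A_def)
      then show False using ab by (simp add: A_def)
    qed
    ultimately show "\<exists>A\<in>\<U>. F2 \<inter> ?boundary A = {}" by blast
  qed
  also have "\<dots> \<le> (\<Sum>A\<in>\<U>. exp (- (p * d) * (card V * \<delta>\<^sup>2 / 2)))"
  proof (rule sum_mono)
    fix A assume A: "A \<in> \<U>"
    have "\<Union>\<C> \<subseteq> L" using CL by (auto simp: \<C>_def)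
    then have "A \<subseteq> L" using A by (auto simp: \<U>_def)
    then show "pprob E p (\<lambda>F. F \<inter> ?boundary A = {}) \<le> exp (- (p * d) * (card V * \<delta>\<^sup>2 / 2))"
      using A LV N by (intro no_edges_between[OF G \<delta> p]) (auto simp: \<U>_def)
  qed
  also have "\<dots> \<le> 2 powr (1 / \<delta>) * exp (- (p * d) * (card V * \<delta>\<^sup>2 / 2))"
    using cU by (simp add: mult_right_mono)
  finally show ?thesis unfolding L_def .
qed

section \<open>The phase transition in sequences of mixing graphs\<close>

text \<open>The fixed point equation is replaced by strict inequalities on both sides of
  \<open>q\<close>, because the exploration bounds are applied at \<open>q - \<tau>\<close> and
  \<open>q + \<tau>\<close> and need the slack; the equation itself follows by continuity.\<close>

definition extinction :: "real \<Rightarrow> real \<Rightarrow> bool" where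
  "extinction c q \<longleftrightarrow> 0 < q \<and> q < 1 \<and> (\<forall>t. 0 < t \<and> t < q \<longrightarrow> t < exp (- (c * (1 - t)))) \<and>
     (\<forall>t. q < t \<and> t < 1 \<longrightarrow> exp (- (c * (1 - t))) < t)"

text \<open>In logarithms the equation is \<open>g t = 0\<close>, and \<open>g\<close> increases up
  to \<open>1 / c\<close> and decreases afterwards. As \<open>g 1 = 0\<close>, there is one other
  zero \<open>q < 1 / c\<close>. Substituting \<open>x = c * t\<close> identifies it with the
  conjugate solution.\<close>

lemma extinction_exists:
  assumes c: "1 < c"
  obtains q where "extinction c q" "conjugate_solution c = c * q"
proof -
  define g where "g t = ln t + c * (1 - t)" for t :: real
  have ln_strict: "ln x < x - 1" if "0 < x" "x \<noteq> 1" for x :: real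
    using ln_le_minus_one[of x] ln_eq_minus_one[of x] that by force
  have inc: "g x < g y" if "0 < x" "x < y" "y \<le> 1 / c" for x y
  proof -
    have "ln (x / y) < x / y - 1" using that by (intro ln_strict) auto
    then have "1 - x / y < ln y - ln x" using that by (simp add: ln_div)
    moreover have "c * (y - x) \<le> 1 / y * (y - x)"
      using that c by (intro mult_right_mono) (auto simp: field_simps)
    moreover have "1 / y * (y - x) = 1 - x / y" using that by (simp add: field_simps)
    ultimately show ?thesis by (simp add: g_def algebra_simps)
  qed
  have dec: "g y < g x" if "1 / c \<le> x" "x < y" for x y
  proof -
    have x: "0 < x" using that c by (smt (verit) divide_pos_pos)
    have "ln (y / x) < y / x - 1" using that x by (intro ln_strict) auto
    then have "ln y - ln x < y / x - 1" using that x by (simp add: ln_div)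
    moreover have "1 / x * (y - x) \<le> c * (y - x)"
      using that c x by (intro mult_right_mono) (auto simp: field_simps)
    moreover have "1 / x * (y - x) = y / x - 1" using x by (simp add: field_simps)
    ultimately show ?thesis by (simp add: g_def algebra_simps)
  qed
  have c1: "1 / c < 1" using c by simp
  have g1: "g 1 = 0" by (simp add: g_def)
  have gc: "0 < g (1 / c)" using dec[of "1 / c" 1] c1 g1 by simp
  have "c < exp c" using exp_ge_add_one_self[of c] by linarith
  then have e: "exp (- c) < 1 / c" using c by (simp add: exp_minus field_simps)
  have ge: "g (exp (- c)) < 0" using c by (simp add: g_def algebra_simps)
  obtain q where q: "exp (- c) \<le> q" "q \<le> 1 / c" "g q = 0"
  proof -
    have "continuous_on {exp (- c)..1 / c} g" unfolding g_def
      by (intro continuous_intros) (use exp_gt_zero[of "- c"] in force)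
    then show ?thesis using IVT'[of g "exp (- c)" 0 "1 / c"] ge gc e that by auto
  qed
  have q0: "0 < q" using q(1) exp_gt_zero[of "- c"] by linarith
  have qc: "q < 1 / c" using q gc by (cases "q = 1 / c") auto
  have pos: "0 < g t" if "q < t" "t < 1" for t
    using inc[of q t] dec[of t 1] that q0 q g1 by (cases "t \<le> 1 / c") auto
  have neg: "g t < 0" if "0 < t" "t < q" for t using inc[of t q] that q by auto
  have neg1: "g t < 0" if "1 < t" for t using dec[of 1 t] that c1 g1 by auto
  have gln: "exp (- (c * (1 - t))) < t \<longleftrightarrow> 0 < g t" "t < exp (- (c * (1 - t))) \<longleftrightarrow> g t < 0" if "0 < t" for t
  proof -
    have "exp (- (c * (1 - t))) < exp (ln t) \<longleftrightarrow> - (c * (1 - t)) < ln t" "exp (ln t) < exp (- (c * (1 - t))) \<longleftrightarrow> ln t < - (c * (1 - t))"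
      by (rule exp_less_cancel_iff)+
    then show "exp (- (c * (1 - t))) < t \<longleftrightarrow> 0 < g t" "t < exp (- (c * (1 - t))) \<longleftrightarrow> g t < 0"
      using that by (auto simp: g_def)
  qed
  have root: "g t = 0 \<longleftrightarrow> t = q \<or> t = 1" if "0 < t" for t
    using pos[of t] neg[of t] neg1[of t] that q g1 by (cases t q rule: linorder_cases; cases t "1::real" rule: linorder_cases) auto
  have "extinction c q"
    unfolding extinction_def using q0 qc c1 pos neg gln by (auto simp: order_less_trans[OF q0])
  moreover have "conjugate_solution c = c * q"
    unfolding conjugate_solution_def
  proof (rule the_equality)
    have sol: "(c * t) * exp (- (c * t)) = c * exp (- c) \<longleftrightarrow> g t = 0" if t: "0 < t" for t
    proof -
      have "(c * t) * exp (- (c * t)) = c * exp (- c) \<longleftrightarrow> t * exp (- (c * t)) = exp (- c)"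
        using c by (simp add: mult.assoc)
      also have "\<dots> \<longleftrightarrow> ln (t * exp (- (c * t))) = ln (exp (- c))" using t by (subst ln_inj_iff) auto
      also have "\<dots> \<longleftrightarrow> g t = 0" using t by (auto simp: ln_mult g_def algebra_simps)
      finally show ?thesis .
    qed
    show "c * q * exp (- (c * q)) = c * exp (- c) \<and> c * q \<noteq> c" using sol[OF q0] q qc c1 c by auto
    fix x assume x: "x * exp (- x) = c * exp (- c) \<and> x \<noteq> c"
    then have "0 < x * exp (- x)" using c by simp
    then have "0 < x" by (simp add: zero_less_mult_iff)
    then have "0 < x / c" using c by simp
    moreover have "c * (x / c) = x" using c by simp
    ultimately have "g (x / c) = 0" using sol[of "x / c"] x by simp
    then show "x = c * q" using root[OF \<open>0 < x / c\<close>] x c by (auto simp: field_simps)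
  qed
  ultimately show ?thesis by (rule that)
qed

lemma pprob_disj:
  assumes "0 \<le> p" "p \<le> 1" "\<And>F. F \<subseteq> E \<Longrightarrow> Q F \<Longrightarrow> Q1 F \<or> Q2 F"
  shows "pprob E p Q \<le> pprob E p Q1 + pprob E p Q2"
  unfolding pexp_add[symmetric] using assms by (intro pexp_mono) (auto simp: of_bool_def)

lemma sprinkle_parameter:
  fixes p p1 :: real
  assumes "0 \<le> p1" "p1 < p" "p \<le> 1"
  shows "0 \<le> (p - p1) / (1 - p1)" "(p - p1) / (1 - p1) \<le> 1"
    "1 - p = (1 - p1) * (1 - (p - p1) / (1 - p1))" "p - p1 \<le> (p - p1) / (1 - p1)"
proof -
  show "0 \<le> (p - p1) / (1 - p1)" "(p - p1) / (1 - p1) \<le> 1"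
    "1 - p = (1 - p1) * (1 - (p - p1) / (1 - p1))" using assms by (auto simp: field_simps)
  have "(p - p1) * (1 - p1) \<le> (p - p1) * 1" using assms by (intro mult_left_mono) auto
  then show "p - p1 \<le> (p - p1) / (1 - p1)" using assms by (simp add: pos_le_divide_eq)
qed

locale mixing_sequence =
  fixes V :: "nat \<Rightarrow> 'a set" and E :: "nat \<Rightarrow> 'a set set" and d :: "nat \<Rightarrow> nat"
  assumes d_top: "filterlim d at_top sequentially"
    and N_top: "filterlim (\<lambda>n. card (V n)) at_top sequentially"
    and mixing: "\<And>\<epsilon>. 0 < \<epsilon> \<Longrightarrow> eventually (\<lambda>n. mixing_graph (V n) (E n) (d n) \<epsilon>) sequentially"
begin

abbreviation N :: "nat \<Rightarrow> real" where "N n \<equiv> real (card (V n))"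

abbreviation edge_prob :: "real \<Rightarrow> nat \<Rightarrow> real" where "edge_prob c n \<equiv> c / real (d n)"

text \<open>The \<open>\<rho>\<close> of \<open>component_gap\<close> with mixing error
  \<open>\<delta> / 2\<close>, the error that \<open>sprinkling_merges\<close> asks for. For
  \<open>c > 1\<close> it exceeds 1 when \<open>\<delta>\<close> is small, since
  \<open>c - 1 > ln c\<close>.\<close>

definition rate :: "real \<Rightarrow> real \<Rightarrow> real" where
  "rate c \<delta> = exp (c - 1 - c * (\<delta> + \<delta> / 2)) / c"

abbreviation prob_at :: "real \<Rightarrow> nat \<Rightarrow> ('a set set \<Rightarrow> bool) \<Rightarrow> real" where
  "prob_at c n \<equiv> pprob (E n) (edge_prob c n)"

abbreviation large :: "real \<Rightarrow> nat \<Rightarrow> 'a set set \<Rightarrow> 'a set" where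
  "large \<delta> n F \<equiv> large_verts (V n) (\<delta> * N n) F"

lemma real_d_top: "filterlim (\<lambda>n. real (d n)) at_top sequentially"
  by (rule filterlim_compose[OF filterlim_real_sequentially d_top])

lemma real_N_top: "filterlim N at_top sequentially"
  by (rule filterlim_compose[OF filterlim_real_sequentially N_top])

lemma eventually_d_ge: "eventually (\<lambda>n. x \<le> real (d n)) sequentially"
  using real_d_top by (simp add: filterlim_at_top)

lemma eventually_N_ge: "eventually (\<lambda>n. x \<le> N n) sequentially"
  using real_N_top by (simp add: filterlim_at_top)

lemma inverse_N_tendsto: "(\<lambda>n. x / N n) \<longlonglongrightarrow> 0"
  by (rule real_tendsto_divide_at_top[OF tendsto_const real_N_top])

lemma power_tendsto_exp: "(\<lambda>n. (1 - a / real (d n)) ^ d n) \<longlonglongrightarrow> exp (- a)"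
  using filterlim_compose[OF tendsto_exp_limit_sequentially[of "- a"] d_top] by simp

lemma base_tendsto: "(\<lambda>n. 1 - a / real (d n)) \<longlonglongrightarrow> 1"
  using tendsto_diff[OF tendsto_const real_tendsto_divide_at_top[OF tendsto_const real_d_top], of 1 a] by simp

text \<open>A bounded shift of the exponent costs a factor tending to 1. This absorbs the
  corrections in \<open>2 * d n - 2\<close> and \<open>d n - 4 * K\<close>.\<close>

lemma power_diff_tendsto_exp: "(\<lambda>n. (1 - a / real (d n)) ^ (k * d n - m)) \<longlonglongrightarrow> exp (- a) ^ k" if "0 < k"
proof (rule Lim_transform_eventually)
  have "(\<lambda>n. ((1 - a / real (d n)) ^ d n) ^ k / (1 - a / real (d n)) ^ m) \<longlonglongrightarrow> exp (- a) ^ k / 1 ^ m"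
    by (intro tendsto_divide tendsto_power power_tendsto_exp base_tendsto) auto
  then show "(\<lambda>n. ((1 - a / real (d n)) ^ d n) ^ k / (1 - a / real (d n)) ^ m) \<longlonglongrightarrow> exp (- a) ^ k" by simp
  show "eventually (\<lambda>n. ((1 - a / real (d n)) ^ d n) ^ k / (1 - a / real (d n)) ^ m = (1 - a / real (d n)) ^ (k * d n - m)) sequentially"
    using order_tendstoD(1)[OF base_tendsto[of a], of 0, simplified] eventually_d_ge[of m]
  proof eventually_elim
    case (elim n)
    have "1 * d n \<le> k * d n" using that by (intro mult_right_mono) auto
    then have "m \<le> k * d n" using elim(2) by linarith
    have "0 < 1 - a / real (d n)" using elim(1) by linarith
    then have nz: "1 - a / real (d n) \<noteq> 0" by (rule less_imp_neq[THEN not_sym])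
    show ?case unfolding power_diff[OF nz \<open>m \<le> k * d n\<close>] power_mult[symmetric] by (simp add: mult.commute)
  qed
qed

text \<open>\<open>K\<close> is fixed before \<open>n\<close> grows: a constant cut-off already
  brings the bounds close to the extinction probability. Single vertices use the level
  \<open>q - \<tau>\<close>, pairs \<open>q + \<tau>\<close>.\<close>

lemma small_concentration:
  assumes c: "1 < c" and q: "extinction c q" and "0 < \<eta>" "0 < \<xi>"
  obtains K0 where "\<And>K. K0 \<le> K \<Longrightarrow> eventually (\<lambda>n. prob_at c n
    (\<lambda>F. \<eta> * N n < \<bar>real (card (small_verts (V n) K F)) - q * N n\<bar>) < \<xi>) sequentially"
proof -
  have q01: "0 < q" "q < 1" using q by (auto simp: extinction_def)
  \<comment> \<open>The variance bound below is less than \<open>8 * \<tau>\<close>, and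
    \<open>\<xi> * \<eta>\<^sup>2 / 16\<close> makes this half of what is allowed; the other terms
    keep \<open>q - \<tau>\<close> and \<open>q + \<tau>\<close> in \<open>(0, 1)\<close>.\<close>
  define \<tau> where "\<tau> = min (\<xi> * \<eta>\<^sup>2 / 16) (min (q / 2) ((1 - q) / 2))"
  have \<tau>: "0 < \<tau>" "\<tau> \<le> \<xi> * \<eta>\<^sup>2 / 16" "\<tau> < q" "q + \<tau> < 1"
  proof -
    have "\<tau> \<le> q / 2" "\<tau> \<le> (1 - q) / 2"
      unfolding \<tau>_def by (rule order_trans[OF min.cobounded2 min.cobounded1], rule order_trans[OF min.cobounded2 min.cobounded2])
    then show "\<tau> < q" "q + \<tau> < 1" using q01 by simp_all
  qed (use assms q01 in \<open>auto simp: \<tau>_def\<close>)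
  define y y' where "y = q + \<tau>" and "y' = q - \<tau>"
  have y: "0 < y" "y < 1" "exp (- (c * (1 - y))) < y" using \<tau> q01 q by (auto simp: y_def extinction_def)
  have y': "0 < y'" "y' < 1" "y' < exp (- (c * (1 - y')))" using \<tau> q01 q by (auto simp: y'_def extinction_def)
  define w where "w = exp (- (c * (1 - y')))"
  have yw: "y' / w < 1" "0 < y' / w" using y' by (auto simp: w_def)
  \<comment> \<open>Room for a base below 1: \<open>y' < z * w\<close> still holds, while
    \<open>z ^ K\<close> vanishes for large \<open>K\<close>.\<close>
  obtain z where z: "y' / w < z" "z < 1" using dense[OF yw(1)] by blast
  note z = z less_trans[OF yw(2) z(1)]
  have "0 < w" by (simp add: w_def)
  then have zw: "y' < z * w" using z(1) by (simp add: field_simps)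
  have "(\<lambda>K. z ^ K) \<longlonglongrightarrow> 0" using z by (intro LIMSEQ_power_zero) auto
  then have "eventually (\<lambda>K. z ^ K < \<tau>) sequentially" using \<tau>(1) by (rule order_tendstoD(2))
  then obtain K0 where K0: "\<And>K. K0 \<le> K \<Longrightarrow> z ^ K < \<tau>"
    unfolding eventually_sequentially by blast
  \<comment> \<open>\<open>Suc K0\<close> ensures \<open>0 < K\<close>, required for exploring from
    two vertices.\<close>
  have "eventually (\<lambda>n. prob_at c n
    (\<lambda>F. \<eta> * N n < \<bar>real (card (small_verts (V n) K F)) - q * N n\<bar>) < \<xi>) sequentially" if K: "Suc K0 \<le> K" for K
  proof -
    have "exp (- (c * (1 - y))) ^ 2 < y ^ 2" using y by (intro power_strict_mono) auto
    then have l1: "eventually (\<lambda>n. (1 - c * (1 - y) / real (d n)) ^ (2 * d n - 2) < y\<^sup>2) sequentially"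
      by (intro order_tendstoD(2)[OF power_diff_tendsto_exp[of 2 "c * (1 - y)" 2]]) auto
    have l2: "eventually (\<lambda>n. (1 - c * (1 - y) / real (d n)) ^ (1 * d n - 4 * K) < y) sequentially"
      using y by (intro order_tendstoD(2)[OF power_diff_tendsto_exp[of 1 "c * (1 - y)" "4 * K"]]) auto
    have "(\<lambda>n. z * (1 - c * (1 - y') / real (d n)) ^ d n) \<longlonglongrightarrow> z * w"
      unfolding w_def by (intro tendsto_mult tendsto_const power_tendsto_exp)
    then have l3: "eventually (\<lambda>n. y' < z * (1 - c * (1 - y') / real (d n)) ^ d n) sequentially"
      using zw by (rule order_tendstoD(1))
    have l4: "eventually (\<lambda>n. 1 / N n < \<tau>) sequentially"
      using inverse_N_tendsto \<tau>(1) by (rule order_tendstoD(2))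
    show ?thesis
      using l1 l2 l3 l4 eventually_d_ge[of c] eventually_d_ge[of "4 * K"] eventually_N_ge[of 1] mixing[OF zero_less_one]
    proof eventually_elim
      case (elim n)
      note M = mixing_graphD[OF elim(8)]
      have p: "0 \<le> edge_prob c n" "edge_prob c n \<le> 1" using elim(5) c by (auto simp: divide_le_eq)
      have "pprob (E n) (edge_prob c n) (\<lambda>F. \<eta> * N n < \<bar>real (card (small_verts (V n) K F)) - q * N n\<bar>)
        \<le> (y\<^sup>2 - 2 * q * (y' - z ^ K) + q\<^sup>2 + 1 / N n) / \<eta>\<^sup>2"
      proof (rule small_verts_concentration[OF M(2) M(1) _ p])
        show "card (V n) \<noteq> 0" using elim(7) by auto
        show "y' - z ^ K \<le> prob_at c n (\<lambda>F. comp_size F v \<le> K)" for v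
          using c y' z elim by (intro component_small_lower[OF elim(8)]) auto
        fix u v assume uv: "u \<in> V n" "v \<in> V n" "u \<noteq> v"
        have "pprob (E n) (edge_prob c n) (\<lambda>F. comp_size F u \<le> K \<and> comp_size F v \<le> K)
           \<le> (1 - c * (1 - y) / real (d n)) ^ (2 * d n - 2)"
          using c y elim K by (intro component_pair_small_upper[OF elim(8) _ _ uv]) auto
        then show "pprob (E n) (edge_prob c n) (\<lambda>F. comp_size F u \<le> K \<and> comp_size F v \<le> K) \<le> y\<^sup>2"
          using elim(1) by linarith
      qed (use q01 assms in auto)
      also have "\<dots> < \<xi>"
      proof -
        have "y\<^sup>2 - 2 * q * (y' - z ^ K) + q\<^sup>2 + 1 / N n = q * \<tau> * 4 + \<tau> * \<tau> + 2 * q * z ^ K + 1 / N n"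
          by (simp add: y_def y'_def power2_eq_square algebra_simps)
        moreover have "q * \<tau> \<le> 1 * \<tau>" "\<tau> * \<tau> \<le> 1 * \<tau>" using q01 \<tau> by (intro mult_right_mono; simp)+
        moreover have "q * z ^ K \<le> 1 * \<tau>" using q01 z K0[of K] K by (intro mult_mono) auto
        ultimately have "y\<^sup>2 - 2 * q * (y' - z ^ K) + q\<^sup>2 + 1 / N n < 8 * \<tau>" using elim(4) by linarith
        also have "\<dots> \<le> \<xi> * \<eta>\<^sup>2 / 2" using \<tau>(2) by linarith
        also have "\<dots> < \<xi> * \<eta>\<^sup>2" using assms by simp
        finally show ?thesis using assms by (simp add: divide_less_eq)
      qed
      finally show ?case .
    qed
  qed
  then show ?thesis by (rule that)
qed

lemma powr_neg_tendsto:
  fixes \<rho> :: real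
  assumes "1 < \<rho>"
  shows "(\<lambda>K. \<rho> powr (- real K)) \<longlonglongrightarrow> 0"
proof -
  have "(\<lambda>K. (1 / \<rho>) ^ K) \<longlonglongrightarrow> 0" using assms by (intro LIMSEQ_power_zero) auto
  moreover have "(1 / \<rho>) ^ K = \<rho> powr (- real K)" for K
    using assms by (simp add: powr_minus powr_realpow power_divide field_simps)
  ultimately show ?thesis by simp
qed

text \<open>Every vertex is small, of middle size or large. By \<open>component_gap\<close> and
  Markov's inequality a large constant \<open>K\<close> makes the middle ones rare, so small and
  large vertices nearly exhaust \<open>V n\<close>.\<close>

lemma large_concentration:
  assumes c: "1 < c" and q: "extinction c q" and \<delta>: "0 < \<delta>"
    and \<rho>: "1 < rate c \<delta>" and "0 < \<eta>" "0 < \<xi>"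
  shows "eventually (\<lambda>n. prob_at c n
    (\<lambda>F. \<eta> * N n < \<bar>real (card (large \<delta> n F)) - (1 - q) * N n\<bar>) < \<xi>) sequentially"
proof -
  define \<rho> where "\<rho> = rate c \<delta>"
  have \<rho>1: "1 < \<rho>" using \<rho> by (simp add: \<rho>_def)
  obtain K0 where K0: "\<And>K. K0 \<le> K \<Longrightarrow> eventually (\<lambda>n. prob_at c n
    (\<lambda>F. \<eta> / 2 * N n < \<bar>real (card (small_verts (V n) K F)) - q * N n\<bar>) < \<xi> / 2) sequentially"
    using small_concentration[OF c q, of "\<eta> / 2" "\<xi> / 2"] assms by auto
  have "eventually (\<lambda>K. \<rho> powr (- real K) < c * \<eta> * \<xi> / 4) sequentially"
    using assms by (intro order_tendstoD(2)[OF powr_neg_tendsto[OF \<rho>1]]) auto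
  then obtain K1 where K1: "\<And>K. K1 \<le> K \<Longrightarrow> \<rho> powr (- real K) < c * \<eta> * \<xi> / 4"
    unfolding eventually_sequentially by blast
  define K where "K = max K0 K1"
  have K: "\<rho> powr (- real K) < c * \<eta> * \<xi> / 4" using K1[of K] by (simp add: K_def)
  have "0 < \<delta> / 2" using \<delta> by simp
  note small = K0[of K, simplified K_def max.cobounded1, OF TrueI, folded K_def]
  show ?thesis
    \<comment> \<open>\<open>K / \<delta>\<close> puts \<open>K\<close> below
      \<open>\<delta> * N n\<close>, so no vertex is both small and large.\<close>
    using small mixing[OF \<open>0 < \<delta> / 2\<close>] eventually_d_ge[of c] eventually_N_ge[of "max 1 (K / \<delta>)"]
  proof eventually_elim
    case (elim n)
    note M = mixing_graphD[OF elim(2)]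
    have p: "0 \<le> edge_prob c n" "edge_prob c n \<le> 1" using elim(3) c by (auto simp: divide_le_eq)
    have N: "0 < N n" "real K \<le> \<delta> * N n" using elim(4) \<delta> by (auto simp: field_simps)
    define mid where "mid F = {v \<in> V n. real K \<le> comp_size F v \<and> real (comp_size F v) \<le> \<delta> * N n}" for F
    have "pprob (E n) (edge_prob c n) (\<lambda>F. \<eta> / 2 * N n < card (mid F)) \<le>
       pexp (E n) (edge_prob c n) (\<lambda>F. real (card (mid F))) / (\<eta> / 2 * N n)"
      by (rule pprob_markov[OF p]) (use N assms in auto)
    also have "\<dots> \<le> (N n * ((1 / c) * \<rho> powr (- real K))) / (\<eta> / 2 * N n)"
    proof (rule divide_right_mono)
      have "real (card (mid F)) = (\<Sum>v\<in>V n. of_bool (real K \<le> comp_size F v \<and> real (comp_size F v) \<le> \<delta> * N n))" for F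
        using M(1) by (simp add: mid_def Int_def)
      then have "pexp (E n) (edge_prob c n) (\<lambda>F. real (card (mid F))) = (\<Sum>v\<in>V n. prob_at c n
         (\<lambda>F. real K \<le> comp_size F v \<and> real (comp_size F v) \<le> \<delta> * N n))"
        by (simp add: pexp_sum)
      also have "\<dots> \<le> (\<Sum>v\<in>V n. (1 / c) * \<rho> powr (- real K))"
        by (intro sum_mono component_gap[OF elim(2)]) (use c elim \<rho>1 in \<open>auto simp: \<rho>_def rate_def\<close>)
      finally show "pexp (E n) (edge_prob c n) (\<lambda>F. real (card (mid F))) \<le> N n * ((1 / c) * \<rho> powr (- real K))" by simp
    qed (use N assms in auto)
    also have "\<dots> = \<rho> powr (- real K) * 2 / (c * \<eta>)" using N by simp
    also have "\<dots> < \<xi> / 2" using K assms by (simp add: field_simps)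
    finally have mid: "pprob (E n) (edge_prob c n) (\<lambda>F. \<eta> / 2 * N n < card (mid F)) < \<xi> / 2" .
    have "pprob (E n) (edge_prob c n) (\<lambda>F. \<eta> * N n < \<bar>real (card (large \<delta> n F)) - (1 - q) * N n\<bar>)
      \<le> prob_at c n (\<lambda>F. \<eta> / 2 * N n < \<bar>real (card (small_verts (V n) K F)) - q * N n\<bar>)
       + prob_at c n (\<lambda>F. \<eta> / 2 * N n < card (mid F))"
    proof (rule pprob_disj[OF p])
      fix F
      let ?S = "small_verts (V n) K F" and ?L = "large \<delta> n F"
      have fin: "finite ?S" "finite ?L" "finite (mid F)"
        using M(1) by (auto simp: small_verts_def large_verts_def mid_def)
      have "V n \<subseteq> ?S \<union> mid F \<union> ?L" by (auto simp: small_verts_def large_verts_def mid_def)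
      then have "card (V n) \<le> card (?S \<union> mid F \<union> ?L)" using fin by (intro card_mono) auto
      also have "\<dots> \<le> card ?S + card (mid F) + card ?L"
        by (meson add_le_mono1 card_Un_le order_trans)
      finally have up: "N n \<le> real (card ?S) + card (mid F) + card ?L" by linarith
      have "?S \<inter> ?L = {}" using N(2) by (auto simp: small_verts_def large_verts_def)
      then have "card ?S + card ?L = card (?S \<union> ?L)" using fin by (simp add: card_Un_disjoint)
      also have "\<dots> \<le> card (V n)" using M(1) by (intro card_mono) (auto simp: small_verts_def large_verts_def)
      finally have low: "real (card ?S) + card ?L \<le> N n" by linarith
      have "(1 - q) * N n = N n - q * N n" "\<eta> * N n = 2 * (\<eta> / 2 * N n)" by (simp_all add: left_diff_distrib)
      assume "\<eta> * N n < \<bar>real (card ?L) - (1 - q) * N n\<bar>"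
      then show "\<eta> / 2 * N n < \<bar>real (card ?S) - q * N n\<bar> \<or> \<eta> / 2 * N n < card (mid F)"
        using up low unfolding \<open>(1 - q) * N n = N n - q * N n\<close> \<open>\<eta> * N n = 2 * (\<eta> / 2 * N n)\<close> by linarith
    qed
    then show ?case using elim(1) mid by linarith
  qed
qed

lemma gap_whp:
  assumes c: "0 < c" and \<delta>: "0 < \<delta>" and \<rho>: "1 < rate c \<delta>" and "0 < \<xi>"
  shows "eventually (\<lambda>n. prob_at c n (\<lambda>F. \<exists>v\<in>V n.
     2 / ln (rate c \<delta>) * ln (N n) \<le> real (comp_size F v) \<and>
     real (comp_size F v) \<le> \<delta> * N n) < \<xi>) sequentially"
proof -
  define \<rho> where "\<rho> = rate c \<delta>"
  have \<rho>1: "1 < \<rho>" using \<rho> by (simp add: \<rho>_def)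
  have "0 < \<delta> / 2" using \<delta> by simp
  have "(\<lambda>n. (1 / c) / N n) \<longlonglongrightarrow> 0" by (rule inverse_N_tendsto)
  then have "eventually (\<lambda>n. (1 / c) / N n < \<xi>) sequentially" using assms(4) by (rule order_tendstoD(2))
  then show ?thesis
    using mixing[OF \<open>0 < \<delta> / 2\<close>] eventually_d_ge[of c] eventually_N_ge[of 1] unfolding \<rho>_def[symmetric]
  proof eventually_elim
    case (elim n)
    note M = mixing_graphD[OF elim(2)]
    have p: "0 \<le> edge_prob c n" "edge_prob c n \<le> 1" using elim(3) c by (auto simp: divide_le_eq)
    let ?k = "2 / ln \<rho> * ln (N n)"
    let ?Q = "\<lambda>v F. ?k \<le> real (comp_size F v) \<and> real (comp_size F v) \<le> \<delta> * N n"
    have "pprob (E n) (edge_prob c n) (\<lambda>F. \<exists>v\<in>V n. ?Q v F) \<le> (\<Sum>v\<in>V n. prob_at c n (?Q v))"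
      by (rule pprob_union_bound[OF p M(1)])
    also have "\<dots> \<le> (\<Sum>v\<in>V n. (1 / c) * \<rho> powr (- ?k))"
      by (intro sum_mono component_gap[OF elim(2)]) (use c elim \<rho>1 in \<open>auto simp: \<rho>_def rate_def\<close>)
    also have "\<dots> = N n * ((1 / c) * \<rho> powr (- ?k))" by simp
    also have "\<dots> = (1 / c) / N n" by (rule powr_minus_log_threshold[OF \<rho>1 elim(4)])
    finally show ?case using elim(1) by linarith
  qed
qed

text \<open>At \<open>c1\<close> the large components already hold about
  \<open>(1 - q1) * N n\<close> vertices, and the edges added on the way to \<open>c\<close> merge
  them. The value \<open>c1\<close> is later chosen close to \<open>c\<close>.\<close>

lemma giant_exists:
  assumes c: "1 < c1" "c1 < c" and q1: "extinction c1 q1" and \<delta>: "0 < \<delta>"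
    and \<rho>1: "1 < rate c1 \<delta>" and "0 < \<eta>" "0 < \<xi>" "\<eta> < 1 - q1"
  shows "eventually (\<lambda>n. prob_at c n
    (\<lambda>F. \<not> (\<exists>x\<in>V n. (1 - q1 - \<eta>) * N n \<le> real (comp_size F x))) < \<xi>) sequentially"
proof -
  let ?err = "\<lambda>n. 2 powr (1 / \<delta>) * exp (- ((c - c1) * (\<delta>\<^sup>2 / 2) * N n))"
  have "filterlim (\<lambda>n. (c - c1) * (\<delta>\<^sup>2 / 2) * N n) at_top sequentially"
    using c \<delta> by (intro filterlim_tendsto_pos_mult_at_top[OF tendsto_const _ real_N_top]) auto
  then have "filterlim (\<lambda>n. - ((c - c1) * (\<delta>\<^sup>2 / 2) * N n)) at_bot sequentially"
    by (simp add: filterlim_uminus_at_top)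
  then have "(\<lambda>n. exp (- ((c - c1) * (\<delta>\<^sup>2 / 2) * N n))) \<longlonglongrightarrow> 0" by (rule filterlim_compose[OF exp_at_bot])
  then have lim: "?err \<longlonglongrightarrow> 0" by (rule tendsto_mult_right_zero)
  have "0 < \<delta> / 2" using \<delta> by simp
  have "0 < \<xi> / 2" using assms by simp
  note err = order_tendstoD(2)[OF lim this]
  note conc = large_concentration[OF c(1) q1 \<delta> \<rho>1 assms(6) \<open>0 < \<xi> / 2\<close>]
  show ?thesis
    using err conc mixing[OF \<open>0 < \<delta> / 2\<close>] eventually_d_ge[of c] eventually_N_ge[of 1]
  proof eventually_elim
    case (elim n)
    note M = mixing_graphD[OF elim(3)]
    let ?p = "edge_prob c n" and ?p1 = "edge_prob c1 n"
    define p2 where "p2 = (?p - ?p1) / (1 - ?p1)"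
    have d: "0 < real (d n)" using elim(4) c by linarith
    have p: "0 \<le> ?p" "?p \<le> 1" "0 \<le> ?p1" "?p1 < 1" "?p1 < ?p" using elim(4) c d by (auto simp: divide_le_eq divide_less_eq divide_strict_right_mono)
    note p2 = sprinkle_parameter[OF p(3,5,2), folded p2_def]
    from p2(4) have "(?p - ?p1) * real (d n) \<le> p2 * real (d n)" by (intro mult_right_mono) auto
    then have p2d: "c - c1 \<le> p2 * real (d n)" using d by (simp add: left_diff_distrib)
    have NV: "card (V n) \<noteq> 0" using elim(5) by auto
    let ?Q = "\<lambda>F. \<not> (\<exists>x\<in>V n. (1 - q1 - \<eta>) * N n \<le> real (comp_size F x))"
    let ?bad = "\<lambda>F1. \<eta> * N n < \<bar>real (card (large \<delta> n F1)) - (1 - q1) * N n\<bar>"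
    have "pprob (E n) ?p ?Q = pexp (E n) ?p1 (\<lambda>F1. pprob (E n) p2 (\<lambda>F2. ?Q (F1 \<union> F2)))"
      by (rule pexp_sprinkle[OF M(2) p2(3)])
    also have "\<dots> \<le> pexp (E n) ?p1 (\<lambda>F1. of_bool (?bad F1) + ?err n)"
    proof (rule pexp_mono)
      fix F1 assume F1: "F1 \<subseteq> E n"
      show "pprob (E n) p2 (\<lambda>F2. ?Q (F1 \<union> F2)) \<le> of_bool (?bad F1) + ?err n"
      proof (cases "?bad F1")
        case True
        have "pprob (E n) p2 (\<lambda>F2. ?Q (F1 \<union> F2)) \<le> pexp (E n) p2 (\<lambda>_. 1)" using p2 by (intro pexp_mono) auto
        also have "\<dots> = 1" using M(2) by (simp add: pexp_const)
        finally show ?thesis using True by (simp add: add_increasing2)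
      next
        case False
        let ?L = "large \<delta> n F1"
        have big: "(1 - q1 - \<eta>) * N n \<le> real (card ?L)" using False by (simp add: algebra_simps abs_if split: if_splits)
        \<comment> \<open>Rules out an empty \<open>?L\<close>, for which merging would say
          nothing.\<close>
        have "0 < (1 - q1 - \<eta>) * N n" using assms(8) elim(5) by simp
        then have "card ?L \<noteq> 0" using big by auto
        then obtain x where x: "x \<in> ?L" by (metis card.empty equals0I)
        have "pprob (E n) p2 (\<lambda>F2. ?Q (F1 \<union> F2)) \<le> pprob (E n) p2 (\<lambda>F2. \<exists>x\<in>?L. \<not> ?L \<subseteq> reach (F1 \<union> F2) {x})"
        proof (rule pexp_mono[OF p2(1,2)])
          fix F2 assume F2: "F2 \<subseteq> E n"
          have "\<not> ?Q (F1 \<union> F2)" if "?L \<subseteq> reach (F1 \<union> F2) {x}"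
          proof -
            have "finite (reach (F1 \<union> F2) {x})"
              by (rule finite_reach) (use F1 F2 M finite_subset in auto)
            then have "card ?L \<le> comp_size (F1 \<union> F2) x" using that by (intro card_mono)
            then show ?thesis using big x by (auto simp: large_verts_def intro!: bexI[of _ x])
          qed
          then show "of_bool (?Q (F1 \<union> F2)) \<le> (of_bool (\<exists>x\<in>?L. \<not> ?L \<subseteq> reach (F1 \<union> F2) {x}) :: real)"
            using x by (auto simp: of_bool_def)
        qed
        also have "\<dots> \<le> 2 powr (1 / \<delta>) * exp (- (p2 * d n) * (card (V n) * \<delta>\<^sup>2 / 2))"
          by (rule sprinkling_merges[OF elim(3) \<delta> p2(1,2) NV F1])
        also have "\<dots> \<le> ?err n"
        proof -
          have "(c - c1) * (N n * \<delta>\<^sup>2 / 2) \<le> p2 * real (d n) * (N n * \<delta>\<^sup>2 / 2)"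
            using p2d by (intro mult_right_mono) auto
          then show ?thesis by (simp add: mult_ac)
        qed
        finally show ?thesis by simp
      qed
    qed (use p in auto)
    also have "\<dots> = pprob (E n) ?p1 ?bad + ?err n" using M(2) by (simp add: pexp_add pexp_const)
    also have "\<dots> < \<xi>" using elim(1,2) by linarith
    finally show ?case .
  qed
qed

end

section \<open>Assembling the two regimes\<close>

lemma connected_components_eq:
  assumes "\<And>e. e \<in> F \<Longrightarrow> e \<subseteq> V"
  shows "connected_components (V, F) = (\<lambda>v. reach F {v}) ` V"
proof -
  let ?R = "{(u, v). u \<in> V \<and> v \<in> V \<and> (u, v) \<in> {(x, y). {x, y} \<in> F}\<^sup>*}"
  have "?R `` {v} = reach F {v}" if "v \<in> V" for v
    using reach_subset[of F V "{v}"] assms that by (auto simp: reach_def)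
  then show ?thesis by (auto simp: connected_components_def quotient_def)
qed

lemma tendsto_const_minus_exp:
  fixes a :: real
  shows "((\<lambda>c. exp (- (c * a))) \<longlongrightarrow> exp (- (c * a))) (at_left c)"
  by (intro tendsto_intros)

context mixing_sequence
begin

abbreviation all_small :: "real \<Rightarrow> nat \<Rightarrow> 'a set set \<Rightarrow> bool" where
  "all_small C n F \<equiv> \<forall>v\<in>V n. real (comp_size F v) \<le> C * ln (N n)"

definition giant :: "real \<Rightarrow> real \<Rightarrow> real \<Rightarrow> nat \<Rightarrow> 'a set set \<Rightarrow> bool" where
  "giant q C \<eta> n F \<longleftrightarrow> (\<exists>x\<in>V n. \<bar>real (comp_size F x) - (1 - q) * N n\<bar> \<le> \<eta> * N n \<and>
     (\<forall>v\<in>V n. reach F {v} \<noteq> reach F {x} \<longrightarrow> real (comp_size F v) \<le> C * ln (N n)))"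

lemma subcritical:
  assumes c: "0 < c" "c < 1"
  shows "(\<lambda>n. prob_at c n (all_small (2 / ln (exp (c - 1) / c)) n)) \<longlonglongrightarrow> 1"
proof -
  define z where "z = exp (c - 1) / c"
  have "ln c < c - 1" using ln_le_minus_one[of c] ln_eq_minus_one[of c] c by force
  then have "exp (ln c) < exp (c - 1)" by (subst exp_less_cancel_iff)
  then have z: "1 < z" using c by (simp add: z_def)
  have ev: "eventually (\<lambda>n. mixing_graph (V n) (E n) (d n) 1 \<and> 1 \<le> real (d n) \<and> 1 \<le> N n) sequentially"
    using mixing[OF zero_less_one] eventually_d_ge[of 1] eventually_N_ge[of 1] by eventually_elim simp
  have "eventually (\<lambda>n. 1 - (1 / c) / N n \<le> prob_at c n (all_small (2 / ln z) n) \<and>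
     prob_at c n (all_small (2 / ln z) n) \<le> 1) sequentially"
    using ev
  proof eventually_elim
    case (elim n)
    then have G: "mixing_graph (V n) (E n) (d n) 1" and d: "1 \<le> real (d n)" and N1: "1 \<le> N n" by auto
    note M = mixing_graphD[OF G]
    have p: "0 \<le> edge_prob c n" "edge_prob c n \<le> 1" using d c by (auto simp: divide_le_eq)
    let ?k = "2 / ln z * ln (N n)"
    have "pprob (E n) (edge_prob c n) (\<lambda>F. \<not> all_small (2 / ln z) n F) \<le>
       (\<Sum>v\<in>V n. prob_at c n (\<lambda>F. ?k \<le> real (comp_size F v)))"
      by (rule pprob_union_bound[OF p M(1)]) force
    also have "\<dots> \<le> (\<Sum>v\<in>V n. (1 / c) * z powr (- ?k))"
      using component_tail_subcritical[OF G c] c d by (intro sum_mono) (auto simp: z_def)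
    also have "\<dots> = N n * ((1 / c) * z powr (- ?k))" by simp
    also have "\<dots> = (1 / c) / N n" by (rule powr_minus_log_threshold[OF z N1])
    finally have "pprob (E n) (edge_prob c n) (\<lambda>F. \<not> all_small (2 / ln z) n F) \<le> (1 / c) / N n" .
    moreover have "0 \<le> prob_at c n (\<lambda>F. \<not> all_small (2 / ln z) n F)"
      using p by (intro pexp_nonneg) auto
    ultimately show ?case using pprob_compl[OF M(2), of "edge_prob c n" "all_small (2 / ln z) n"] by linarith
  qed
  then have "eventually (\<lambda>n. 1 - (1 / c) / N n \<le> prob_at c n (all_small (2 / ln z) n)) sequentially"
    "eventually (\<lambda>n. prob_at c n (all_small (2 / ln z) n) \<le> 1) sequentially"
    by (eventually_elim; simp)+
  moreover have "(\<lambda>n. 1 - (1 / c) / N n) \<longlonglongrightarrow> 1 - 0" by (intro tendsto_diff tendsto_const inverse_N_tendsto)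
  then have "(\<lambda>n. 1 - (1 / c) / N n) \<longlonglongrightarrow> 1" by simp
  ultimately have "(\<lambda>n. prob_at c n (all_small (2 / ln z) n)) \<longlonglongrightarrow> 1"
    by (rule tendsto_sandwich[OF _ _ _ tendsto_const])
  then show ?thesis by (simp add: z_def)
qed

text \<open>At most \<open>(1 - q + \<eta>) * N n\<close> vertices are large and the component of
  \<open>x\<close> has at least \<open>(1 - q - 2 * \<eta>) * N n\<close>, which leaves no room for
  another one above \<open>\<delta> * N n\<close>, as \<open>\<delta> > 3 * \<eta>\<close>. So it is
  the whole set of large vertices, whose concentration gives its size within \<open>\<eta>\<close>;
  the gap bounds all others.\<close>

lemma giant_unique:
  assumes fin: "finite (V n)" and FV: "\<And>e. e \<in> F \<Longrightarrow> e \<subseteq> V n" and N: "0 < N n"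
    and L: "\<bar>real (card (large \<delta> n F)) - (1 - q) * N n\<bar> \<le> \<eta> * N n"
    and gap: "\<not> (\<exists>v\<in>V n. C * ln (N n) \<le> real (comp_size F v) \<and> real (comp_size F v) \<le> \<delta> * N n)"
    and x: "x \<in> V n" "(1 - q - 2 * \<eta>) * N n \<le> real (comp_size F x)"
    and \<eta>: "3 * \<eta> < \<delta>" "\<delta> < 1 - q - 2 * \<eta>"
  shows "giant q C \<eta> n F"
proof -
  let ?L = "large \<delta> n F"
  have finL: "finite ?L" using fin by (simp add: large_verts_def)
  have sub: "reach F {v} \<subseteq> ?L" if "v \<in> ?L" for v
    using reach_in_large_verts[OF that FV] by blast
  have "\<delta> * N n < (1 - q - 2 * \<eta>) * N n" using \<eta> N by (intro mult_strict_right_mono) auto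
  then have xL: "x \<in> ?L" using x by (simp add: large_verts_def)
  have other: "v \<notin> ?L" if "reach F {v} \<noteq> reach F {x}" for v
  proof
    assume v: "v \<in> ?L"
    have "reach F {x} \<inter> reach F {v} = {}" using reach_disjoint[of F v x] that by auto
    then have "comp_size F x + comp_size F v = card (reach F {x} \<union> reach F {v})"
      using finL sub[OF xL] sub[OF v] by (intro card_Un_disjoint[symmetric]) (auto intro: finite_subset)
    also have "\<dots> \<le> card ?L" using finL sub[OF xL] sub[OF v] by (intro card_mono) auto
    finally have "real (comp_size F x) + real (comp_size F v) \<le> real (card ?L)" by linarith
    moreover have "\<delta> * N n < real (comp_size F v)" using v by (simp add: large_verts_def)
    moreover have "3 * \<eta> * N n < \<delta> * N n" using \<eta> N by (intro mult_strict_right_mono) auto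
    ultimately show False using L x(2) by (simp add: algebra_simps)
  qed
  have "reach F {x} = ?L"
  proof (rule subset_antisym[OF sub[OF xL]], rule subsetI)
    fix v assume "v \<in> ?L"
    then have "reach F {v} = reach F {x}" using other by blast
    then show "v \<in> reach F {x}" using mem_reach[of v F] by simp
  qed
  moreover have "real (comp_size F v) \<le> C * ln (N n)" if "v \<in> V n" "reach F {v} \<noteq> reach F {x}" for v
    using gap other[OF that(2)] that(1) by (force simp: large_verts_def)
  ultimately show ?thesis unfolding giant_def using L x(1) by (intro bexI[of _ x]) auto
qed

text \<open>\<open>C\<close> comes from the rate at \<open>c\<close> and is fixed before
  \<open>\<eta>\<close>, as one constant has to serve all tolerances; only the auxiliary
  \<open>\<tau>\<close> and \<open>c1\<close> depend on \<open>\<eta>\<close>.\<close>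

lemma supercritical:
  assumes c: "1 < c" and q: "extinction c q"
  obtains C where "\<And>\<eta>. 0 < \<eta> \<Longrightarrow> eventually (\<lambda>n. prob_at c n (\<lambda>F. \<not> giant q C \<eta> n F) < \<eta>) sequentially"
proof -
  have q01: "0 < q" "q < 1" using q by (auto simp: extinction_def)
  have "ln c < c - 1" using ln_le_minus_one[of c] ln_eq_minus_one[of c] c by force
  \<comment> \<open>The penalty in \<open>rate\<close> is \<open>c * (3 / 2) * \<delta>\<close>,
    here at most half of \<open>c - 1 - ln c\<close>; the second term keeps the giant above the
    threshold \<open>\<delta> * N n\<close>.\<close>
  define \<delta> where "\<delta> = min ((c - 1 - ln c) / (3 * c)) ((1 - q) / 2)"
  have \<delta>: "0 < \<delta>" "\<delta> < 1 - q"
    using \<open>ln c < c - 1\<close> q01 c by (auto simp: \<delta>_def min_less_iff_disj)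
  have "3 * c * \<delta> \<le> c - 1 - ln c"
    using c min.cobounded1[of "(c - 1 - ln c) / (3 * c)" "(1 - q) / 2"] unfolding \<delta>_def[symmetric] by (simp add: field_simps)
  then have h: "0 < c - 1 - c * (\<delta> + \<delta> / 2) - ln c" using \<open>ln c < c - 1\<close> c \<delta> by (simp add: algebra_simps)
  have to_\<rho>: "1 < rate b \<delta>" if "0 < b - 1 - b * (\<delta> + \<delta> / 2) - ln b" "0 < b" for b
  proof -
    have "exp (ln b) < exp (b - 1 - b * (\<delta> + \<delta> / 2))" using that(1) by (subst exp_less_cancel_iff) linarith
    then show ?thesis using that by (simp add: rate_def)
  qed
  have \<rho>: "1 < rate c \<delta>" using to_\<rho>[OF h] c by simp
  define C where "C = 2 / ln (rate c \<delta>)"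
  have "eventually (\<lambda>n. prob_at c n (\<lambda>F. \<not> giant q C \<eta> n F) < \<eta>) sequentially" if \<eta>: "0 < \<eta>" for \<eta>
  proof -
    have "0 < min \<eta> (min (\<delta> / 3) ((1 - q - \<delta>) / 2))" using \<eta> \<delta> by simp
    then obtain \<tau> where "0 < \<tau>" "\<tau> < min \<eta> (min (\<delta> / 3) ((1 - q - \<delta>) / 2))" using dense by blast
    then have \<tau>: "0 < \<tau>" "\<tau> < \<eta>" "3 * \<tau> < \<delta>" "\<delta> < 1 - q - 2 * \<tau>" by simp_all
    define y where "y = q + \<tau>"
    have y: "q < y" "y < 1" using \<tau> \<delta> by (auto simp: y_def)
    then have "exp (- (c * (1 - y))) < y" using q by (simp add: extinction_def)
    then have e1: "eventually (\<lambda>b. exp (- (b * (1 - y))) < y) (at_left c)"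
      by (rule order_tendstoD(2)[OF tendsto_const_minus_exp])
    have "((\<lambda>b. b - 1 - b * (\<delta> + \<delta> / 2) - ln b) \<longlongrightarrow> c - 1 - c * (\<delta> + \<delta> / 2) - ln c) (at_left c)"
      by (intro tendsto_intros) (use c in auto)
    then have e2: "eventually (\<lambda>b. 0 < b - 1 - b * (\<delta> + \<delta> / 2) - ln b) (at_left c)"
      using h by (rule order_tendstoD(1))
    have e3: "eventually (\<lambda>b. 1 < b \<and> b < c) (at_left c)"
      using eventually_at_left_real[OF c] by eventually_elim auto
    \<comment> \<open>So close to \<open>c\<close> that its rate stays above 1 and
      \<open>y = q + \<tau>\<close> stays above \<open>exp (- (c1 * (1 - y)))\<close>. The latter
      forces \<open>q1 \<le> y\<close>, which stands in for continuity of the extinction probability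
      in \<open>c\<close>.\<close>
    obtain c1 where c1: "exp (- (c1 * (1 - y))) < y" "0 < c1 - 1 - c1 * (\<delta> + \<delta> / 2) - ln c1" "1 < c1" "c1 < c"
      using eventually_happens'[OF trivial_limit_at_left_real eventually_conj[OF e1 eventually_conj[OF e2 e3]]] by blast
    obtain q1 where q1: "extinction c1 q1" by (rule extinction_exists[OF c1(3)])
    have "q1 \<le> y"
    proof (rule ccontr)
      assume "\<not> q1 \<le> y"
      then have "y < exp (- (c1 * (1 - y)))" using q1 q01 y by (auto simp: extinction_def)
      then show False using c1(1) by simp
    qed
    then have q1q: "q1 \<le> q + \<tau>" by (simp add: y_def)
    have \<rho>1: "1 < rate c1 \<delta>" using to_\<rho>[OF c1(2)] c1 by simp
    have pos: "0 < \<eta> / 3" using \<eta> by simp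
    have \<tau>q: "\<tau> < 1 - q1" using q1q \<tau> \<delta>(1) by linarith
    have c0: "0 < c" using c by simp
    show ?thesis
      using large_concentration[OF c q \<delta>(1) \<rho> \<tau>(1) pos] gap_whp[OF c0 \<delta>(1) \<rho> pos]
        giant_exists[OF c1(3,4) q1 \<delta>(1) \<rho>1 \<tau>(1) pos \<tau>q] mixing[OF zero_less_one] eventually_d_ge[of c] eventually_N_ge[of 1]
    proof eventually_elim
      case (elim n)
      note M = mixing_graphD[OF elim(4)]
      have p: "0 \<le> edge_prob c n" "edge_prob c n \<le> 1" using elim(5) c by (auto simp: divide_le_eq)
      let ?P = "pprob (E n) (edge_prob c n)"
      let ?Q1 = "\<lambda>F. \<tau> * N n < \<bar>real (card (large \<delta> n F)) - (1 - q) * N n\<bar>"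
      let ?Q2 = "\<lambda>F. \<exists>v\<in>V n. C * ln (N n) \<le> real (comp_size F v) \<and> real (comp_size F v) \<le> \<delta> * N n"
      let ?Q3 = "\<lambda>F. \<not> (\<exists>x\<in>V n. (1 - q1 - \<tau>) * N n \<le> real (comp_size F x))"
      have "?P (\<lambda>F. \<not> giant q C \<eta> n F) \<le> ?P ?Q1 + ?P (\<lambda>F. ?Q2 F \<or> ?Q3 F)"
      proof (rule pprob_disj[OF p], rule ccontr)
        fix F assume F: "F \<subseteq> E n" and ng: "\<not> giant q C \<eta> n F" and no: "\<not> (?Q1 F \<or> ?Q2 F \<or> ?Q3 F)"
        obtain x where x: "x \<in> V n" "(1 - q1 - \<tau>) * N n \<le> real (comp_size F x)" using no by blast
        have "(1 - q - 2 * \<tau>) * N n \<le> (1 - q1 - \<tau>) * N n" using q1q by (intro mult_right_mono) auto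
        then have xb: "(1 - q - 2 * \<tau>) * N n \<le> real (comp_size F x)" using x(2) by (rule order_trans)
        have "giant q C \<tau> n F"
        proof (rule giant_unique[OF M(1) _ _ _ _ x(1) xb \<tau>(3,4)])
          show "e \<subseteq> V n" if "e \<in> F" for e using that F M(4) by blast
          show "0 < N n" using elim(6) by linarith
          show "\<bar>real (card (large \<delta> n F)) - (1 - q) * N n\<bar> \<le> \<tau> * N n" using no by linarith
        qed (use no in blast)
        moreover have "\<tau> * N n \<le> \<eta> * N n" using \<tau> by (intro mult_right_mono) auto
        ultimately have "giant q C \<eta> n F" unfolding giant_def by (blast intro: order_trans)
        then show False using ng by simp
      qed
      also have "?P (\<lambda>F. ?Q2 F \<or> ?Q3 F) \<le> ?P ?Q2 + ?P ?Q3"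
        by (rule pprob_disj[OF p])
      finally show ?case using elim(1-3) unfolding C_def[symmetric] by linarith
    qed
  qed
  then show ?thesis by (rule that)
qed

end

text \<open>Diagonal choice: \<open>\<epsilon> n\<close> is, up to \<open>1 / (n + 1)\<close>, the
  best tolerance valid at \<open>n\<close> with failure probability at most itself. Every fixed
  tolerance is valid for large \<open>n\<close>, so these optima tend to 0.\<close>

lemma tolerance_to_zero:
  fixes P :: "real \<Rightarrow> nat \<Rightarrow> real"
  assumes P: "\<And>\<eta> n. 0 \<le> P \<eta> n" "\<And>\<eta> n. P \<eta> n \<le> 1"
    and ev: "\<And>\<eta>. 0 < \<eta> \<Longrightarrow> eventually (\<lambda>n. 1 - \<eta> \<le> P \<eta> n) sequentially"
  obtains \<epsilon> where "\<epsilon> \<longlonglongrightarrow> 0" "(\<lambda>n. P (\<epsilon> n) n) \<longlonglongrightarrow> 1"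
proof -
  define S where "S n = {\<eta>. 0 < \<eta> \<and> 1 - \<eta> \<le> P \<eta> n}" for n
  have one: "1 \<in> S n" for n using P(1)[of 1 n] by (simp add: S_def)
  have bdd: "bdd_below (S n)" for n by (rule bdd_belowI[of _ 0]) (auto simp: S_def)
  have "\<exists>\<eta>\<in>S n. \<eta> < Inf (S n) + 1 / real (Suc n)" for n
    using cInf_lessD[of "S n" "Inf (S n) + 1 / real (Suc n)"] one by auto
  then obtain \<epsilon> where \<epsilon>: "\<And>n. \<epsilon> n \<in> S n" "\<And>n. \<epsilon> n < Inf (S n) + 1 / real (Suc n)" by metis
  have lim: "\<epsilon> \<longlonglongrightarrow> 0"
  proof (rule tendstoI)
    fix e :: real assume e: "0 < e"
    have "(\<lambda>n. 1 / real (Suc n)) \<longlonglongrightarrow> 0" using LIMSEQ_inverse_real_of_nat by (simp add: inverse_eq_divide)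
    then have "eventually (\<lambda>n. 1 / real (Suc n) < e / 2) sequentially" using e by (intro order_tendstoD(2)) auto
    moreover have "eventually (\<lambda>n. 1 - e / 2 \<le> P (e / 2) n) sequentially" using ev[of "e / 2"] e by simp
    ultimately show "eventually (\<lambda>n. dist (\<epsilon> n) 0 < e) sequentially"
    proof eventually_elim
      case (elim n)
      have "e / 2 \<in> S n" using elim e by (simp add: S_def)
      then have "Inf (S n) \<le> e / 2" by (rule cInf_lower[OF _ bdd])
      then have "\<epsilon> n < e" using \<epsilon>(2)[of n] elim by linarith
      moreover have "0 < \<epsilon> n" using \<epsilon>(1)[of n] by (simp add: S_def)
      ultimately show ?case by simp
    qed
  qed
  have "(\<lambda>n. 1 - \<epsilon> n) \<longlonglongrightarrow> 1 - 0" by (intro tendsto_diff tendsto_const lim)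
  then have low: "(\<lambda>n. 1 - \<epsilon> n) \<longlonglongrightarrow> 1" by simp
  have "\<forall>n. 1 - \<epsilon> n \<le> P (\<epsilon> n) n" using \<epsilon>(1) by (simp add: S_def)
  moreover have "\<forall>n. P (\<epsilon> n) n \<le> 1" using P(2) by blast
  ultimately have "(\<lambda>n. P (\<epsilon> n) n) \<longlonglongrightarrow> 1"
    by (rule tendsto_sandwich[OF always_eventually always_eventually low tendsto_const])
  with lim show ?thesis by (rule that)
qed

theorem theorem6:
  fixes \<alpha> :: real and f_r f_s :: "nat \<Rightarrow> real" and r s d N :: "nat \<Rightarrow> nat"
    and G :: "nat \<Rightarrow> (nat \<Rightarrow> nat) graph"
  assumes "0 < \<alpha>" and "\<alpha> < 1"
    and "f_r \<in> o(\<lambda>n. real n)" and "f_s \<in> o(\<lambda>n. real n)"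
    and "\<And>n. real (r n) = \<alpha> * real n + f_r n"
    and "\<And>n. real (s n) = \<alpha>\<^sup>2 * real n + f_s n"
    and "\<And>n. G n = johnson_graph n (r n) (s n)"
    and "\<And>n. d n = regular_degree (G n)"
    and "\<And>n. N n = n choose r n"
  shows "(\<forall>c::real. 0 < c \<and> c < 1 \<longrightarrow>
           (\<exists>C. with_high_probability (\<lambda>n. random_subgraph (G n) (c / real (d n)))
              (\<lambda>n H. \<forall>K\<in>connected_components H. real (card K) \<le> C * ln (real (N n))))) \<and>
         (\<forall>c::real. 1 < c \<longrightarrow>
           (\<exists>\<epsilon> C. \<epsilon> \<longlonglongrightarrow> 0 \<and>
              with_high_probability (\<lambda>n. random_subgraph (G n) (c / real (d n)))
              (\<lambda>n H. \<exists>K\<in>connected_components H.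
                 (\<exists>\<delta>. \<bar>\<delta>\<bar> \<le> \<epsilon> n \<and>
                    real (card K) = (1 + \<delta>) * (1 - conjugate_solution c / c) * real (N n)) \<and>
                 (\<forall>K'\<in>connected_components H. K' \<noteq> K \<longrightarrow>
                    real (card K') \<le> C * ln (real (N n))))))"
proof -
  define V where "V n = verts (G n)" for n
  define E where "E n = edges (G n)" for n
  note js = johnson_sequence[OF assms]
  have cV: "card (V n) = N n" for n using js(3) by (simp add: V_def)
  interpret mixing_sequence V E d
    by standard (use js in \<open>simp_all add: V_def E_def\<close>)
  have GVE: "G n = (V n, E n)" for n by (simp add: V_def E_def)
  \<comment> \<open>Stated for large \<open>n\<close>, where \<open>c / d n \<le> 1\<close> and
    mixing supplies finiteness and edges inside the vertex set.\<close>
  have prob: "eventually (\<lambda>n. measure_pmf.prob (random_subgraph (G n) (c / real (d n))) {H. Q n H}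
      = prob_at c n (\<lambda>F. Q n (V n, F)) \<and> (\<forall>F\<subseteq>E n. connected_components (V n, F) = (\<lambda>v. reach F {v}) ` V n)) sequentially"
    if "0 < c" for c Q
    using mixing[OF zero_less_one] eventually_d_ge[of c]
  proof eventually_elim
    case (elim n)
    note M = mixing_graphD[OF elim(1)]
    have "0 \<le> edge_prob c n" "edge_prob c n \<le> 1" using elim(2) that by (auto simp: divide_le_eq)
    then have "measure_pmf.prob (random_subgraph (G n) (c / real (d n))) {H. Q n H}
      = prob_at c n (\<lambda>F. Q n (V n, F))"
      using prob_random_subgraph[of "G n" "edge_prob c n" "Q n"] M(2) by (simp add: GVE)
    moreover have "connected_components (V n, F) = (\<lambda>v. reach F {v}) ` V n" if "F \<subseteq> E n" for F
      using M(4) that by (intro connected_components_eq) auto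
    ultimately show ?case by blast
  qed
  show ?thesis
  proof (intro conjI allI impI, goal_cases)
    case c: (1 c)
    then have c0: "0 < c" by simp
    define C where "C = 2 / ln (exp (c - 1) / c)"
    let ?Q = "\<lambda>n H. \<forall>K\<in>connected_components H. real (card K) \<le> C * ln (real (N n))"
    have "(\<lambda>n. measure_pmf.prob (random_subgraph (G n) (c / real (d n))) {H. ?Q n H}) \<longlonglongrightarrow> 1"
    proof (rule Lim_transform_eventually)
      show "(\<lambda>n. prob_at c n (all_small C n)) \<longlonglongrightarrow> 1"
        using subcritical c by (simp add: C_def)
      show "eventually (\<lambda>n. prob_at c n (all_small C n) =
         measure_pmf.prob (random_subgraph (G n) (c / real (d n))) {H. ?Q n H}) sequentially"
        using prob[OF c0, of ?Q]
      proof eventually_elim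
        case (elim n)
        have "pprob (E n) (edge_prob c n) (all_small C n) = prob_at c n (\<lambda>F. ?Q n (V n, F))"
          using elim by (intro pexp_cong) (simp add: cV)
        then show ?case using elim by simp
      qed
    qed
    then show ?case
      unfolding with_high_probability_def by blast
  next
    case c: (2 c)
    obtain q where q: "extinction c q" "conjugate_solution c = c * q" by (rule extinction_exists[OF c])
    have q1: "0 < 1 - q" using q(1) by (simp add: extinction_def)
    have cq: "conjugate_solution c / c = q" using q(2) c by simp
    obtain C where C: "\<And>\<eta>. 0 < \<eta> \<Longrightarrow>
       eventually (\<lambda>n. prob_at c n (\<lambda>F. \<not> giant q C \<eta> n F) < \<eta>) sequentially"
      by (rule supercritical[OF c q(1)]) blast
    let ?Q = "\<lambda>\<eta> n H. \<exists>K\<in>connected_components H.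
                 (\<exists>\<delta>. \<bar>\<delta>\<bar> \<le> \<eta> \<and> real (card K) = (1 + \<delta>) * (1 - q) * real (N n)) \<and>
                 (\<forall>K'\<in>connected_components H. K' \<noteq> K \<longrightarrow> real (card K') \<le> C * ln (real (N n)))"
    define P where "P \<eta> n = measure_pmf.prob (random_subgraph (G n) (c / real (d n))) {H. ?Q \<eta> n H}" for \<eta> n
    have ev: "eventually (\<lambda>n. 1 - \<eta> \<le> P \<eta> n) sequentially" if \<eta>: "0 < \<eta>" for \<eta>
    proof -
      \<comment> \<open>Turns an error relative to \<open>N n\<close> into one relative to the size
        \<open>(1 - q) * N n\<close> of the giant; \<open>\<tau> \<le> \<eta>\<close> keeps the
        failure probability below \<open>\<eta>\<close>.\<close>
      define \<tau> where "\<tau> = \<eta> * (1 - q)"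
      have \<tau>: "0 < \<tau>" "\<tau> \<le> \<eta>" using \<eta> q1 q(1) by (auto simp: \<tau>_def extinction_def algebra_simps)
      have c0: "0 < c" using c by simp
      show ?thesis
        using C[OF \<tau>(1)] prob[OF c0, of "?Q \<eta>"] mixing[OF zero_less_one] eventually_d_ge[of c] eventually_N_ge[of 1]
      proof eventually_elim
        case (elim n)
        note M = mixing_graphD[OF elim(3)]
        have p: "0 \<le> edge_prob c n" "edge_prob c n \<le> 1" using elim(4) c by (auto simp: divide_le_eq)
        have "pprob (E n) (edge_prob c n) (giant q C \<tau> n) \<le> prob_at c n (\<lambda>F. ?Q \<eta> n (V n, F))"
        proof (rule pexp_mono[OF p])
          fix F assume F: "F \<subseteq> E n"
          have "?Q \<eta> n (V n, F)" if g: "giant q C \<tau> n F"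
          proof -
            obtain x where x: "x \<in> V n" "\<bar>real (comp_size F x) - (1 - q) * N n\<bar> \<le> \<tau> * N n"
              "\<And>v. v \<in> V n \<Longrightarrow> reach F {v} \<noteq> reach F {x} \<Longrightarrow> real (comp_size F v) \<le> C * ln (N n)"
              using g unfolding giant_def cV by blast
            define m where "m = (1 - q) * real (N n)"
            define \<delta> where "\<delta> = real (comp_size F x) / m - 1"
            have m: "0 < m" using q1 elim(5) by (simp add: m_def cV)
            have \<delta>m: "\<delta> * m = real (comp_size F x) - m"
              using m by (simp add: \<delta>_def left_diff_distrib)
            have "\<bar>\<delta>\<bar> * m = \<bar>\<delta> * m\<bar>" using m by (simp add: abs_mult)
            also have "\<dots> \<le> \<eta> * m" using x(2) unfolding \<delta>m by (simp add: m_def \<tau>_def)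
            finally have "\<bar>\<delta>\<bar> \<le> \<eta>" using m by (simp only: mult_le_cancel_right_pos)
            moreover have "real (comp_size F x) = (1 + \<delta>) * (1 - q) * real (N n)"
              using \<delta>m by (simp add: m_def algebra_simps)
            ultimately show ?thesis using elim(2) F x by (intro bexI[of _ "reach F {x}"]) auto
          qed
          then show "of_bool (giant q C \<tau> n F) \<le> (of_bool (?Q \<eta> n (V n, F)) :: real)"
            unfolding of_bool_less_eq_iff by (rule impI)
        qed
        then have "pprob (E n) (edge_prob c n) (giant q C \<tau> n) \<le> P \<eta> n" using elim(2) by (simp add: P_def)
        then show ?case
          using elim(1) \<tau>(2) pprob_compl[OF M(2), of "edge_prob c n" "giant q C \<tau> n"] by linarith
      qed
    qed
    have "0 \<le> P \<eta> n" "P \<eta> n \<le> 1" for \<eta> n by (simp_all add: P_def)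
    then obtain \<epsilon> where "\<epsilon> \<longlonglongrightarrow> 0" "(\<lambda>n. P (\<epsilon> n) n) \<longlonglongrightarrow> 1"
      using tolerance_to_zero[of P] ev by blast
    then show ?case
      unfolding with_high_probability_def cq P_def by (intro exI conjI)
  qed
qed

end
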